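(* Let $\mathsf{C}$ be a strict braided monoidal category. The functor $\Lambda\colon\mathsf{HTr}^{\star}\to\mathsf{wtr}\text{-}\mathsf{RB}^{\star}$, given by $\Lambda(H_1,H_2,\sigma_H)=(\mathrm{id}_{H}\colon H_{1}\to H_{2},\Gamma_{H_{1}}^{\sigma_{H}},\sigma_{H})$ on objects and $\Lambda(f)=(f,f)$ on morphisms, is left adjoint to the functor $\Omega\colon\mathsf{wtr}\text{-}\mathsf{RB}^{\star}\to\mathsf{HTr}^{\star}$, given by $\Omega(T\colon H\to B,\varphi_H,\Psi_H)=(H,\widetilde{H},\Psi_H)$ on objects and $\Omega((f,g))=f$ on morphisms, where $\widetilde{H}=(H,\widetilde{\mu}_{H},\varepsilon_{H},\delta_{H})$ and $\widetilde{\mu}_{H}:=\mu_{H}\circ(\Psi_{H}\otimes(\varphi_H\circ(T\otimes H)))\circ(\delta_{H}\otimes H)$.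
   Context: $\mathsf{C}=(\mathsf{C},\otimes,K,c)$ is a strict braided monoidal category with unit object $K$ and braiding $c_{M,N}\colon M\otimes N\to N\otimes M$. For an object $X$ and a morphism $f$, $X\otimes f$ and $f\otimes X$ denote $\mathrm{id}_X\otimes f$ and $f\otimes \mathrm{id}_X$. A Hopf algebra in $\mathsf{C}$ is $H=(H,\eta_H,\mu_H,\varepsilon_H,\delta_H,\lambda_H)$ (unit, product, counit, coproduct, antipode). A Hopf algebra morphism is an algebra and coalgebra morphism. The tensor product $D\otimes E$ of coalgebras has coproduct $(D\otimes c_{D,E}\otimes E)\circ(\delta_D\otimes\delta_E)$ and counit $\varepsilon_D\otimes\varepsilon_E$. A non-unital bialgebra $(X,\mu_X,\varepsilon_X,\delta_X)$ is a coalgebra with an associative product $\mu_X$ that is a coalgebra morphism (no unit required); a morphism of non-unital bialgebras is a coalgebra morphism preserving products. Hopf truss: $\mathbb{H}=(H_1,H_2,\sigma_H)$ where $(H,\varepsilon_H,\delta_H)$ is a coalgebra, $H_1=(H,\eta_H,\mu_H^1,\varepsilon_H,\delta_H,\lambda_H)$ is a Hopf algebra, $H_2=(H,\mu_H^2,\varepsilon_H,\delta_H)$ is a non-unital bialgebra, and $\sigma_H\colon H\to H$ is a coalgebra morphism such that $\mu_{H}^{2}\circ(H\otimes\mu_{H}^{1})=\mu_{H}^{1}\circ(\mu_{H}^{2}\otimes\Gamma_{H_{1}}^{\sigma_{H}})\circ(H\otimes c_{H,H}\otimes H)\circ(\delta_{H}\otimes H\otimes H)$, where $\Gamma_{H_{1}}^{\sigma_{H}}:=\mu_{H}^{1}\circ((\lambda_{H}\circ\sigma_{H})\otimes\mu_{H}^{2})\circ(\delta_{H}\otimes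 H)$. A morphism of Hopf trusses $(H_1,H_2,\sigma_H)\to(B_1,B_2,\sigma_B)$ is a morphism $f$ that is a Hopf algebra morphism $H_1\to B_1$ and a morphism of non-unital bialgebras $H_2\to B_2$. $\mathsf{HTr}^{\star}$ is the full subcategory on those Hopf trusses with $(\Gamma_{H_{1}}^{\sigma_{H}}\otimes H)\circ(H\otimes c_{H,H})\circ((c_{H,H}\circ\delta_{H})\otimes H)=(\Gamma_{H_{1}}^{\sigma_{H}}\otimes H)\circ(H\otimes c_{H,H})\circ(\delta_{H}\otimes H)$. Weak twisted relative Rota–Baxter operator $(T\colon H\to B,\varphi_H,\Psi_H)$: $H$ is a Hopf algebra, $B=(B,\mu_B,\varepsilon_B,\delta_B)$ a non-unital bialgebra, $\varphi_H\colon B\otimes H\to H$ makes $H$ a non-unital left $B$-module algebra-coalgebra, i.e. $\varphi_H\circ(B\otimes\varphi_H)=\varphi_H\circ(\mu_B\otimes H)$, $\varphi_H\circ(B\otimes\eta_H)=\varepsilon_B\otimes\eta_H$, $\varphi_H\circ(B\otimes\mu_H)=\mu_H\circ(\varphi_H\otimes\varphi_H)\circ(B\otimes c_{B,H}\otimes H)\circ(\delta_B\otimes H\otimes H)$, and $\varphi_H$ is a coalgebra morphism; $T\colon H\to B$ and $\Psi_H\colon H\to H$ are coalgebra morphisms such that, with $\mathfrak{m}_H:=\varphi_H\circ(T\otimes H)$, (i) $\mu_{B}\circ(T\otimes T)=T\circ\mu_{H}\circ(\Psi_{H}\otimes\mathfrak{m}_H)\circ(\delta_{H}\otimes H)$ and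 (ii) $\Psi_{H}\circ\mu_{H}\circ(\Psi_{H}\otimes\mathfrak{m}_H)\circ(\delta_{H}\otimes H)=\mu_{H}\circ(\Psi_{H}\otimes\mathfrak{m}_H)\circ(\delta_{H}\otimes\Psi_{H})$. A morphism $(T\colon H\to B,\varphi_H,\Psi_H)\to(T'\colon H'\to B',\varphi_{H'},\Psi_{H'})$ is a pair $(f,g)$ with $f\colon H\to H'$ a Hopf algebra morphism and $g\colon B\to B'$ a morphism of non-unital bialgebras such that $T'\circ f=g\circ T$, $f\circ\Psi_H=\Psi_{H'}\circ f$, $f\circ\varphi_H=\varphi_{H'}\circ(g\otimes f)$. $\mathsf{wtr}\text{-}\mathsf{RB}^{\star}$ is the full subcategory on those objects with $(\mathfrak{m}_{H}\otimes H)\circ(H\otimes c_{H,H})\circ((c_{H,H}\circ\delta_{H})\otimes H)=(\mathfrak{m}_{H}\otimes H)\circ(H\otimes c_{H,H})\circ(\delta_{H}\otimes H)$. The assignments $\Lambda$ and $\Omega$ are well-defined functors. *)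

theory Defs
  imports Main
begin

section \<open>Categories, functors and adjunctions\<close>

record ('o, 'm) category =
  Obj :: "'o set"
  Arr :: "'m set"
  Dom :: "'m \<Rightarrow> 'o"
  Cod :: "'m \<Rightarrow> 'o"
  Ident :: "'o \<Rightarrow> 'm"  ("\<one>\<index>")
  Comp :: "'m \<Rightarrow> 'm \<Rightarrow> 'm"  (infixr "\<cdot>\<index>" 55)

definition Hom :: "('o, 'm, 'z) category_scheme \<Rightarrow> 'o \<Rightarrow> 'o \<Rightarrow> 'm set"
  where "Hom C X Y = {f \<in> Arr C. Dom C f = X \<and> Cod C f = Y}"

locale category =
  fixes C :: "('o, 'm, 'z) category_scheme" (structure)
  assumes Dom_Obj: "f \<in> Arr C \<Longrightarrow> Dom C f \<in> Obj C"
    and Cod_Obj: "f \<in> Arr C \<Longrightarrow> Cod C f \<in> Obj C"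
    and Ident_Hom: "X \<in> Obj C \<Longrightarrow> \<one> X \<in> Hom C X X"
    and Comp_Hom: "f \<in> Hom C X Y \<Longrightarrow> g \<in> Hom C Y Z \<Longrightarrow> g \<cdot> f \<in> Hom C X Z"
    and Comp_Ident: "f \<in> Hom C X Y \<Longrightarrow> f \<cdot> \<one> X = f"
    and Ident_Comp: "f \<in> Hom C X Y \<Longrightarrow> \<one> Y \<cdot> f = f"
    and Comp_assoc: "f \<in> Hom C W X \<Longrightarrow> g \<in> Hom C X Y \<Longrightarrow> h \<in> Hom C Y Z
        \<Longrightarrow> (h \<cdot> g) \<cdot> f = h \<cdot> (g \<cdot> f)"

definition full_subcategory :: "('o, 'm) category \<Rightarrow> 'o set \<Rightarrow> ('o, 'm) category"
  where "full_subcategory C S =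
    C\<lparr>Obj := Obj C \<inter> S, Arr := {f \<in> Arr C. Dom C f \<in> S \<and> Cod C f \<in> S}\<rparr>"

record ('o, 'm, 'p, 'n) functor_data =
  OMap :: "'o \<Rightarrow> 'p"
  AMap :: "'m \<Rightarrow> 'n"

locale is_functor =
  C: category C + D: category D
  for C :: "('o, 'm, 'y) category_scheme" and D :: "('p, 'n, 'z) category_scheme" +
  fixes F :: "('o, 'm, 'p, 'n) functor_data"
  assumes OMap_Obj: "X \<in> Obj C \<Longrightarrow> OMap F X \<in> Obj D"
    and AMap_Hom: "f \<in> Hom C X Y \<Longrightarrow> AMap F f \<in> Hom D (OMap F X) (OMap F Y)"
    and AMap_Ident: "X \<in> Obj C \<Longrightarrow> AMap F (\<one>\<^bsub>C\<^esub> X) = \<one>\<^bsub>D\<^esub> (OMap F X)"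
    and AMap_Comp: "f \<in> Hom C X Y \<Longrightarrow> g \<in> Hom C Y Z
        \<Longrightarrow> AMap F (g \<cdot>\<^bsub>C\<^esub> f) = AMap F g \<cdot>\<^bsub>D\<^esub> AMap F f"

text \<open>\<^term>\<open>F\<close> is left adjoint to \<^term>\<open>G\<close>: there are bijections
  \<open>D(F X, Y) \<cong> C(X, G Y)\<close>, natural in \<^term>\<open>X\<close> and \<^term>\<open>Y\<close>.\<close>

definition left_adjoint ::
    "('o, 'm, 'y) category_scheme \<Rightarrow> ('p, 'n, 'z) category_scheme \<Rightarrow>
     ('o, 'm, 'p, 'n) functor_data \<Rightarrow> ('p, 'n, 'o, 'm) functor_data \<Rightarrow> bool"
  where "left_adjoint C D F G \<longleftrightarrow>
    is_functor C D F \<and> is_functor D C G \<and>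
    (\<exists>\<Phi> :: 'o \<Rightarrow> 'p \<Rightarrow> 'n \<Rightarrow> 'm.
      (\<forall>X \<in> Obj C. \<forall>Y \<in> Obj D.
        bij_betw (\<Phi> X Y) (Hom D (OMap F X) Y) (Hom C X (OMap G Y))) \<and>
      (\<forall>X X' Y Y' h k f.
        h \<in> Hom C X' X \<longrightarrow> k \<in> Hom D Y Y' \<longrightarrow> f \<in> Hom D (OMap F X) Y \<longrightarrow>
        \<Phi> X' Y' (k \<cdot>\<^bsub>D\<^esub> f \<cdot>\<^bsub>D\<^esub> AMap F h) = AMap G k \<cdot>\<^bsub>C\<^esub> \<Phi> X Y f \<cdot>\<^bsub>C\<^esub> h))"


section \<open>Strict braided monoidal categories\<close>

record ('o, 'm) braided_category = "('o, 'm) category" +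
  Unit :: 'o  ("\<K>\<index>")
  OTensor :: "'o \<Rightarrow> 'o \<Rightarrow> 'o"  (infixr "\<boxtimes>\<index>" 70)
  ATensor :: "'m \<Rightarrow> 'm \<Rightarrow> 'm"  (infixr "\<otimes>\<index>" 70)
  Braid :: "'o \<Rightarrow> 'o \<Rightarrow> 'm"  ("\<c>\<index>")

locale strict_monoidal_category = category C
  for C :: "('o, 'm, 'z) braided_category_scheme" (structure) +
  assumes Unit_Obj: "\<K> \<in> Obj C"
    and OTensor_Obj: "X \<in> Obj C \<Longrightarrow> Y \<in> Obj C \<Longrightarrow> X \<boxtimes> Y \<in> Obj C"
    and ATensor_Hom: "f \<in> Hom C X Y \<Longrightarrow> g \<in> Hom C X' Y'
        \<Longrightarrow> f \<otimes> g \<in> Hom C (X \<boxtimes> X') (Y \<boxtimes> Y')"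
    and ATensor_Ident: "X \<in> Obj C \<Longrightarrow> Y \<in> Obj C \<Longrightarrow> \<one> X \<otimes> \<one> Y = \<one> (X \<boxtimes> Y)"
    and ATensor_Comp: "f \<in> Hom C X Y \<Longrightarrow> g \<in> Hom C Y Z \<Longrightarrow> f' \<in> Hom C X' Y' \<Longrightarrow> g' \<in> Hom C Y' Z'
        \<Longrightarrow> (g \<cdot> f) \<otimes> (g' \<cdot> f') = (g \<otimes> g') \<cdot> (f \<otimes> f')"
    and OTensor_assoc: "X \<in> Obj C \<Longrightarrow> Y \<in> Obj C \<Longrightarrow> Z \<in> Obj C
        \<Longrightarrow> (X \<boxtimes> Y) \<boxtimes> Z = X \<boxtimes> (Y \<boxtimes> Z)"
    and ATensor_assoc: "f \<in> Arr C \<Longrightarrow> g \<in> Arr C \<Longrightarrow> h \<in> Arr C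
        \<Longrightarrow> (f \<otimes> g) \<otimes> h = f \<otimes> (g \<otimes> h)"
    and Unit_OTensor: "X \<in> Obj C \<Longrightarrow> \<K> \<boxtimes> X = X"
    and OTensor_Unit: "X \<in> Obj C \<Longrightarrow> X \<boxtimes> \<K> = X"
    and Unit_ATensor: "f \<in> Arr C \<Longrightarrow> \<one> \<K> \<otimes> f = f"
    and ATensor_Unit: "f \<in> Arr C \<Longrightarrow> f \<otimes> \<one> \<K> = f"

locale strict_braided_monoidal_category = strict_monoidal_category +
  assumes Braid_Hom: "X \<in> Obj C \<Longrightarrow> Y \<in> Obj C \<Longrightarrow> \<c> X Y \<in> Hom C (X \<boxtimes> Y) (Y \<boxtimes> X)"
    and Braid_iso: "X \<in> Obj C \<Longrightarrow> Y \<in> Obj C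
        \<Longrightarrow> \<exists>d \<in> Hom C (Y \<boxtimes> X) (X \<boxtimes> Y). d \<cdot> \<c> X Y = \<one> (X \<boxtimes> Y) \<and> \<c> X Y \<cdot> d = \<one> (Y \<boxtimes> X)"
    and Braid_natural: "f \<in> Hom C X X' \<Longrightarrow> g \<in> Hom C Y Y'
        \<Longrightarrow> \<c> X' Y' \<cdot> (f \<otimes> g) = (g \<otimes> f) \<cdot> \<c> X Y"
    and Braid_OTensor_right: "X \<in> Obj C \<Longrightarrow> Y \<in> Obj C \<Longrightarrow> Z \<in> Obj C
        \<Longrightarrow> \<c> X (Y \<boxtimes> Z) = (\<one> Y \<otimes> \<c> X Z) \<cdot> (\<c> X Y \<otimes> \<one> Z)"
    and Braid_OTensor_left: "X \<in> Obj C \<Longrightarrow> Y \<in> Obj C \<Longrightarrow> Z \<in> Obj C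
        \<Longrightarrow> \<c> (X \<boxtimes> Y) Z = (\<c> X Z \<otimes> \<one> Y) \<cdot> (\<one> X \<otimes> \<c> Y Z)"


section \<open>Coalgebras, non-unital bialgebras and Hopf algebras\<close>

text \<open>The records extend each other, so every predicate on coalgebras or non-unital bialgebras
  also applies to a Hopf algebra, by forgetting structure.\<close>

record ('o, 'm) coalgebra_data =
  car :: 'o
  counit :: 'm  ("\<epsilon>\<index>")
  coproduct :: 'm  ("\<delta>\<index>")

record ('o, 'm) bialgebra_data = "('o, 'm) coalgebra_data" +
  product :: 'm  ("\<mu>\<index>")

record ('o, 'm) hopf_data = "('o, 'm) bialgebra_data" +
  unit :: 'm  ("\<eta>\<index>")
  antipode :: 'm  ("\<S>\<index>")

definition coalgebra ::
    "('o, 'm, 'c) braided_category_scheme \<Rightarrow> ('o, 'm, 'z) coalgebra_data_scheme \<Rightarrow> bool"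
  where "coalgebra C D \<longleftrightarrow>
    car D \<in> Obj C \<and>
    \<epsilon>\<^bsub>D\<^esub> \<in> Hom C (car D) \<K> \<and>
    \<delta>\<^bsub>D\<^esub> \<in> Hom C (car D) (car D \<boxtimes> car D) \<and>
    (\<delta>\<^bsub>D\<^esub> \<otimes> \<one> (car D)) \<cdot> \<delta>\<^bsub>D\<^esub> = (\<one> (car D) \<otimes> \<delta>\<^bsub>D\<^esub>) \<cdot> \<delta>\<^bsub>D\<^esub> \<and>
    (\<epsilon>\<^bsub>D\<^esub> \<otimes> \<one> (car D)) \<cdot> \<delta>\<^bsub>D\<^esub> = \<one> (car D) \<and>
    (\<one> (car D) \<otimes> \<epsilon>\<^bsub>D\<^esub>) \<cdot> \<delta>\<^bsub>D\<^esub> = \<one> (car D)"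
  for C (structure)

definition unit_coalgebra ::
    "('o, 'm, 'c) braided_category_scheme \<Rightarrow> ('o, 'm) coalgebra_data"
  where "unit_coalgebra C = \<lparr>car = \<K>, counit = \<one> \<K>, coproduct = \<one> \<K>\<rparr>"
  for C (structure)

definition tensor_coalgebra ::
    "('o, 'm, 'c) braided_category_scheme \<Rightarrow> ('o, 'm, 'y) coalgebra_data_scheme \<Rightarrow>
     ('o, 'm, 'z) coalgebra_data_scheme \<Rightarrow> ('o, 'm) coalgebra_data"
  where "tensor_coalgebra C D E =
    \<lparr>car = car D \<boxtimes> car E,
     counit = \<epsilon>\<^bsub>D\<^esub> \<otimes> \<epsilon>\<^bsub>E\<^esub>,
     coproduct = (\<one> (car D) \<otimes> \<c> (car D) (car E) \<otimes> \<one> (car E)) \<cdot> (\<delta>\<^bsub>D\<^esub> \<otimes> \<delta>\<^bsub>E\<^esub>)\<rparr>"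
  for C (structure)

definition coalgebra_morphism ::
    "('o, 'm, 'c) braided_category_scheme \<Rightarrow> ('o, 'm, 'y) coalgebra_data_scheme \<Rightarrow>
     ('o, 'm, 'z) coalgebra_data_scheme \<Rightarrow> 'm \<Rightarrow> bool"
  where "coalgebra_morphism C D E f \<longleftrightarrow>
    f \<in> Hom C (car D) (car E) \<and>
    \<epsilon>\<^bsub>E\<^esub> \<cdot> f = \<epsilon>\<^bsub>D\<^esub> \<and>
    \<delta>\<^bsub>E\<^esub> \<cdot> f = (f \<otimes> f) \<cdot> \<delta>\<^bsub>D\<^esub>"
  for C (structure)

definition nonunital_bialgebra ::
    "('o, 'm, 'c) braided_category_scheme \<Rightarrow> ('o, 'm, 'z) bialgebra_data_scheme \<Rightarrow> bool"
  where "nonunital_bialgebra C X \<longleftrightarrow>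
    coalgebra C X \<and>
    \<mu>\<^bsub>X\<^esub> \<in> Hom C (car X \<boxtimes> car X) (car X) \<and>
    \<mu>\<^bsub>X\<^esub> \<cdot> (\<mu>\<^bsub>X\<^esub> \<otimes> \<one> (car X)) = \<mu>\<^bsub>X\<^esub> \<cdot> (\<one> (car X) \<otimes> \<mu>\<^bsub>X\<^esub>) \<and>
    coalgebra_morphism C (tensor_coalgebra C X X) X \<mu>\<^bsub>X\<^esub>"
  for C (structure)

definition nonunital_bialgebra_morphism ::
    "('o, 'm, 'c) braided_category_scheme \<Rightarrow> ('o, 'm, 'y) bialgebra_data_scheme \<Rightarrow>
     ('o, 'm, 'z) bialgebra_data_scheme \<Rightarrow> 'm \<Rightarrow> bool"
  where "nonunital_bialgebra_morphism C X Y f \<longleftrightarrow>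
    coalgebra_morphism C X Y f \<and> f \<cdot> \<mu>\<^bsub>X\<^esub> = \<mu>\<^bsub>Y\<^esub> \<cdot> (f \<otimes> f)"
  for C (structure)

definition hopf_algebra ::
    "('o, 'm, 'c) braided_category_scheme \<Rightarrow> ('o, 'm, 'z) hopf_data_scheme \<Rightarrow> bool"
  where "hopf_algebra C H \<longleftrightarrow>
    nonunital_bialgebra C H \<and>
    \<eta>\<^bsub>H\<^esub> \<in> Hom C \<K> (car H) \<and>
    \<mu>\<^bsub>H\<^esub> \<cdot> (\<eta>\<^bsub>H\<^esub> \<otimes> \<one> (car H)) = \<one> (car H) \<and>
    \<mu>\<^bsub>H\<^esub> \<cdot> (\<one> (car H) \<otimes> \<eta>\<^bsub>H\<^esub>) = \<one> (car H) \<and>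
    coalgebra_morphism C (unit_coalgebra C) H \<eta>\<^bsub>H\<^esub> \<and>
    \<S>\<^bsub>H\<^esub> \<in> Hom C (car H) (car H) \<and>
    \<mu>\<^bsub>H\<^esub> \<cdot> (\<S>\<^bsub>H\<^esub> \<otimes> \<one> (car H)) \<cdot> \<delta>\<^bsub>H\<^esub> = \<eta>\<^bsub>H\<^esub> \<cdot> \<epsilon>\<^bsub>H\<^esub> \<and>
    \<mu>\<^bsub>H\<^esub> \<cdot> (\<one> (car H) \<otimes> \<S>\<^bsub>H\<^esub>) \<cdot> \<delta>\<^bsub>H\<^esub> = \<eta>\<^bsub>H\<^esub> \<cdot> \<epsilon>\<^bsub>H\<^esub>"
  for C (structure)

definition hopf_algebra_morphism ::
    "('o, 'm, 'c) braided_category_scheme \<Rightarrow> ('o, 'm, 'y) hopf_data_scheme \<Rightarrow>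
     ('o, 'm, 'z) hopf_data_scheme \<Rightarrow> 'm \<Rightarrow> bool"
  where "hopf_algebra_morphism C H B f \<longleftrightarrow>
    coalgebra_morphism C H B f \<and>
    f \<cdot> \<mu>\<^bsub>H\<^esub> = \<mu>\<^bsub>B\<^esub> \<cdot> (f \<otimes> f) \<and>
    f \<cdot> \<eta>\<^bsub>H\<^esub> = \<eta>\<^bsub>B\<^esub>"
  for C (structure)


section \<open>Hopf trusses\<close>

type_synonym ('o, 'm) truss = "('o, 'm) hopf_data \<times> ('o, 'm) bialgebra_data \<times> 'm"

definition Gamma ::
    "('o, 'm, 'c) braided_category_scheme \<Rightarrow> ('o, 'm) hopf_data \<Rightarrow> ('o, 'm) bialgebra_data \<Rightarrow>
     'm \<Rightarrow> 'm"
  where "Gamma C H1 H2 \<sigma> =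
    \<mu>\<^bsub>H1\<^esub> \<cdot> ((\<S>\<^bsub>H1\<^esub> \<cdot> \<sigma>) \<otimes> \<mu>\<^bsub>H2\<^esub>) \<cdot> (\<delta>\<^bsub>H1\<^esub> \<otimes> \<one> (car H1))"
  for C (structure)

definition hopf_truss ::
    "('o, 'm, 'c) braided_category_scheme \<Rightarrow> ('o, 'm) hopf_data \<Rightarrow> ('o, 'm) bialgebra_data \<Rightarrow>
     'm \<Rightarrow> bool"
  where "hopf_truss C H1 H2 \<sigma> \<longleftrightarrow>
    hopf_algebra C H1 \<and>
    nonunital_bialgebra C H2 \<and>
    car H2 = car H1 \<and> \<epsilon>\<^bsub>H2\<^esub> = \<epsilon>\<^bsub>H1\<^esub> \<and> \<delta>\<^bsub>H2\<^esub> = \<delta>\<^bsub>H1\<^esub> \<and>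
    coalgebra_morphism C H1 H1 \<sigma> \<and>
    \<mu>\<^bsub>H2\<^esub> \<cdot> (\<one> (car H1) \<otimes> \<mu>\<^bsub>H1\<^esub>) =
      \<mu>\<^bsub>H1\<^esub> \<cdot> (\<mu>\<^bsub>H2\<^esub> \<otimes> Gamma C H1 H2 \<sigma>)
        \<cdot> (\<one> (car H1) \<otimes> \<c> (car H1) (car H1) \<otimes> \<one> (car H1))
        \<cdot> (\<delta>\<^bsub>H1\<^esub> \<otimes> \<one> (car H1) \<otimes> \<one> (car H1))"
  for C (structure)

text \<open>Arrows are stored together with their source and target.\<close>

definition HTr ::
    "('o, 'm, 'c) braided_category_scheme \<Rightarrow>
     (('o, 'm) truss, ('o, 'm) truss \<times> 'm \<times> ('o, 'm) truss) category"
  where "HTr C =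
    \<lparr>Obj = {(H1, H2, \<sigma>). hopf_truss C H1 H2 \<sigma>},
     Arr = {((H1, H2, \<sigma>), f, (B1, B2, \<tau>)) | H1 H2 \<sigma> f B1 B2 \<tau>.
       hopf_truss C H1 H2 \<sigma> \<and> hopf_truss C B1 B2 \<tau> \<and>
       hopf_algebra_morphism C H1 B1 f \<and> nonunital_bialgebra_morphism C H2 B2 f},
     Dom = (\<lambda>(X, f, Y). X),
     Cod = (\<lambda>(X, f, Y). Y),
     Ident = (\<lambda>(H1, H2, \<sigma>). ((H1, H2, \<sigma>), \<one> (car H1), (H1, H2, \<sigma>))),
     Comp = (\<lambda>(Y', g, Z) (X, f, Y). (X, g \<cdot> f, Z))\<rparr>"
  for C (structure)

text \<open>The condition defining both starred subcategories, for an action \<^term>\<open>m\<close> of a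
  coalgebra \<^term>\<open>H\<close> on its own underlying object.\<close>

definition star_condition ::
    "('o, 'm, 'c) braided_category_scheme \<Rightarrow> ('o, 'm, 'z) coalgebra_data_scheme \<Rightarrow> 'm \<Rightarrow> bool"
  where "star_condition C H m \<longleftrightarrow>
    (m \<otimes> \<one> (car H)) \<cdot> (\<one> (car H) \<otimes> \<c> (car H) (car H))
        \<cdot> ((\<c> (car H) (car H) \<cdot> \<delta>\<^bsub>H\<^esub>) \<otimes> \<one> (car H)) =
    (m \<otimes> \<one> (car H)) \<cdot> (\<one> (car H) \<otimes> \<c> (car H) (car H)) \<cdot> (\<delta>\<^bsub>H\<^esub> \<otimes> \<one> (car H))"
  for C (structure)

definition HTr_star ::
    "('o, 'm, 'c) braided_category_scheme \<Rightarrow>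
     (('o, 'm) truss, ('o, 'm) truss \<times> 'm \<times> ('o, 'm) truss) category"
  where "HTr_star C =
    full_subcategory (HTr C) {(H1, H2, \<sigma>). star_condition C H1 (Gamma C H1 H2 \<sigma>)}"


section \<open>Weak twisted relative Rota--Baxter operators\<close>

text \<open>The operator \<open>(T : H \<rightarrow> B, \<phi>, \<Psi>)\<close> is encoded as \<open>(H, B, T, \<phi>, \<Psi>)\<close>.\<close>

type_synonym ('o, 'm) rb_operator =
  "('o, 'm) hopf_data \<times> ('o, 'm) bialgebra_data \<times> 'm \<times> 'm \<times> 'm"

definition module_algebra_coalgebra ::
    "('o, 'm, 'c) braided_category_scheme \<Rightarrow> ('o, 'm) bialgebra_data \<Rightarrow> ('o, 'm) hopf_data \<Rightarrow>
     'm \<Rightarrow> bool"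
  where "module_algebra_coalgebra C B H \<phi> \<longleftrightarrow>
    \<phi> \<in> Hom C (car B \<boxtimes> car H) (car H) \<and>
    \<phi> \<cdot> (\<one> (car B) \<otimes> \<phi>) = \<phi> \<cdot> (\<mu>\<^bsub>B\<^esub> \<otimes> \<one> (car H)) \<and>
    \<phi> \<cdot> (\<one> (car B) \<otimes> \<eta>\<^bsub>H\<^esub>) = \<epsilon>\<^bsub>B\<^esub> \<otimes> \<eta>\<^bsub>H\<^esub> \<and>
    \<phi> \<cdot> (\<one> (car B) \<otimes> \<mu>\<^bsub>H\<^esub>) =
      \<mu>\<^bsub>H\<^esub> \<cdot> (\<phi> \<otimes> \<phi>)
        \<cdot> (\<one> (car B) \<otimes> \<c> (car B) (car H) \<otimes> \<one> (car H))
        \<cdot> (\<delta>\<^bsub>B\<^esub> \<otimes> \<one> (car H) \<otimes> \<one> (car H)) \<and>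
    coalgebra_morphism C (tensor_coalgebra C B H) H \<phi>"
  for C (structure)

definition rb_action ::
    "('o, 'm, 'c) braided_category_scheme \<Rightarrow> ('o, 'm) hopf_data \<Rightarrow> 'm \<Rightarrow> 'm \<Rightarrow> 'm"
  where "rb_action C H T \<phi> = \<phi> \<cdot> (T \<otimes> \<one> (car H))"
  for C (structure)

definition rb_product ::
    "('o, 'm, 'c) braided_category_scheme \<Rightarrow> ('o, 'm) hopf_data \<Rightarrow> 'm \<Rightarrow> 'm \<Rightarrow> 'm \<Rightarrow> 'm"
  where "rb_product C H T \<phi> \<Psi> =
    \<mu>\<^bsub>H\<^esub> \<cdot> (\<Psi> \<otimes> rb_action C H T \<phi>) \<cdot> (\<delta>\<^bsub>H\<^esub> \<otimes> \<one> (car H))"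
  for C (structure)

definition weak_twisted_rb_operator ::
    "('o, 'm, 'c) braided_category_scheme \<Rightarrow> ('o, 'm) hopf_data \<Rightarrow> ('o, 'm) bialgebra_data \<Rightarrow>
     'm \<Rightarrow> 'm \<Rightarrow> 'm \<Rightarrow> bool"
  where "weak_twisted_rb_operator C H B T \<phi> \<Psi> \<longleftrightarrow>
    hopf_algebra C H \<and>
    nonunital_bialgebra C B \<and>
    module_algebra_coalgebra C B H \<phi> \<and>
    coalgebra_morphism C H B T \<and>
    coalgebra_morphism C H H \<Psi> \<and>
    \<mu>\<^bsub>B\<^esub> \<cdot> (T \<otimes> T) = T \<cdot> rb_product C H T \<phi> \<Psi> \<and>
    \<Psi> \<cdot> rb_product C H T \<phi> \<Psi> = \<mu>\<^bsub>H\<^esub> \<cdot> (\<Psi> \<otimes> rb_action C H T \<phi>) \<cdot> (\<delta>\<^bsub>H\<^esub> \<otimes> \<Psi>)"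
  for C (structure)

definition wtrRB ::
    "('o, 'm, 'c) braided_category_scheme \<Rightarrow>
     (('o, 'm) rb_operator,
      ('o, 'm) rb_operator \<times> ('m \<times> 'm) \<times> ('o, 'm) rb_operator) category"
  where "wtrRB C =
    \<lparr>Obj = {(H, B, T, \<phi>, \<Psi>). weak_twisted_rb_operator C H B T \<phi> \<Psi>},
     Arr = {((H, B, T, \<phi>, \<Psi>), (f, g), (H', B', T', \<phi>', \<Psi>')) |
         H B T \<phi> \<Psi> f g H' B' T' \<phi>' \<Psi>'.
       weak_twisted_rb_operator C H B T \<phi> \<Psi> \<and>
       weak_twisted_rb_operator C H' B' T' \<phi>' \<Psi>' \<and>
       hopf_algebra_morphism C H H' f \<and>
       nonunital_bialgebra_morphism C B B' g \<and>
       T' \<cdot> f = g \<cdot> T \<and>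
       f \<cdot> \<Psi> = \<Psi>' \<cdot> f \<and>
       f \<cdot> \<phi> = \<phi>' \<cdot> (g \<otimes> f)},
     Dom = (\<lambda>(X, p, Y). X),
     Cod = (\<lambda>(X, p, Y). Y),
     Ident = (\<lambda>(H, B, T, \<phi>, \<Psi>).
       ((H, B, T, \<phi>, \<Psi>), (\<one> (car H), \<one> (car B)), (H, B, T, \<phi>, \<Psi>))),
     Comp = (\<lambda>(Y', (f', g'), Z) (X, (f, g), Y). (X, (f' \<cdot> f, g' \<cdot> g), Z))\<rparr>"
  for C (structure)

definition wtrRB_star ::
    "('o, 'm, 'c) braided_category_scheme \<Rightarrow>
     (('o, 'm) rb_operator,
      ('o, 'm) rb_operator \<times> ('m \<times> 'm) \<times> ('o, 'm) rb_operator) category"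
  where "wtrRB_star C =
    full_subcategory (wtrRB C) {(H, B, T, \<phi>, \<Psi>). star_condition C H (rb_action C H T \<phi>)}"


section \<open>The functors \<open>\<Lambda>\<close> and \<open>\<Omega>\<close>\<close>

definition Lambda_obj ::
    "('o, 'm, 'c) braided_category_scheme \<Rightarrow> ('o, 'm) truss \<Rightarrow> ('o, 'm) rb_operator"
  where "Lambda_obj C = (\<lambda>(H1, H2, \<sigma>). (H1, H2, \<one> (car H1), Gamma C H1 H2 \<sigma>, \<sigma>))"
  for C (structure)

definition Lambda ::
    "('o, 'm, 'c) braided_category_scheme \<Rightarrow>
     (('o, 'm) truss, ('o, 'm) truss \<times> 'm \<times> ('o, 'm) truss,
      ('o, 'm) rb_operator,
      ('o, 'm) rb_operator \<times> ('m \<times> 'm) \<times> ('o, 'm) rb_operator) functor_data"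
  where "Lambda C =
    \<lparr>OMap = Lambda_obj C,
     AMap = (\<lambda>(X, f, Y). (Lambda_obj C X, (f, f), Lambda_obj C Y))\<rparr>"

definition Omega_obj ::
    "('o, 'm, 'c) braided_category_scheme \<Rightarrow> ('o, 'm) rb_operator \<Rightarrow> ('o, 'm) truss"
  where "Omega_obj C = (\<lambda>(H, B, T, \<phi>, \<Psi>).
    (H,
     \<lparr>car = car H, counit = \<epsilon>\<^bsub>H\<^esub>, coproduct = \<delta>\<^bsub>H\<^esub>, product = rb_product C H T \<phi> \<Psi>\<rparr>,
     \<Psi>))"

definition Omega ::
    "('o, 'm, 'c) braided_category_scheme \<Rightarrow>
     (('o, 'm) rb_operator,
      ('o, 'm) rb_operator \<times> ('m \<times> 'm) \<times> ('o, 'm) rb_operator,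
      ('o, 'm) truss, ('o, 'm) truss \<times> 'm \<times> ('o, 'm) truss) functor_data"
  where "Omega C =
    \<lparr>OMap = Omega_obj C,
     AMap = (\<lambda>(X, (f, g), Y). (Omega_obj C X, f, Omega_obj C Y))\<rparr>"

end

theory Submission
  imports Defs
begin

text \<open>
  Everything is computed in convolution monoids. For a coalgebra \<open>D\<close> and an algebra \<open>A\<close> put
  \<open>f * g = \<mu> \<cdot> (f \<otimes> g) \<cdot> \<delta>\<close> for \<open>f, g : D \<rightarrow> A\<close>. This is a monoid with unit \<open>\<eta> \<cdot> \<epsilon>\<close>, and if
  \<open>A\<close> is a Hopf algebra then a coalgebra morphism \<open>f\<close> has the inverse \<open>S \<cdot> f\<close>
  (\<open>conv_antipode\<close>). With \<open>p = 1 \<otimes> \<epsilon>\<close> the first projection of a tensor product coalgebra,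
  the formulas that define trusses and operators become, by \<open>conv_proj1\<close>,
  \<open>\<Gamma> = (S \<cdot> \<sigma> \<cdot> p) * \<mu>\<^sub>2\<close> and \<open>\<mu>\<^sub>~ = (\<Psi> \<cdot> p) * \<m>\<close>, and the distributive laws say that an
  action turns convolution products into convolution products (\<open>measures_conv\<close>). The braiding is
  then needed only for a handful of facts about \<open>*\<close>.

  For a Hopf truss, the truss axiom at the unit shows \<open>\<mu>\<^sub>2 \<cdot> (1 \<otimes> \<eta>) = \<sigma>\<close>, because both sides are
  convolution inverse to \<open>S \<cdot> \<sigma>\<close> (\<open>Gamma_unit_and_product_unit\<close>). Hence \<open>\<sigma>\<close> and \<open>\<Gamma>\<close> are preserved
  by morphisms, and \<open>\<mu>\<^sub>2 = (\<sigma> \<cdot> p) * \<Gamma>\<close>. Multiplicativity of \<open>\<Gamma>\<close> follows from the truss axiom by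
  multiplying with \<open>S \<cdot> \<sigma> \<cdot> p\<close> from the left; the module law \<open>\<Gamma> \<cdot> (1 \<otimes> \<Gamma>) = \<Gamma> \<cdot> (\<mu>\<^sub>2 \<otimes> 1)\<close> follows from uniqueness of
  convolution inverses (\<open>Gamma_antipode\<close>, \<open>Gamma_module\<close>).

  The star condition says exactly that \<open>\<m> \<otimes> p\<close> does not distinguish the coproduct of \<open>H \<otimes> H\<close>
  from its braided opposite (\<open>star_condition_iff\<close>). If \<open>f\<close> is a coalgebra morphism and \<open>g \<otimes> f\<close> has
  this property, then \<open>(\<delta> \<cdot> f) * ((g \<otimes> g) \<cdot> \<delta>) = ((f * g) \<otimes> (f * g)) \<cdot> \<delta>\<close>
  (\<open>conv_tensor_product\<close>), where the left-hand convolution is into \<open>H \<otimes> H\<close>. If \<open>g\<close> is a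
  coalgebra morphism then so is \<open>f * g\<close>, which gives the coalgebra morphism \<open>\<mu>\<^sub>~\<close>. If
  instead \<open>f * g\<close> is one, cancelling \<open>\<delta> \<cdot> f\<close> shows that \<open>g\<close> is one, which gives \<open>\<Gamma>\<close>.

  For the adjunction, the compatibility \<open>T \<cdot> f = g \<cdot> 1\<close> in a morphism \<open>(f, g)\<close> out of
  \<open>\<Lambda>(H\<^sub>1, H\<^sub>2, \<sigma>)\<close> determines \<open>g\<close>, and conversely \<open>(f, T \<cdot> f)\<close> is a morphism for every morphism of
  Hopf trusses \<open>f\<close> (\<open>adjunct_iff\<close>). The bijection \<open>(f, g) \<mapsto> f\<close> is visibly natural.
\<close>

section \<open>Calculus in strict braided monoidal categories\<close>

text \<open>The typing axioms are recast with \<open>Arr\<close>, \<open>Dom\<close> and \<open>Cod\<close>, so that the simplifier can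
  compute sources and targets and normalise composites to right-nested form.\<close>

context category
begin

lemma HomD:
  assumes "f \<in> Hom C X Y"
  shows "f \<in> Arr C" "Dom C f = X" "Cod C f = Y" "X \<in> Obj C" "Y \<in> Obj C"
  using assms Dom_Obj Cod_Obj by (auto simp: Hom_def)

lemma HomI: "f \<in> Arr C \<Longrightarrow> Dom C f = X \<Longrightarrow> Cod C f = Y \<Longrightarrow> f \<in> Hom C X Y"
  by (simp add: Hom_def)

lemma arr_Hom: "f \<in> Arr C \<Longrightarrow> f \<in> Hom C (Dom C f) (Cod C f)"
  by (simp add: Hom_def)

lemma ident_typing [simp]:
  assumes "X \<in> Obj C"
  shows "\<one> X \<in> Arr C" "Dom C (\<one> X) = X" "Cod C (\<one> X) = X"
  using Ident_Hom[OF assms] by (auto simp: Hom_def)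

lemma comp_typing [simp]:
  assumes "f \<in> Arr C" "g \<in> Arr C" "Cod C f = Dom C g"
  shows "g \<cdot> f \<in> Arr C" "Dom C (g \<cdot> f) = Dom C f" "Cod C (g \<cdot> f) = Cod C g"
  using Comp_Hom[of f "Dom C f" "Cod C f" g "Cod C g"] assms by (auto simp: Hom_def)

lemma comp_ident [simp]: "f \<in> Arr C \<Longrightarrow> X = Dom C f \<Longrightarrow> f \<cdot> \<one> X = f"
  using Comp_Ident arr_Hom by blast

lemma ident_comp [simp]: "f \<in> Arr C \<Longrightarrow> X = Cod C f \<Longrightarrow> \<one> X \<cdot> f = f"
  using Ident_Comp arr_Hom by blast

lemma comp_assoc [simp]:
  "f \<in> Arr C \<Longrightarrow> g \<in> Arr C \<Longrightarrow> h \<in> Arr C \<Longrightarrow> Cod C f = Dom C g \<Longrightarrow> Cod C g = Dom C h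
    \<Longrightarrow> (h \<cdot> g) \<cdot> f = h \<cdot> g \<cdot> f"
  using Comp_assoc[of f "Dom C f" "Cod C f" g "Cod C g" h "Cod C h"] by (auto simp: Hom_def)

end

context strict_monoidal_category
begin

declare Unit_Obj [simp] OTensor_Obj [simp] OTensor_assoc [simp]
  Unit_OTensor [simp] OTensor_Unit [simp] Unit_ATensor [simp] ATensor_Unit [simp]
  ATensor_assoc [simp] Dom_Obj [simp] Cod_Obj [simp]

lemma tensor_typing [simp]:
  assumes "f \<in> Arr C" "g \<in> Arr C"
  shows "f \<otimes> g \<in> Arr C" "Dom C (f \<otimes> g) = Dom C f \<boxtimes> Dom C g" "Cod C (f \<otimes> g) = Cod C f \<boxtimes> Cod C g"
  using ATensor_Hom[OF arr_Hom arr_Hom, OF assms] by (auto simp: Hom_def)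

lemma ident_tensor: "X \<in> Obj C \<Longrightarrow> Y \<in> Obj C \<Longrightarrow> \<one> (X \<boxtimes> Y) = \<one> X \<otimes> \<one> Y"
  by (simp add: ATensor_Ident)

lemma interchange:
  assumes "f \<in> Arr C" "g \<in> Arr C" "f' \<in> Arr C" "g' \<in> Arr C" "Cod C f = Dom C g" "Cod C f' = Dom C g'"
  shows "(g \<otimes> g') \<cdot> (f \<otimes> f') = (g \<cdot> f) \<otimes> (g' \<cdot> f')"
  using ATensor_Comp[of f "Dom C f" "Cod C f" g "Cod C g" f' "Dom C f'" "Cod C f'" g' "Cod C g'"] assms
  by (simp add: Hom_def)

text \<open>Since tensor products are kept right-nested, the interchange law is also needed when one
  factor on one side faces two factors on the other.\<close>

lemma interchange_21:
  assumes "f1 \<in> Arr C" "f2 \<in> Arr C" "g \<in> Arr C" "f' \<in> Arr C" "g' \<in> Arr C"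
    "Dom C g = Cod C f1 \<boxtimes> Cod C f2" "Cod C f' = Dom C g'"
  shows "(g \<otimes> g') \<cdot> (f1 \<otimes> f2 \<otimes> f') = (g \<cdot> (f1 \<otimes> f2)) \<otimes> (g' \<cdot> f')"
  using interchange[of "f1 \<otimes> f2" g f' g'] assms by simp

lemma interchange_12:
  assumes "g1 \<in> Arr C" "g2 \<in> Arr C" "f \<in> Arr C" "f' \<in> Arr C" "g' \<in> Arr C"
    "Cod C f = Dom C g1 \<boxtimes> Dom C g2" "Cod C f' = Dom C g'"
  shows "(g1 \<otimes> g2 \<otimes> g') \<cdot> (f \<otimes> f') = ((g1 \<otimes> g2) \<cdot> f) \<otimes> (g' \<cdot> f')"
  using interchange[of f "g1 \<otimes> g2" f' g'] assms by simp

lemma whisker: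
  assumes "X \<in> Obj C" "f \<in> Arr C" "g \<in> Arr C" "Cod C f = Dom C g"
  shows "\<one> X \<otimes> (g \<cdot> f) = (\<one> X \<otimes> g) \<cdot> (\<one> X \<otimes> f)" "(g \<cdot> f) \<otimes> \<one> X = (g \<otimes> \<one> X) \<cdot> (f \<otimes> \<one> X)"
  using assms by (simp_all add: interchange)

lemma whisker2:
  assumes "X \<in> Obj C" "Y \<in> Obj C" "f \<in> Arr C" "g \<in> Arr C" "Cod C f = Dom C g"
  shows "(g \<cdot> f) \<otimes> \<one> X \<otimes> \<one> Y = (g \<otimes> \<one> X \<otimes> \<one> Y) \<cdot> (f \<otimes> \<one> X \<otimes> \<one> Y)"
  using assms whisker(2)[of "X \<boxtimes> Y" f g] by (simp add: ident_tensor)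

text \<open>Lifts an equation between composites to one that applies inside a right-nested composite.\<close>

lemma comp_eq_comp:
  assumes "g \<cdot> f = k" "f \<in> Arr C" "g \<in> Arr C" "h \<in> Arr C" "Cod C f = Dom C g" "Cod C h = Dom C f"
  shows "g \<cdot> f \<cdot> h = k \<cdot> h"
  using assms comp_assoc[of h f g] by simp

lemma interchange_comp:
  assumes "f \<in> Arr C" "g \<in> Arr C" "f' \<in> Arr C" "g' \<in> Arr C" "Cod C f = Dom C g" "Cod C f' = Dom C g'"
    "h \<in> Arr C" "Cod C h = Dom C f \<boxtimes> Dom C f'"
  shows "(g \<otimes> g') \<cdot> (f \<otimes> f') \<cdot> h = ((g \<cdot> f) \<otimes> (g' \<cdot> f')) \<cdot> h"
  by (rule comp_eq_comp[OF interchange]) (use assms in simp_all)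

lemma interchange_21_comp:
  assumes "f1 \<in> Arr C" "f2 \<in> Arr C" "g \<in> Arr C" "f' \<in> Arr C" "g' \<in> Arr C"
    "Dom C g = Cod C f1 \<boxtimes> Cod C f2" "Cod C f' = Dom C g'"
    "h \<in> Arr C" "Cod C h = Dom C f1 \<boxtimes> Dom C f2 \<boxtimes> Dom C f'"
  shows "(g \<otimes> g') \<cdot> (f1 \<otimes> f2 \<otimes> f') \<cdot> h = ((g \<cdot> (f1 \<otimes> f2)) \<otimes> (g' \<cdot> f')) \<cdot> h"
  by (rule comp_eq_comp[OF interchange_21]) (use assms in simp_all)

lemma interchange_12_comp:
  assumes "g1 \<in> Arr C" "g2 \<in> Arr C" "f \<in> Arr C" "f' \<in> Arr C" "g' \<in> Arr C"
    "Cod C f = Dom C g1 \<boxtimes> Dom C g2" "Cod C f' = Dom C g'"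
    "h \<in> Arr C" "Cod C h = Dom C f \<boxtimes> Dom C f'"
  shows "(g1 \<otimes> g2 \<otimes> g') \<cdot> (f \<otimes> f') \<cdot> h = (((g1 \<otimes> g2) \<cdot> f) \<otimes> (g' \<cdot> f')) \<cdot> h"
  by (rule comp_eq_comp[OF interchange_12]) (use assms in simp_all)

lemmas interchanges = interchange interchange_21 interchange_12
  interchange_comp interchange_21_comp interchange_12_comp

lemma ident2_comp [simp]:
  assumes "X \<in> Obj C" "Y \<in> Obj C" "f \<in> Arr C"
  shows "Cod C f = X \<boxtimes> Y \<Longrightarrow> (\<one> X \<otimes> \<one> Y) \<cdot> f = f" "Dom C f = X \<boxtimes> Y \<Longrightarrow> f \<cdot> (\<one> X \<otimes> \<one> Y) = f"
  using assms by (auto simp: ATensor_Ident)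

lemma ident3_comp [simp]:
  assumes "X \<in> Obj C" "Y \<in> Obj C" "Z \<in> Obj C" "f \<in> Arr C"
  shows "Cod C f = X \<boxtimes> Y \<boxtimes> Z \<Longrightarrow> (\<one> X \<otimes> \<one> Y \<otimes> \<one> Z) \<cdot> f = f"
    "Dom C f = X \<boxtimes> Y \<boxtimes> Z \<Longrightarrow> f \<cdot> (\<one> X \<otimes> \<one> Y \<otimes> \<one> Z) = f"
  using assms by (auto simp: ATensor_Ident)

declare ident_tensor [simp]

end

context strict_braided_monoidal_category
begin

lemma braid_typing [simp]:
  assumes "X \<in> Obj C" "Y \<in> Obj C"
  shows "\<c> X Y \<in> Arr C" "Dom C (\<c> X Y) = X \<boxtimes> Y" "Cod C (\<c> X Y) = Y \<boxtimes> X"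
  using Braid_Hom[OF assms] by (auto simp: Hom_def)

lemma braid_natural:
  assumes "f \<in> Arr C" "g \<in> Arr C"
  shows "\<c> (Cod C f) (Cod C g) \<cdot> (f \<otimes> g) = (g \<otimes> f) \<cdot> \<c> (Dom C f) (Dom C g)"
  using Braid_natural[OF arr_Hom arr_Hom] assms by blast

lemma braid_unit [simp]:
  assumes "X \<in> Obj C"
  shows "\<c> \<K> X = \<one> X" "\<c> X \<K> = \<one> X"
proof -
  have l: "\<c> \<K> X = \<c> \<K> X \<cdot> \<c> \<K> X"
    using Braid_OTensor_left[of \<K> \<K> X] assms by simp
  obtain d where "d \<in> Hom C X X" "d \<cdot> \<c> \<K> X = \<one> X"
    using Braid_iso[of \<K> X] assms by auto
  then show "\<c> \<K> X = \<one> X"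
    using l comp_assoc[of "\<c> \<K> X" "\<c> \<K> X" d] assms by (auto simp: Hom_def)
  have r: "\<c> X \<K> = \<c> X \<K> \<cdot> \<c> X \<K>"
    using Braid_OTensor_right[of X \<K> \<K>] assms by simp
  obtain d where "d \<in> Hom C X X" "d \<cdot> \<c> X \<K> = \<one> X"
    using Braid_iso[of X \<K>] assms by auto
  then show "\<c> X \<K> = \<one> X"
    using r comp_assoc[of "\<c> X \<K>" "\<c> X \<K>" d] assms by (auto simp: Hom_def)
qed

lemma braid_to_unit [simp]:
  assumes "X \<in> Obj C" "f \<in> Arr C" "Dom C f = Y" "Cod C f = \<K>"
  shows "(f \<otimes> \<one> X) \<cdot> \<c> X Y = \<one> X \<otimes> f" "(\<one> X \<otimes> f) \<cdot> \<c> Y X = f \<otimes> \<one> X"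
  using braid_natural[of "\<one> X" f] braid_natural[of f "\<one> X"] assms by simp_all

text \<open>The next two identities, consequences of the hexagons and interchange, are the braid-theoretic
  content of the associativity laws for tensor products of coalgebras and of algebras.\<close>

lemma braid_exchange:
  assumes [simp]: "X \<in> Obj C" "Y \<in> Obj C" "Z \<in> Obj C" "W \<in> Obj C"
  shows "(\<one> Y \<otimes> \<c> (X \<boxtimes> Z) W) \<cdot> (\<c> X Y \<otimes> \<one> Z \<otimes> \<one> W) =
    (\<c> X (Y \<boxtimes> W) \<otimes> \<one> Z) \<cdot> (\<one> X \<otimes> \<one> Y \<otimes> \<c> Z W)"
proof -
  have "(\<one> Y \<otimes> \<c> (X \<boxtimes> Z) W) = (\<one> Y \<otimes> \<c> X W \<otimes> \<one> Z) \<cdot> (\<one> Y \<otimes> \<one> X \<otimes> \<c> Z W)"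
    by (simp add: Braid_OTensor_left whisker)
  moreover have "\<c> X (Y \<boxtimes> W) \<otimes> \<one> Z = (\<one> Y \<otimes> \<c> X W \<otimes> \<one> Z) \<cdot> (\<c> X Y \<otimes> \<one> W \<otimes> \<one> Z)"
    by (simp add: Braid_OTensor_right whisker)
  moreover have "(\<one> Y \<otimes> \<one> X \<otimes> \<c> Z W) \<cdot> (\<c> X Y \<otimes> \<one> Z \<otimes> \<one> W) =
      (\<c> X Y \<otimes> \<one> W \<otimes> \<one> Z) \<cdot> (\<one> X \<otimes> \<one> Y \<otimes> \<c> Z W)"
    by (simp add: interchanges)
  ultimately show ?thesis by simp
qed

lemma braid_shuffle:
  assumes [simp]: "X \<in> Obj C" "Y \<in> Obj C"
  shows "(\<c> X Y \<otimes> \<one> Y \<otimes> \<one> X) \<cdot> (\<one> X \<otimes> \<c> X (Y \<boxtimes> Y)) =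
    (\<one> Y \<otimes> \<one> X \<otimes> \<c> X Y) \<cdot> (\<c> (X \<boxtimes> X) Y \<otimes> \<one> Y)"
proof -
  have "\<one> X \<otimes> \<c> X (Y \<boxtimes> Y) = (\<one> X \<otimes> \<one> Y \<otimes> \<c> X Y) \<cdot> (\<one> X \<otimes> \<c> X Y \<otimes> \<one> Y)"
    by (simp add: Braid_OTensor_right whisker)
  moreover have "\<c> (X \<boxtimes> X) Y \<otimes> \<one> Y = (\<c> X Y \<otimes> \<one> X \<otimes> \<one> Y) \<cdot> (\<one> X \<otimes> \<c> X Y \<otimes> \<one> Y)"
    by (simp add: Braid_OTensor_left whisker)
  moreover have 1: "(\<c> X Y \<otimes> \<one> Y \<otimes> \<one> X) \<cdot> (\<one> X \<otimes> \<one> Y \<otimes> \<c> X Y) =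
      (\<one> Y \<otimes> \<one> X \<otimes> \<c> X Y) \<cdot> (\<c> X Y \<otimes> \<one> X \<otimes> \<one> Y)"
    by (simp add: interchanges)
  then have "(\<c> X Y \<otimes> \<one> Y \<otimes> \<one> X) \<cdot> (\<one> X \<otimes> \<one> Y \<otimes> \<c> X Y) \<cdot> (\<one> X \<otimes> \<c> X Y \<otimes> \<one> Y) =
      (\<one> Y \<otimes> \<one> X \<otimes> \<c> X Y) \<cdot> (\<c> X Y \<otimes> \<one> X \<otimes> \<one> Y) \<cdot> (\<one> X \<otimes> \<c> X Y \<otimes> \<one> Y)"
    by (subst comp_eq_comp[OF 1]) simp_all
  ultimately show ?thesis by simp
qed

section \<open>Coalgebras, convolution and tensor products\<close>

lemma coalgebra_typing [simp]:
  assumes "coalgebra C D"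
  shows "car D \<in> Obj C"
    "\<epsilon>\<^bsub>D\<^esub> \<in> Arr C" "Dom C \<epsilon>\<^bsub>D\<^esub> = car D" "Cod C \<epsilon>\<^bsub>D\<^esub> = \<K>"
    "\<delta>\<^bsub>D\<^esub> \<in> Arr C" "Dom C \<delta>\<^bsub>D\<^esub> = car D" "Cod C \<delta>\<^bsub>D\<^esub> = car D \<boxtimes> car D"
  using assms by (auto simp: coalgebra_def Hom_def)

lemma coassoc:
  assumes "coalgebra C D"
  shows "(\<delta>\<^bsub>D\<^esub> \<otimes> \<one> (car D)) \<cdot> \<delta>\<^bsub>D\<^esub> = (\<one> (car D) \<otimes> \<delta>\<^bsub>D\<^esub>) \<cdot> \<delta>\<^bsub>D\<^esub>"
  using assms by (auto simp: coalgebra_def)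

lemma counit_left [simp]: "coalgebra C D \<Longrightarrow> (\<epsilon>\<^bsub>D\<^esub> \<otimes> \<one> (car D)) \<cdot> \<delta>\<^bsub>D\<^esub> = \<one> (car D)"
  and counit_right [simp]: "coalgebra C D \<Longrightarrow> (\<one> (car D) \<otimes> \<epsilon>\<^bsub>D\<^esub>) \<cdot> \<delta>\<^bsub>D\<^esub> = \<one> (car D)"
  by (auto simp: coalgebra_def)

lemma tensor_coalgebra_sel [simp]:
  "car (tensor_coalgebra C D E) = car D \<boxtimes> car E"
  "\<epsilon>\<^bsub>tensor_coalgebra C D E\<^esub> = \<epsilon>\<^bsub>D\<^esub> \<otimes> \<epsilon>\<^bsub>E\<^esub>"
  "\<delta>\<^bsub>tensor_coalgebra C D E\<^esub> =
    (\<one> (car D) \<otimes> \<c> (car D) (car E) \<otimes> \<one> (car E)) \<cdot> (\<delta>\<^bsub>D\<^esub> \<otimes> \<delta>\<^bsub>E\<^esub>)"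
  by (simp_all add: tensor_coalgebra_def)

text \<open>A unital associative algebra, given by its object, product and unit rather than by a record,
  so that the notion applies to Hopf algebras and to their tensor squares alike.\<close>

definition algebra :: "'a \<Rightarrow> 'b \<Rightarrow> 'b \<Rightarrow> bool"
  where "algebra A m e \<longleftrightarrow>
    A \<in> Obj C \<and> m \<in> Hom C (A \<boxtimes> A) A \<and> e \<in> Hom C \<K> A \<and>
    m \<cdot> (m \<otimes> \<one> A) = m \<cdot> (\<one> A \<otimes> m) \<and> m \<cdot> (e \<otimes> \<one> A) = \<one> A \<and> m \<cdot> (\<one> A \<otimes> e) = \<one> A"

text \<open>The convolution product of \<open>f\<close> and \<open>g\<close>. Any morphism \<open>m\<close> is admitted in place of the
  product of an algebra.\<close>

definition conv :: "'b \<Rightarrow> ('a, 'b, 'z) coalgebra_data_scheme \<Rightarrow> 'b \<Rightarrow> 'b \<Rightarrow> 'b"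
  where "conv m D f g = m \<cdot> (f \<otimes> g) \<cdot> \<delta>\<^bsub>D\<^esub>"

lemma algebraD:
  assumes "algebra A m e"
  shows "A \<in> Obj C" "m \<in> Arr C" "Dom C m = A \<boxtimes> A" "Cod C m = A"
    "e \<in> Arr C" "Dom C e = \<K>" "Cod C e = A"
    "m \<cdot> (m \<otimes> \<one> A) = m \<cdot> (\<one> A \<otimes> m)" "m \<cdot> (e \<otimes> \<one> A) = \<one> A" "m \<cdot> (\<one> A \<otimes> e) = \<one> A"
  using assms by (auto simp: algebra_def Hom_def)

lemma conv_Hom:
  assumes "algebra A m e" "coalgebra C D" "f \<in> Hom C (car D) A" "g \<in> Hom C (car D) A"
  shows "conv m D f g \<in> Hom C (car D) A"
  using algebraD[OF assms(1)] assms(2) HomD[OF assms(3)] HomD[OF assms(4)]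
  by (auto simp: conv_def intro!: HomI)

lemma conv_assoc:
  assumes "algebra A m e" "coalgebra C D"
    and f: "f \<in> Hom C (car D) A" and g: "g \<in> Hom C (car D) A" and h: "h \<in> Hom C (car D) A"
  shows "conv m D (conv m D f g) h = conv m D f (conv m D g h)"
proof -
  note [simp] = algebraD(1-7)[OF assms(1)] assms(2) HomD[OF f] HomD[OF g] HomD[OF h]
  let ?d = "\<delta>\<^bsub>D\<^esub>" and ?D = "\<one> (car D)"
  have "conv m D (conv m D f g) h = m \<cdot> (m \<otimes> \<one> A) \<cdot> (f \<otimes> g \<otimes> h) \<cdot> (?d \<otimes> ?D) \<cdot> ?d"
    by (simp add: conv_def interchanges)
  also have "\<dots> = (m \<cdot> (m \<otimes> \<one> A)) \<cdot> (f \<otimes> g \<otimes> h) \<cdot> (?d \<otimes> ?D) \<cdot> ?d"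
    by simp
  also have "\<dots> = m \<cdot> (\<one> A \<otimes> m) \<cdot> (f \<otimes> g \<otimes> h) \<cdot> (\<one> (car D) \<otimes> ?d) \<cdot> ?d"
    by (simp add: coassoc algebraD(8)[OF assms(1)] del: comp_assoc) simp
  also have "\<dots> = conv m D f (conv m D g h)"
    by (simp add: conv_def interchanges)
  finally show ?thesis .
qed

lemma conv_unit:
  assumes "algebra A m e" "coalgebra C D" and f: "f \<in> Hom C (car D) A"
  shows "conv m D f (e \<cdot> \<epsilon>\<^bsub>D\<^esub>) = f" "conv m D (e \<cdot> \<epsilon>\<^bsub>D\<^esub>) f = f"
proof -
  note [simp] = algebraD(1-7)[OF assms(1)] assms(2) HomD[OF f]
  have "f \<otimes> (e \<cdot> \<epsilon>\<^bsub>D\<^esub>) = (\<one> A \<otimes> e) \<cdot> f \<cdot> (\<one> (car D) \<otimes> \<epsilon>\<^bsub>D\<^esub>)"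
    using interchange[of f "\<one> A" "\<epsilon>\<^bsub>D\<^esub>" e] interchange[of "\<one> (car D)" f "\<epsilon>\<^bsub>D\<^esub>" "\<one> \<K>"] by simp
  then show "conv m D f (e \<cdot> \<epsilon>\<^bsub>D\<^esub>) = f"
    by (simp add: conv_def comp_eq_comp[OF algebraD(10)[OF assms(1)]])
  have "(e \<cdot> \<epsilon>\<^bsub>D\<^esub>) \<otimes> f = (e \<otimes> \<one> A) \<cdot> f \<cdot> (\<epsilon>\<^bsub>D\<^esub> \<otimes> \<one> (car D))"
    using interchange[of "\<epsilon>\<^bsub>D\<^esub>" e f "\<one> A"] interchange[of "\<epsilon>\<^bsub>D\<^esub>" "\<one> \<K>" "\<one> (car D)" f] by simp
  then show "conv m D (e \<cdot> \<epsilon>\<^bsub>D\<^esub>) f = f"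
    by (simp add: conv_def comp_eq_comp[OF algebraD(9)[OF assms(1)]])
qed

lemma conv_comp:
  assumes m: "m \<in> Arr C" "Dom C m = Cod C f \<boxtimes> Cod C g"
    and D: "coalgebra C D" "coalgebra C E" "coalgebra_morphism C D E h"
    and f: "f \<in> Arr C" "Dom C f = car E" and g: "g \<in> Arr C" "Dom C g = car E"
  shows "conv m E f g \<cdot> h = conv m D (f \<cdot> h) (g \<cdot> h)"
proof -
  have h: "h \<in> Arr C" "Dom C h = car D" "Cod C h = car E" "\<delta>\<^bsub>E\<^esub> \<cdot> h = (h \<otimes> h) \<cdot> \<delta>\<^bsub>D\<^esub>"
    using D(3) by (auto simp: coalgebra_morphism_def Hom_def)
  then show ?thesis using m D(1,2) f g h by (simp add: conv_def interchanges)
qed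

lemma tensor_coalgebra_counits:
  assumes [simp]: "coalgebra C D" "coalgebra C E"
  defines "P \<equiv> tensor_coalgebra C D E"
  shows "(\<epsilon>\<^bsub>P\<^esub> \<otimes> \<one> (car P)) \<cdot> \<delta>\<^bsub>P\<^esub> = \<one> (car P)" "(\<one> (car P) \<otimes> \<epsilon>\<^bsub>P\<^esub>) \<cdot> \<delta>\<^bsub>P\<^esub> = \<one> (car P)"
  by (simp_all add: P_def interchanges)

lemma tensor_coalgebra_coassoc:
  assumes [simp]: "coalgebra C D" "coalgebra C E"
  defines "P \<equiv> tensor_coalgebra C D E"
  shows "(\<delta>\<^bsub>P\<^esub> \<otimes> \<one> (car P)) \<cdot> \<delta>\<^bsub>P\<^esub> = (\<one> (car P) \<otimes> \<delta>\<^bsub>P\<^esub>) \<cdot> \<delta>\<^bsub>P\<^esub>"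
proof -
  define a b d e where abde [simp]: "a = car D" "b = car E" "d = \<delta>\<^bsub>D\<^esub>" "e = \<delta>\<^bsub>E\<^esub>"
  \<comment> \<open>Move all coproducts to the right of all braidings, on either side.\<close>
  have 1: "(d \<otimes> e \<otimes> \<one> a \<otimes> \<one> b) \<cdot> (\<one> a \<otimes> \<c> a b \<otimes> \<one> b) =
      (\<one> a \<otimes> \<one> a \<otimes> \<c> a (b \<boxtimes> b) \<otimes> \<one> b) \<cdot> (d \<otimes> \<one> a \<otimes> e \<otimes> \<one> b)"
    using braid_natural[of "\<one> a" e] by (simp add: interchanges)
  have 2: "(\<one> a \<otimes> \<one> b \<otimes> d \<otimes> e) \<cdot> (\<one> a \<otimes> \<c> a b \<otimes> \<one> b) =
      (\<one> a \<otimes> \<c> (a \<boxtimes> a) b \<otimes> \<one> b \<otimes> \<one> b) \<cdot> (\<one> a \<otimes> d \<otimes> \<one> b \<otimes> e)"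
    using braid_natural[of d "\<one> b"] by (simp add: interchanges)
  have 3: "(d \<otimes> \<one> a \<otimes> e \<otimes> \<one> b) \<cdot> (d \<otimes> e) = ((d \<otimes> \<one> a) \<cdot> d) \<otimes> ((e \<otimes> \<one> b) \<cdot> e)"
    and 4: "(\<one> a \<otimes> d \<otimes> \<one> b \<otimes> e) \<cdot> (d \<otimes> e) = ((\<one> a \<otimes> d) \<cdot> d) \<otimes> ((\<one> b \<otimes> e) \<cdot> e)"
    by (simp_all add: interchanges)
  have "(\<delta>\<^bsub>P\<^esub> \<otimes> \<one> (car P)) \<cdot> \<delta>\<^bsub>P\<^esub> = (\<one> a \<otimes> \<c> a b \<otimes> \<one> b \<otimes> \<one> a \<otimes> \<one> b) \<cdot>
      (d \<otimes> e \<otimes> \<one> a \<otimes> \<one> b) \<cdot> (\<one> a \<otimes> \<c> a b \<otimes> \<one> b) \<cdot> (d \<otimes> e)"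
    by (simp add: P_def whisker2)
  also have "\<dots> = (\<one> a \<otimes> \<c> a b \<otimes> \<one> b \<otimes> \<one> a \<otimes> \<one> b) \<cdot>
      (\<one> a \<otimes> \<one> a \<otimes> \<c> a (b \<boxtimes> b) \<otimes> \<one> b) \<cdot> (((d \<otimes> \<one> a) \<cdot> d) \<otimes> ((e \<otimes> \<one> b) \<cdot> e))"
    by (subst comp_eq_comp[OF 1]) (simp_all add: 3[unfolded abde])
  also have "\<dots> = (\<one> a \<otimes> \<one> b \<otimes> \<one> a \<otimes> \<c> a b \<otimes> \<one> b) \<cdot>
      (\<one> a \<otimes> \<c> (a \<boxtimes> a) b \<otimes> \<one> b \<otimes> \<one> b) \<cdot> (((\<one> a \<otimes> d) \<cdot> d) \<otimes> ((\<one> b \<otimes> e) \<cdot> e))"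
  proof -
    have 5: "(\<one> a \<otimes> \<c> a b \<otimes> \<one> b \<otimes> \<one> a \<otimes> \<one> b) \<cdot> (\<one> a \<otimes> \<one> a \<otimes> \<c> a (b \<boxtimes> b) \<otimes> \<one> b) =
       (\<one> a \<otimes> \<one> b \<otimes> \<one> a \<otimes> \<c> a b \<otimes> \<one> b) \<cdot> (\<one> a \<otimes> \<c> (a \<boxtimes> a) b \<otimes> \<one> b \<otimes> \<one> b)"
      using arg_cong[OF braid_shuffle[of a b], of "\<lambda>x. \<one> a \<otimes> x \<otimes> \<one> b"]
      by (simp add: whisker)
    show ?thesis
      by (subst comp_eq_comp[OF 5]) (simp_all add: coassoc)
  qed
  also have "\<dots> = (\<one> a \<otimes> \<one> b \<otimes> \<one> a \<otimes> \<c> a b \<otimes> \<one> b) \<cdot>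
      (\<one> a \<otimes> \<one> b \<otimes> d \<otimes> e) \<cdot> (\<one> a \<otimes> \<c> a b \<otimes> \<one> b) \<cdot> (d \<otimes> e)"
    by (subst comp_eq_comp[OF 2]) (simp_all add: 4[unfolded abde])
  also have "\<dots> = (\<one> (car P) \<otimes> \<delta>\<^bsub>P\<^esub>) \<cdot> \<delta>\<^bsub>P\<^esub>"
    by (simp add: P_def whisker)
  finally show ?thesis .
qed

lemma tensor_coalgebra_morphism:
  assumes D: "coalgebra C D" "coalgebra C E" "coalgebra C D'" "coalgebra C E'"
    and f: "coalgebra_morphism C D D' f" and g: "coalgebra_morphism C E E' g"
  shows "coalgebra_morphism C (tensor_coalgebra C D E) (tensor_coalgebra C D' E') (f \<otimes> g)"
proof -
  note [simp] = D
  have [simp]: "f \<in> Arr C" "Dom C f = car D" "Cod C f = car D'" "\<epsilon>\<^bsub>D'\<^esub> \<cdot> f = \<epsilon>\<^bsub>D\<^esub>"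
    "\<delta>\<^bsub>D'\<^esub> \<cdot> f = (f \<otimes> f) \<cdot> \<delta>\<^bsub>D\<^esub>"
    "g \<in> Arr C" "Dom C g = car E" "Cod C g = car E'" "\<epsilon>\<^bsub>E'\<^esub> \<cdot> g = \<epsilon>\<^bsub>E\<^esub>"
    "\<delta>\<^bsub>E'\<^esub> \<cdot> g = (g \<otimes> g) \<cdot> \<delta>\<^bsub>E\<^esub>"
    using f g by (auto simp: coalgebra_morphism_def Hom_def)
  have 1: "(\<one> (car D') \<otimes> \<c> (car D') (car E') \<otimes> \<one> (car E')) \<cdot> (f \<otimes> f \<otimes> g \<otimes> g) =
      (f \<otimes> g \<otimes> f \<otimes> g) \<cdot> (\<one> (car D) \<otimes> \<c> (car D) (car E) \<otimes> \<one> (car E))"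
    using braid_natural[of f g] by (simp add: interchanges)
  have "\<delta>\<^bsub>tensor_coalgebra C D' E'\<^esub> \<cdot> (f \<otimes> g) =
    (\<one> (car D') \<otimes> \<c> (car D') (car E') \<otimes> \<one> (car E')) \<cdot> (f \<otimes> f \<otimes> g \<otimes> g) \<cdot> (\<delta>\<^bsub>D\<^esub> \<otimes> \<delta>\<^bsub>E\<^esub>)"
    by (simp add: interchanges)
  also have "\<dots> = ((f \<otimes> g) \<otimes> (f \<otimes> g)) \<cdot> \<delta>\<^bsub>tensor_coalgebra C D E\<^esub>"
    by (subst comp_eq_comp[OF 1]) simp_all
  finally show ?thesis
    by (auto simp: coalgebra_morphism_def interchanges intro!: HomI)
qed

lemma tensor_coalgebra_assoc:
  assumes [simp]: "coalgebra C D" "coalgebra C E" "coalgebra C F"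
  shows "tensor_coalgebra C (tensor_coalgebra C D E) F = tensor_coalgebra C D (tensor_coalgebra C E F)"
proof -
  define a b c where [simp]: "a = car D" "b = car E" "c = car F"
  have 1: "(\<one> a \<otimes> \<one> b \<otimes> \<c> (a \<boxtimes> b) c \<otimes> \<one> c) \<cdot> (\<one> a \<otimes> \<c> a b \<otimes> \<one> b \<otimes> \<one> c \<otimes> \<one> c) =
      (\<one> a \<otimes> \<c> a (b \<boxtimes> c) \<otimes> \<one> b \<otimes> \<one> c) \<cdot> (\<one> a \<otimes> \<one> a \<otimes> \<one> b \<otimes> \<c> b c \<otimes> \<one> c)"
    using arg_cong[OF braid_exchange[of a b b c], of "\<lambda>x. \<one> a \<otimes> x \<otimes> \<one> c"]
    by (simp add: whisker)
  have "\<delta>\<^bsub>tensor_coalgebra C (tensor_coalgebra C D E) F\<^esub> = (\<one> a \<otimes> \<one> b \<otimes> \<c> (a \<boxtimes> b) c \<otimes> \<one> c) \<cdot>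
     (\<one> a \<otimes> \<c> a b \<otimes> \<one> b \<otimes> \<one> c \<otimes> \<one> c) \<cdot> (\<delta>\<^bsub>D\<^esub> \<otimes> \<delta>\<^bsub>E\<^esub> \<otimes> \<delta>\<^bsub>F\<^esub>)"
    using interchange[of "\<delta>\<^bsub>D\<^esub> \<otimes> \<delta>\<^bsub>E\<^esub>" "\<one> a \<otimes> \<c> a b \<otimes> \<one> b" "\<delta>\<^bsub>F\<^esub>" "\<one> c \<otimes> \<one> c"] by simp
  also have "\<dots> = \<delta>\<^bsub>tensor_coalgebra C D (tensor_coalgebra C E F)\<^esub>"
    using interchange[of "\<delta>\<^bsub>D\<^esub>" "\<one> a \<otimes> \<one> a" "\<delta>\<^bsub>E\<^esub> \<otimes> \<delta>\<^bsub>F\<^esub>" "\<one> b \<otimes> \<c> b c \<otimes> \<one> c"]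
    by (subst comp_eq_comp[OF 1]) simp_all
  finally show ?thesis by (simp add: tensor_coalgebra_def)
qed

text \<open>The effect of discarding the second tensor factor in the left, respectively the right, copy
  of the coproduct.\<close>

lemma tensor_coalgebra_proj:
  assumes [simp]: "coalgebra C D" "coalgebra C E"
  shows "(\<one> (car D) \<otimes> \<epsilon>\<^bsub>E\<^esub> \<otimes> \<one> (car D) \<otimes> \<one> (car E)) \<cdot> \<delta>\<^bsub>tensor_coalgebra C D E\<^esub> = \<delta>\<^bsub>D\<^esub> \<otimes> \<one> (car E)"
    "(\<one> (car D) \<otimes> \<one> (car E) \<otimes> \<one> (car D) \<otimes> \<epsilon>\<^bsub>E\<^esub>) \<cdot> \<delta>\<^bsub>tensor_coalgebra C D E\<^esub> =
      (\<one> (car D) \<otimes> \<c> (car D) (car E)) \<cdot> (\<delta>\<^bsub>D\<^esub> \<otimes> \<one> (car E))"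
proof -
  show "(\<one> (car D) \<otimes> \<epsilon>\<^bsub>E\<^esub> \<otimes> \<one> (car D) \<otimes> \<one> (car E)) \<cdot> \<delta>\<^bsub>tensor_coalgebra C D E\<^esub> = \<delta>\<^bsub>D\<^esub> \<otimes> \<one> (car E)"
    by (simp add: interchanges)
  have "\<one> (car D) \<otimes> \<c> (car D) (car E) \<otimes> \<epsilon>\<^bsub>E\<^esub> =
      (\<one> (car D) \<otimes> \<c> (car D) (car E)) \<cdot> (\<one> (car D) \<otimes> \<one> (car D) \<otimes> \<one> (car E) \<otimes> \<epsilon>\<^bsub>E\<^esub>)"
    using interchange[of "\<one> (car D) \<otimes> \<one> (car D) \<otimes> \<one> (car E)" "\<one> (car D) \<otimes> \<c> (car D) (car E)" "\<epsilon>\<^bsub>E\<^esub>" "\<one> \<K>"]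
    by simp
  moreover have "(\<one> (car D) \<otimes> \<one> (car E) \<otimes> \<one> (car D) \<otimes> \<epsilon>\<^bsub>E\<^esub>) \<cdot> \<delta>\<^bsub>tensor_coalgebra C D E\<^esub> =
      (\<one> (car D) \<otimes> \<c> (car D) (car E) \<otimes> \<epsilon>\<^bsub>E\<^esub>) \<cdot> (\<delta>\<^bsub>D\<^esub> \<otimes> \<delta>\<^bsub>E\<^esub>)"
    by (simp add: interchanges)
  moreover have "(\<one> (car D) \<otimes> \<one> (car D) \<otimes> \<one> (car E) \<otimes> \<epsilon>\<^bsub>E\<^esub>) \<cdot> (\<delta>\<^bsub>D\<^esub> \<otimes> \<delta>\<^bsub>E\<^esub>) = \<delta>\<^bsub>D\<^esub> \<otimes> \<one> (car E)"
    by (simp add: interchanges)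
  ultimately show "(\<one> (car D) \<otimes> \<one> (car E) \<otimes> \<one> (car D) \<otimes> \<epsilon>\<^bsub>E\<^esub>) \<cdot> \<delta>\<^bsub>tensor_coalgebra C D E\<^esub> =
      (\<one> (car D) \<otimes> \<c> (car D) (car E)) \<cdot> (\<delta>\<^bsub>D\<^esub> \<otimes> \<one> (car E))"
    by simp
qed

text \<open>Convolution on \<open>B \<otimes> E\<close> of morphisms that factor through \<open>1 \<otimes> u\<close> and \<open>1 \<otimes> v\<close>: the right-hand
  side has the shape of the distributive laws for actions.\<close>

lemma conv_tensor:
  assumes [simp]: "coalgebra C B" "coalgebra C E"
    and [simp]: "\<beta> \<in> Arr C" "Dom C \<beta> = car B \<boxtimes> Cod C u" "\<gamma> \<in> Arr C" "Dom C \<gamma> = car B \<boxtimes> Cod C v"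
    and [simp]: "u \<in> Arr C" "Dom C u = car E" "v \<in> Arr C" "Dom C v = car E"
    and [simp]: "m \<in> Arr C" "Dom C m = Cod C \<beta> \<boxtimes> Cod C \<gamma>"
  shows "conv m (tensor_coalgebra C B E) (\<beta> \<cdot> (\<one> (car B) \<otimes> u)) (\<gamma> \<cdot> (\<one> (car B) \<otimes> v)) =
    m \<cdot> (\<beta> \<otimes> \<gamma>) \<cdot> (\<one> (car B) \<otimes> \<c> (car B) (Cod C u) \<otimes> \<one> (Cod C v)) \<cdot>
      (\<delta>\<^bsub>B\<^esub> \<otimes> \<one> (Cod C u) \<otimes> \<one> (Cod C v)) \<cdot> (\<one> (car B) \<otimes> ((u \<otimes> v) \<cdot> \<delta>\<^bsub>E\<^esub>))"
proof -
  have 1: "(\<one> (car B) \<otimes> \<c> (car B) (Cod C u) \<otimes> \<one> (Cod C v)) \<cdot> (\<one> (car B) \<otimes> \<one> (car B) \<otimes> u \<otimes> v)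
     = (\<one> (car B) \<otimes> u \<otimes> \<one> (car B) \<otimes> v) \<cdot> (\<one> (car B) \<otimes> \<c> (car B) (car E) \<otimes> \<one> (car E))"
    using braid_natural[of "\<one> (car B)" u] by (simp add: interchanges)
  have 2: "(\<delta>\<^bsub>B\<^esub> \<otimes> \<one> (Cod C u) \<otimes> \<one> (Cod C v)) \<cdot> (\<one> (car B) \<otimes> ((u \<otimes> v) \<cdot> \<delta>\<^bsub>E\<^esub>)) =
     (\<one> (car B) \<otimes> \<one> (car B) \<otimes> u \<otimes> v) \<cdot> (\<delta>\<^bsub>B\<^esub> \<otimes> \<delta>\<^bsub>E\<^esub>)"
    by (simp add: interchanges)
  have 3: "(\<beta> \<cdot> (\<one> (car B) \<otimes> u)) \<otimes> (\<gamma> \<cdot> (\<one> (car B) \<otimes> v)) =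
      (\<beta> \<otimes> \<gamma>) \<cdot> (\<one> (car B) \<otimes> u \<otimes> \<one> (car B) \<otimes> v)"
    by (simp add: interchanges)
  show ?thesis
    unfolding 2
    by (subst comp_eq_comp[OF 1]) (simp_all add: conv_def 3)
qed

lemma coalgebra_tensor [simp]:
  assumes "coalgebra C D" "coalgebra C E"
  shows "coalgebra C (tensor_coalgebra C D E)"
  unfolding coalgebra_def
  using tensor_coalgebra_counits[OF assms] tensor_coalgebra_coassoc[OF assms] assms
  by (auto intro!: HomI)

lemma unit_coalgebra_sel [simp]:
  "car (unit_coalgebra C) = \<K>" "\<epsilon>\<^bsub>unit_coalgebra C\<^esub> = \<one> \<K>" "\<delta>\<^bsub>unit_coalgebra C\<^esub> = \<one> \<K>"
  by (simp_all add: unit_coalgebra_def)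

lemma coalgebra_unit [simp]: "coalgebra C (unit_coalgebra C)"
  by (auto simp: coalgebra_def intro!: HomI)

lemma coalgebra_morphismD:
  assumes "coalgebra_morphism C D E f"
  shows "f \<in> Hom C (car D) (car E)" "f \<in> Arr C" "Dom C f = car D" "Cod C f = car E"
    "\<epsilon>\<^bsub>E\<^esub> \<cdot> f = \<epsilon>\<^bsub>D\<^esub>" "\<delta>\<^bsub>E\<^esub> \<cdot> f = (f \<otimes> f) \<cdot> \<delta>\<^bsub>D\<^esub>"
  using assms by (auto simp: coalgebra_morphism_def Hom_def)

lemma coalgebra_morphism_ident [simp]: "coalgebra C D \<Longrightarrow> coalgebra_morphism C D D (\<one> (car D))"
  by (auto simp: coalgebra_morphism_def intro!: HomI)

lemma coalgebra_morphism_comp: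
  assumes [simp]: "coalgebra C D" "coalgebra C E" "coalgebra C F"
    and f: "coalgebra_morphism C D E f" and g: "coalgebra_morphism C E F g"
  shows "coalgebra_morphism C D F (g \<cdot> f)"
proof -
  note [simp] = coalgebra_morphismD[OF f] coalgebra_morphismD[OF g]
  show ?thesis
    by (auto simp: coalgebra_morphism_def interchanges comp_eq_comp[OF coalgebra_morphismD(5)[OF g]]
        comp_eq_comp[OF coalgebra_morphismD(6)[OF g]] intro!: HomI)
qed

lemma coalgebra_morphism_counit [simp]:
  assumes [simp]: "coalgebra C D"
  shows "coalgebra_morphism C D (unit_coalgebra C) \<epsilon>\<^bsub>D\<^esub>"
proof -
  have "\<epsilon>\<^bsub>D\<^esub> \<otimes> \<epsilon>\<^bsub>D\<^esub> = \<epsilon>\<^bsub>D\<^esub> \<cdot> (\<epsilon>\<^bsub>D\<^esub> \<otimes> \<one> (car D))"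
    using interchange[of "\<epsilon>\<^bsub>D\<^esub>" "\<one> \<K>" "\<one> (car D)" "\<epsilon>\<^bsub>D\<^esub>"] by simp
  then show ?thesis
    by (auto simp: coalgebra_morphism_def intro!: HomI)
qed

lemma coalgebra_morphism_proj1 [simp]:
  assumes [simp]: "coalgebra C D" "coalgebra C E"
  shows "coalgebra_morphism C (tensor_coalgebra C D E) D (\<one> (car D) \<otimes> \<epsilon>\<^bsub>E\<^esub>)"
  using tensor_coalgebra_morphism[of D E D "unit_coalgebra C" "\<one> (car D)" "\<epsilon>\<^bsub>E\<^esub>",
      OF _ _ _ _ coalgebra_morphism_ident coalgebra_morphism_counit]
  by (simp add: coalgebra_morphism_def[of C "tensor_coalgebra C D E"])

text \<open>Expressions of the form \<open>m \<cdot> (f \<otimes> g) \<cdot> (\<delta> \<otimes> 1)\<close> are convolution products on a tensor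
  product coalgebra.\<close>

lemma conv_proj1:
  assumes [simp]: "coalgebra C D" "coalgebra C E"
    and [simp]: "f \<in> Arr C" "Dom C f = car D" "g \<in> Arr C" "Dom C g = car D \<boxtimes> car E"
    and [simp]: "m \<in> Arr C" "Dom C m = Cod C f \<boxtimes> Cod C g"
  shows "conv m (tensor_coalgebra C D E) (f \<cdot> (\<one> (car D) \<otimes> \<epsilon>\<^bsub>E\<^esub>)) g =
    m \<cdot> (f \<otimes> g) \<cdot> (\<delta>\<^bsub>D\<^esub> \<otimes> \<one> (car E))"
proof -
  have 1: "(f \<cdot> (\<one> (car D) \<otimes> \<epsilon>\<^bsub>E\<^esub>)) \<otimes> g = (f \<otimes> g) \<cdot> (\<one> (car D) \<otimes> \<epsilon>\<^bsub>E\<^esub> \<otimes> \<one> (car D) \<otimes> \<one> (car E))"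
    using interchange[of "\<one> (car D) \<otimes> \<epsilon>\<^bsub>E\<^esub>" f "\<one> (car D) \<otimes> \<one> (car E)" g] by simp
  show ?thesis
    unfolding conv_def 1
    using tensor_coalgebra_proj(1)[of D E] by simp
qed

lemma algebra_comp_conv:
  assumes "k \<cdot> m = m' \<cdot> (k \<otimes> k)" "k \<in> Hom C A A'" "m \<in> Hom C (A \<boxtimes> A) A" "m' \<in> Hom C (A' \<boxtimes> A') A'"
    "coalgebra C D" "f \<in> Hom C (car D) A" "g \<in> Hom C (car D) A"
  shows "k \<cdot> conv m D f g = conv m' D (k \<cdot> f) (k \<cdot> g)"
proof -
  note [simp] = assms(5) HomD[OF assms(2)] HomD[OF assms(3)] HomD[OF assms(4)] HomD[OF assms(6)] HomD[OF assms(7)]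
  show ?thesis
    by (simp add: conv_def comp_eq_comp[OF assms(1)] interchanges)
qed

lemma conv_cancel:
  assumes A: "algebra A m e" "coalgebra C D"
    and H: "u \<in> Hom C (car D) A" "x \<in> Hom C (car D) A" "y \<in> Hom C (car D) A" "z \<in> Hom C (car D) A"
    and 1: "conv m D u x = e \<cdot> \<epsilon>\<^bsub>D\<^esub>" and eq: "conv m D x y = conv m D x z"
  shows "y = z"
proof -
  have "y = conv m D (conv m D u x) y"
    using conv_unit[OF A H(3)] 1 by simp
  also have "\<dots> = conv m D (conv m D u x) z"
    using eq conv_assoc[OF A] H by simp
  also have "\<dots> = z"
    using conv_unit[OF A H(4)] 1 by simp
  finally show ?thesis .
qed

lemma conv_inverse_unique:
  assumes A: "algebra A m e" "coalgebra C D"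
    and H: "u \<in> Hom C (car D) A" "x \<in> Hom C (car D) A" "v \<in> Hom C (car D) A"
    and 1: "conv m D u x = e \<cdot> \<epsilon>\<^bsub>D\<^esub>" and 2: "conv m D x v = e \<cdot> \<epsilon>\<^bsub>D\<^esub>"
  shows "u = v"
proof -
  have "u = conv m D u (conv m D x v)"
    using conv_unit[OF A H(1)] 2 by simp
  also have "\<dots> = conv m D (conv m D u x) v"
    using conv_assoc[OF A] H by simp
  also have "\<dots> = v"
    using conv_unit[OF A H(3)] 1 by simp
  finally show ?thesis .
qed

section \<open>Hopf algebras and convolution into the tensor square\<close>

lemma hopf_algebraD:
  assumes "hopf_algebra C H"
  shows "coalgebra C H" "nonunital_bialgebra C H" "algebra (car H) \<mu>\<^bsub>H\<^esub> \<eta>\<^bsub>H\<^esub>"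
    "coalgebra_morphism C (tensor_coalgebra C H H) H \<mu>\<^bsub>H\<^esub>"
    "coalgebra_morphism C (unit_coalgebra C) H \<eta>\<^bsub>H\<^esub>"
    "\<S>\<^bsub>H\<^esub> \<in> Hom C (car H) (car H)"
    "conv \<mu>\<^bsub>H\<^esub> H \<S>\<^bsub>H\<^esub> (\<one> (car H)) = \<eta>\<^bsub>H\<^esub> \<cdot> \<epsilon>\<^bsub>H\<^esub>"
    "conv \<mu>\<^bsub>H\<^esub> H (\<one> (car H)) \<S>\<^bsub>H\<^esub> = \<eta>\<^bsub>H\<^esub> \<cdot> \<epsilon>\<^bsub>H\<^esub>"
  using assms by (auto simp: hopf_algebra_def nonunital_bialgebra_def algebra_def conv_def)

lemma conv_antipode:
  assumes H: "hopf_algebra C H" and D: "coalgebra C D" and f: "coalgebra_morphism C D H f"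
  shows "conv \<mu>\<^bsub>H\<^esub> D (\<S>\<^bsub>H\<^esub> \<cdot> f) f = \<eta>\<^bsub>H\<^esub> \<cdot> \<epsilon>\<^bsub>D\<^esub>" "conv \<mu>\<^bsub>H\<^esub> D f (\<S>\<^bsub>H\<^esub> \<cdot> f) = \<eta>\<^bsub>H\<^esub> \<cdot> \<epsilon>\<^bsub>D\<^esub>"
proof -
  note h = hopf_algebraD[OF H]
  note [simp] = h(1) D coalgebra_morphismD[OF f] HomD[OF h(6)] algebraD(1-7)[OF h(3)]
  show "conv \<mu>\<^bsub>H\<^esub> D (\<S>\<^bsub>H\<^esub> \<cdot> f) f = \<eta>\<^bsub>H\<^esub> \<cdot> \<epsilon>\<^bsub>D\<^esub>"
    using conv_comp[of "\<mu>\<^bsub>H\<^esub>" "\<S>\<^bsub>H\<^esub>" "\<one> (car H)" D H f] f h(7) by simp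
  show "conv \<mu>\<^bsub>H\<^esub> D f (\<S>\<^bsub>H\<^esub> \<cdot> f) = \<eta>\<^bsub>H\<^esub> \<cdot> \<epsilon>\<^bsub>D\<^esub>"
    using conv_comp[of "\<mu>\<^bsub>H\<^esub>" "\<one> (car H)" "\<S>\<^bsub>H\<^esub>" D H f] f h(8) by simp
qed

text \<open>Both sides are convolution inverses of \<open>f\<close>.\<close>

lemma hopf_algebra_morphism_antipode:
  assumes H: "hopf_algebra C H" and B: "hopf_algebra C B" and f: "hopf_algebra_morphism C H B f"
  shows "f \<cdot> \<S>\<^bsub>H\<^esub> = \<S>\<^bsub>B\<^esub> \<cdot> f"
proof -
  note h = hopf_algebraD[OF H] and b = hopf_algebraD[OF B]
  have f': "coalgebra_morphism C H B f" "f \<cdot> \<mu>\<^bsub>H\<^esub> = \<mu>\<^bsub>B\<^esub> \<cdot> (f \<otimes> f)" "f \<cdot> \<eta>\<^bsub>H\<^esub> = \<eta>\<^bsub>B\<^esub>"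
    using f by (auto simp: hopf_algebra_morphism_def)
  note [simp] = h(1) b(1) coalgebra_morphismD[OF f'(1)] HomD[OF h(6)] HomD[OF b(6)]
    algebraD(1-7)[OF h(3)] algebraD(1-7)[OF b(3)]
  have "conv \<mu>\<^bsub>B\<^esub> H (f \<cdot> \<S>\<^bsub>H\<^esub>) f = f \<cdot> conv \<mu>\<^bsub>H\<^esub> H \<S>\<^bsub>H\<^esub> (\<one> (car H))"
    by (subst algebra_comp_conv[OF f'(2)]) (auto intro: HomI)
  also have "\<dots> = \<eta>\<^bsub>B\<^esub> \<cdot> \<epsilon>\<^bsub>H\<^esub>"
    by (simp add: h(7) comp_eq_comp[OF f'(3)])
  finally show ?thesis
    by (intro conv_inverse_unique[OF b(3) h(1) _ _ _ _ conv_antipode(2)[OF B h(1) f'(1)]])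
      (auto intro: HomI)
qed

text \<open>The product of the braided tensor square \<open>A \<otimes> A\<close> of an algebra \<open>A\<close> with product \<open>m\<close>.\<close>

definition tensor_product :: "'a \<Rightarrow> 'b \<Rightarrow> 'b"
  where "tensor_product A m = (m \<otimes> m) \<cdot> (\<one> A \<otimes> \<c> A A \<otimes> \<one> A)"

lemma braid_from_unit [simp]:
  assumes "X \<in> Obj C" "f \<in> Arr C" "Dom C f = \<K>" "Cod C f = Y"
  shows "\<c> X Y \<cdot> (\<one> X \<otimes> f) = f \<otimes> \<one> X" "\<c> Y X \<cdot> (f \<otimes> \<one> X) = \<one> X \<otimes> f"
  using braid_natural[of "\<one> X" f] braid_natural[of f "\<one> X"] assms by simp_all

lemma algebra_tensor:
  assumes a: "algebra A m e"
  shows "algebra (A \<boxtimes> A) (tensor_product A m) (e \<otimes> e)"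
proof -
  note [simp] = algebraD(1-7)[OF a]
  have l: "tensor_product A m \<cdot> (tensor_product A m \<otimes> \<one> (A \<boxtimes> A)) =
    ((m \<cdot> (m \<otimes> \<one> A)) \<otimes> (m \<cdot> (m \<otimes> \<one> A))) \<cdot>
      (\<one> A \<otimes> \<one> A \<otimes> \<c> (A \<boxtimes> A) A \<otimes> \<one> A) \<cdot> (\<one> A \<otimes> \<c> A A \<otimes> \<one> A \<otimes> \<one> A \<otimes> \<one> A)"
  proof -
    have 1: "(\<one> A \<otimes> \<c> A A \<otimes> \<one> A) \<cdot> (m \<otimes> m \<otimes> \<one> A \<otimes> \<one> A) =
      (m \<otimes> \<one> A \<otimes> m \<otimes> \<one> A) \<cdot> (\<one> A \<otimes> \<one> A \<otimes> \<c> (A \<boxtimes> A) A \<otimes> \<one> A)"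
      using braid_natural[of m "\<one> A"] by (simp add: interchanges)
    have 2: "(m \<cdot> (m \<otimes> \<one> A)) \<otimes> (m \<cdot> (m \<otimes> \<one> A)) = (m \<otimes> m) \<cdot> (m \<otimes> \<one> A \<otimes> m \<otimes> \<one> A)"
      by (simp add: interchanges)
    show ?thesis
      unfolding 2 by (simp add: tensor_product_def whisker2 comp_eq_comp[OF 1])
  qed
  have r: "tensor_product A m \<cdot> (\<one> (A \<boxtimes> A) \<otimes> tensor_product A m) =
    ((m \<cdot> (\<one> A \<otimes> m)) \<otimes> (m \<cdot> (\<one> A \<otimes> m))) \<cdot>
      (\<one> A \<otimes> \<c> A (A \<boxtimes> A) \<otimes> \<one> A \<otimes> \<one> A) \<cdot> (\<one> A \<otimes> \<one> A \<otimes> \<one> A \<otimes> \<c> A A \<otimes> \<one> A)"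
  proof -
    have 1: "(\<one> A \<otimes> \<c> A A \<otimes> \<one> A) \<cdot> (\<one> A \<otimes> \<one> A \<otimes> m \<otimes> m) =
      (\<one> A \<otimes> m \<otimes> \<one> A \<otimes> m) \<cdot> (\<one> A \<otimes> \<c> A (A \<boxtimes> A) \<otimes> \<one> A \<otimes> \<one> A)"
      using braid_natural[of "\<one> A" m] by (simp add: interchanges)
    have 2: "(m \<cdot> (\<one> A \<otimes> m)) \<otimes> (m \<cdot> (\<one> A \<otimes> m)) = (m \<otimes> m) \<cdot> (\<one> A \<otimes> m \<otimes> \<one> A \<otimes> m)"
      by (simp add: interchanges)
    show ?thesis
      unfolding 2 by (simp add: tensor_product_def whisker comp_eq_comp[OF 1])
  qed
  have "(\<one> A \<otimes> \<one> A \<otimes> \<c> (A \<boxtimes> A) A \<otimes> \<one> A) \<cdot> (\<one> A \<otimes> \<c> A A \<otimes> \<one> A \<otimes> \<one> A \<otimes> \<one> A) =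
      (\<one> A \<otimes> \<c> A (A \<boxtimes> A) \<otimes> \<one> A \<otimes> \<one> A) \<cdot> (\<one> A \<otimes> \<one> A \<otimes> \<one> A \<otimes> \<c> A A \<otimes> \<one> A)"
    using arg_cong[OF braid_exchange[of A A A A], of "\<lambda>x. \<one> A \<otimes> x \<otimes> \<one> A"]
    by (simp add: whisker)
  then have "tensor_product A m \<cdot> (tensor_product A m \<otimes> \<one> (A \<boxtimes> A)) =
      tensor_product A m \<cdot> (\<one> (A \<boxtimes> A) \<otimes> tensor_product A m)"
    unfolding l r by (simp add: algebraD(8)[OF a])
  moreover have "tensor_product A m \<cdot> ((e \<otimes> e) \<otimes> \<one> (A \<boxtimes> A)) = \<one> (A \<boxtimes> A)"
    by (simp add: tensor_product_def interchanges algebraD[OF a])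
  moreover have "tensor_product A m \<cdot> (\<one> (A \<boxtimes> A) \<otimes> (e \<otimes> e)) = \<one> (A \<boxtimes> A)"
    by (simp add: tensor_product_def interchanges algebraD[OF a])
  ultimately show ?thesis
    unfolding algebra_def by (auto intro!: HomI simp: tensor_product_def)
qed

text \<open>Iterated coproducts agree: the middle two of four strands may be split off last.\<close>

lemma coalgebra_delta4:
  assumes [simp]: "coalgebra C D"
  shows "(\<delta>\<^bsub>D\<^esub> \<otimes> \<delta>\<^bsub>D\<^esub>) \<cdot> \<delta>\<^bsub>D\<^esub> = (\<one> (car D) \<otimes> \<delta>\<^bsub>D\<^esub> \<otimes> \<one> (car D)) \<cdot> (\<delta>\<^bsub>D\<^esub> \<otimes> \<one> (car D)) \<cdot> \<delta>\<^bsub>D\<^esub>"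
proof -
  have "(\<delta>\<^bsub>D\<^esub> \<otimes> \<delta>\<^bsub>D\<^esub>) \<cdot> \<delta>\<^bsub>D\<^esub> = (\<delta>\<^bsub>D\<^esub> \<otimes> \<one> (car D) \<otimes> \<one> (car D)) \<cdot> (\<one> (car D) \<otimes> \<delta>\<^bsub>D\<^esub>) \<cdot> \<delta>\<^bsub>D\<^esub>"
    by (simp add: interchanges)
  also have "\<dots> = (\<delta>\<^bsub>D\<^esub> \<otimes> \<one> (car D) \<otimes> \<one> (car D)) \<cdot> (\<delta>\<^bsub>D\<^esub> \<otimes> \<one> (car D)) \<cdot> \<delta>\<^bsub>D\<^esub>"
    by (simp add: coassoc)
  also have "\<dots> = (((\<delta>\<^bsub>D\<^esub> \<otimes> \<one> (car D)) \<cdot> \<delta>\<^bsub>D\<^esub>) \<otimes> \<one> (car D)) \<cdot> \<delta>\<^bsub>D\<^esub>"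
    by (simp add: interchanges)
  also have "\<dots> = (\<one> (car D) \<otimes> \<delta>\<^bsub>D\<^esub> \<otimes> \<one> (car D)) \<cdot> (\<delta>\<^bsub>D\<^esub> \<otimes> \<one> (car D)) \<cdot> \<delta>\<^bsub>D\<^esub>"
    by (simp add: coassoc whisker)
  finally show ?thesis .
qed

text \<open>The hypothesis \<open>comm\<close> is what allows the middle \<open>f\<close> and \<open>g\<close> to change places. No assumption
  is made on how \<open>g\<close> interacts with the coproducts, so the lemma serves both to pass from \<open>g\<close>
  being a coalgebra morphism to \<open>f * g\<close> being one, and in the other direction.\<close>

lemma conv_tensor_product:
  assumes H: "hopf_algebra C H" and [simp]: "coalgebra C D"
    and f: "coalgebra_morphism C D H f" and g: "g \<in> Hom C (car D) (car H)"
    and comm: "(g \<otimes> f) \<cdot> \<c> (car D) (car D) \<cdot> \<delta>\<^bsub>D\<^esub> = (g \<otimes> f) \<cdot> \<delta>\<^bsub>D\<^esub>"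
  shows "conv (tensor_product (car H) \<mu>\<^bsub>H\<^esub>) D (\<delta>\<^bsub>H\<^esub> \<cdot> f) ((g \<otimes> g) \<cdot> \<delta>\<^bsub>D\<^esub>) =
    (conv \<mu>\<^bsub>H\<^esub> D f g \<otimes> conv \<mu>\<^bsub>H\<^esub> D f g) \<cdot> \<delta>\<^bsub>D\<^esub>"
proof -
  note h = hopf_algebraD[OF H]
  note [simp] = h(1) coalgebra_morphismD[OF f] HomD[OF g] algebraD(1-7)[OF h(3)]
  let ?d = "\<delta>\<^bsub>D\<^esub>" and ?D = "\<one> (car D)" and ?H = "\<one> (car H)"
  have 0: "\<c> (car H) (car H) \<cdot> (f \<otimes> g) \<cdot> ?d = (g \<otimes> f) \<cdot> ?d"
    using comp_eq_comp[OF braid_natural[of f g], of ?d] comm by simp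
  have 1: "(?H \<otimes> \<c> (car H) (car H) \<otimes> ?H) \<cdot> (f \<otimes> f \<otimes> g \<otimes> g) \<cdot> (?D \<otimes> ?d \<otimes> ?D) =
      (f \<otimes> g \<otimes> f \<otimes> g) \<cdot> (?D \<otimes> ?d \<otimes> ?D)"
    using 0 by (simp add: interchanges)
  have "conv (tensor_product (car H) \<mu>\<^bsub>H\<^esub>) D (\<delta>\<^bsub>H\<^esub> \<cdot> f) ((g \<otimes> g) \<cdot> ?d) =
    (\<mu>\<^bsub>H\<^esub> \<otimes> \<mu>\<^bsub>H\<^esub>) \<cdot> (?H \<otimes> \<c> (car H) (car H) \<otimes> ?H) \<cdot> (f \<otimes> f \<otimes> g \<otimes> g) \<cdot> (?d \<otimes> ?d) \<cdot> ?d"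
    using comp_eq_comp[OF interchange[of ?d "f \<otimes> f" ?d "g \<otimes> g"], of ?d]
    by (simp add: conv_def tensor_product_def)
  also have "\<dots> = (\<mu>\<^bsub>H\<^esub> \<otimes> \<mu>\<^bsub>H\<^esub>) \<cdot> (f \<otimes> g \<otimes> f \<otimes> g) \<cdot> (?d \<otimes> ?d) \<cdot> ?d"
    using comp_eq_comp[OF 1, of "(?d \<otimes> ?D) \<cdot> ?d"] by (simp add: coalgebra_delta4)
  also have "\<dots> = (conv \<mu>\<^bsub>H\<^esub> D f g \<otimes> conv \<mu>\<^bsub>H\<^esub> D f g) \<cdot> ?d"
    by (simp add: conv_def interchanges)
  finally show ?thesis .
qed

text \<open>The star condition, with the two copies of \<open>H\<close> bundled into the coalgebra \<open>P = H \<otimes> H\<close>.\<close>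

lemma star_condition_iff:
  assumes [simp]: "coalgebra C H" and m: "m \<in> Hom C (car H \<boxtimes> car H) (car H)"
  defines "P \<equiv> tensor_coalgebra C H H"
  shows "star_condition C H m \<longleftrightarrow>
    (m \<otimes> (\<one> (car H) \<otimes> \<epsilon>\<^bsub>H\<^esub>)) \<cdot> \<c> (car P) (car P) \<cdot> \<delta>\<^bsub>P\<^esub> = (m \<otimes> (\<one> (car H) \<otimes> \<epsilon>\<^bsub>H\<^esub>)) \<cdot> \<delta>\<^bsub>P\<^esub>"
proof -
  note [simp] = HomD[OF m]
  let ?h = "\<one> (car H)" and ?p = "\<one> (car H) \<otimes> \<epsilon>\<^bsub>H\<^esub>" and ?a = "car H"
  have dP [simp]: "\<delta>\<^bsub>P\<^esub> \<in> Arr C" "Dom C \<delta>\<^bsub>P\<^esub> = ?a \<boxtimes> ?a" "Cod C \<delta>\<^bsub>P\<^esub> = ?a \<boxtimes> ?a \<boxtimes> ?a \<boxtimes> ?a" "car P = ?a \<boxtimes> ?a"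
    by (simp_all add: P_def)
  have "m \<otimes> ?p = (m \<otimes> ?h) \<cdot> (?h \<otimes> ?h \<otimes> ?p)"
    using interchange[of "?h \<otimes> ?h" m ?p ?h] by simp
  then have r: "(m \<otimes> ?p) \<cdot> \<delta>\<^bsub>P\<^esub> = (m \<otimes> ?h) \<cdot> (?h \<otimes> \<c> ?a ?a) \<cdot> (\<delta>\<^bsub>H\<^esub> \<otimes> ?h)"
    using tensor_coalgebra_proj(2)[of H H] by (simp add: P_def[symmetric] del: tensor_coalgebra_sel)
  have 1: "?p \<otimes> m = (?h \<otimes> m) \<cdot> (?p \<otimes> ?h \<otimes> ?h)"
    using interchange[of ?p ?h "?h \<otimes> ?h" m] by simp
  have 2: "\<c> ?a ?a \<cdot> (?h \<otimes> m) = (m \<otimes> ?h) \<cdot> (?h \<otimes> \<c> ?a ?a) \<cdot> (\<c> ?a ?a \<otimes> ?h)"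
    using braid_natural[of ?h m] by (simp add: Braid_OTensor_right)
  have 3: "(m \<otimes> ?p) \<cdot> \<c> (car P) (car P) = \<c> ?a ?a \<cdot> (?p \<otimes> m)"
    using braid_natural[of ?p m] by simp
  have "(m \<otimes> ?p) \<cdot> \<c> (car P) (car P) \<cdot> \<delta>\<^bsub>P\<^esub> = \<c> ?a ?a \<cdot> (?p \<otimes> m) \<cdot> \<delta>\<^bsub>P\<^esub>"
    by (subst comp_eq_comp[OF 3]) simp_all
  also have "\<dots> = \<c> ?a ?a \<cdot> (?h \<otimes> m) \<cdot> (\<delta>\<^bsub>H\<^esub> \<otimes> ?h)"
    using tensor_coalgebra_proj(1)[of H H] unfolding 1 by (simp add: P_def[symmetric] del: tensor_coalgebra_sel)
  also have "\<dots> = (m \<otimes> ?h) \<cdot> (?h \<otimes> \<c> ?a ?a) \<cdot> ((\<c> ?a ?a \<cdot> \<delta>\<^bsub>H\<^esub>) \<otimes> ?h)"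
    using comp_eq_comp[OF 2, of "\<delta>\<^bsub>H\<^esub> \<otimes> ?h"] by (simp add: whisker)
  finally show ?thesis unfolding star_condition_def r by simp
qed

section \<open>Multiplicative actions\<close>

lemma tensor_coalgebra_proj_proj:
  assumes [simp]: "coalgebra C D" "coalgebra C E"
  shows "(\<one> (car D) \<otimes> \<epsilon>\<^bsub>E\<^esub> \<otimes> \<epsilon>\<^bsub>D\<^esub> \<otimes> \<one> (car E)) \<cdot> \<delta>\<^bsub>tensor_coalgebra C D E\<^esub> = \<one> (car D) \<otimes> \<one> (car E)"
proof -
  have "\<one> (car D) \<otimes> \<epsilon>\<^bsub>E\<^esub> \<otimes> \<epsilon>\<^bsub>D\<^esub> \<otimes> \<one> (car E) =
     (\<one> (car D) \<otimes> \<epsilon>\<^bsub>D\<^esub> \<otimes> \<one> (car E)) \<cdot> (\<one> (car D) \<otimes> \<epsilon>\<^bsub>E\<^esub> \<otimes> \<one> (car D) \<otimes> \<one> (car E))"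
    using interchange[of "\<one> (car D) \<otimes> \<epsilon>\<^bsub>E\<^esub>" "\<one> (car D)" "\<one> (car D) \<otimes> \<one> (car E)" "\<epsilon>\<^bsub>D\<^esub> \<otimes> \<one> (car E)"]
    by simp
  moreover have "(\<one> (car D) \<otimes> \<epsilon>\<^bsub>D\<^esub> \<otimes> \<one> (car E)) \<cdot> (\<delta>\<^bsub>D\<^esub> \<otimes> \<one> (car E)) = \<one> (car D) \<otimes> \<one> (car E)"
    by (simp add: interchanges)
  ultimately show ?thesis
    using tensor_coalgebra_proj(1)[of D E] by (simp del: tensor_coalgebra_sel(3))
qed

text \<open>The distributive law \<open>\<alpha>(b, x y) = \<beta>(b\<^sub>1, x) \<gamma>(b\<^sub>2, y)\<close> for three actions of a coalgebra \<open>B\<close> on an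
  algebra \<open>H\<close>. For \<open>\<alpha> = \<beta> = \<gamma>\<close> it says that \<open>B\<close> measures \<open>H\<close>, without the condition on the unit; for \<open>\<alpha> = \<beta> = \<mu>\<^sub>2\<close> and \<open>\<gamma> = \<Gamma>\<close> it is
  the truss axiom.\<close>

definition measures ::
    "('a, 'b, 'y) coalgebra_data_scheme \<Rightarrow> ('a, 'b, 'z) bialgebra_data_scheme \<Rightarrow> 'b \<Rightarrow> 'b \<Rightarrow> 'b \<Rightarrow> bool"
  where "measures B H \<alpha> \<beta> \<gamma> \<longleftrightarrow>
    \<alpha> \<cdot> (\<one> (car B) \<otimes> \<mu>\<^bsub>H\<^esub>) =
      \<mu>\<^bsub>H\<^esub> \<cdot> (\<beta> \<otimes> \<gamma>) \<cdot> (\<one> (car B) \<otimes> \<c> (car B) (car H) \<otimes> \<one> (car H)) \<cdot>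
        (\<delta>\<^bsub>B\<^esub> \<otimes> \<one> (car H) \<otimes> \<one> (car H))"

lemma measures_conv:
  assumes M: "measures B H \<alpha> \<beta> \<gamma>"
    and B: "coalgebra C B" and E: "coalgebra C E" and H: "algebra (car H) \<mu>\<^bsub>H\<^esub> e"
    and a: "\<alpha> \<in> Hom C (car B \<boxtimes> car H) (car H)" and b: "\<beta> \<in> Hom C (car B \<boxtimes> car H) (car H)"
    and c: "\<gamma> \<in> Hom C (car B \<boxtimes> car H) (car H)"
    and u: "u \<in> Hom C (car E) (car H)" and v: "v \<in> Hom C (car E) (car H)"
  shows "\<alpha> \<cdot> (\<one> (car B) \<otimes> conv \<mu>\<^bsub>H\<^esub> E u v) =
    conv \<mu>\<^bsub>H\<^esub> (tensor_coalgebra C B E) (\<beta> \<cdot> (\<one> (car B) \<otimes> u)) (\<gamma> \<cdot> (\<one> (car B) \<otimes> v))"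
proof -
  note [simp] = B E HomD[OF a] HomD[OF b] HomD[OF c] HomD[OF u] HomD[OF v] algebraD(1-7)[OF H]
  show ?thesis
    using comp_eq_comp[OF M[unfolded measures_def], of "\<one> (car B) \<otimes> ((u \<otimes> v) \<cdot> \<delta>\<^bsub>E\<^esub>)"]
    by (simp add: conv_tensor) (simp add: conv_def whisker)
qed

text \<open>It suffices to test on convolution products, since the two projections of \<open>H \<otimes> H\<close> have
  convolution product \<open>\<mu>\<close>.\<close>

lemma measuresI:
  assumes B: "coalgebra C B" and H: "algebra (car H) \<mu>\<^bsub>H\<^esub> e" "coalgebra C H"
    and a: "\<alpha> \<in> Hom C (car B \<boxtimes> car H) (car H)" and b: "\<beta> \<in> Hom C (car B \<boxtimes> car H) (car H)"
    and c: "\<gamma> \<in> Hom C (car B \<boxtimes> car H) (car H)"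
    and conv: "\<And>u v. u \<in> Hom C (car H \<boxtimes> car H) (car H) \<Longrightarrow> v \<in> Hom C (car H \<boxtimes> car H) (car H) \<Longrightarrow>
      \<alpha> \<cdot> (\<one> (car B) \<otimes> conv \<mu>\<^bsub>H\<^esub> (tensor_coalgebra C H H) u v) =
      conv \<mu>\<^bsub>H\<^esub> (tensor_coalgebra C B (tensor_coalgebra C H H))
        (\<beta> \<cdot> (\<one> (car B) \<otimes> u)) (\<gamma> \<cdot> (\<one> (car B) \<otimes> v))"
  shows "measures B H \<alpha> \<beta> \<gamma>"
proof -
  note [simp] = B H(2) HomD[OF a] HomD[OF b] HomD[OF c] algebraD(1-7)[OF H(1)]
  let ?u = "\<one> (car H) \<otimes> \<epsilon>\<^bsub>H\<^esub>" and ?v = "\<epsilon>\<^bsub>H\<^esub> \<otimes> \<one> (car H)" and ?P = "tensor_coalgebra C H H"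
  have 1: "(?u \<otimes> ?v) \<cdot> \<delta>\<^bsub>?P\<^esub> = \<one> (car H) \<otimes> \<one> (car H)"
    using tensor_coalgebra_proj_proj[of H H] by (simp del: tensor_coalgebra_sel(3))
  have "conv \<mu>\<^bsub>H\<^esub> ?P ?u ?v = \<mu>\<^bsub>H\<^esub>"
    unfolding conv_def 1 by simp
  then show ?thesis
    using conv[of ?u ?v] conv_tensor[of B ?P \<beta> ?u \<gamma> ?v "\<mu>\<^bsub>H\<^esub>"] unfolding 1 measures_def
    by (simp add: HomI)
qed

lemma counit_conv:
  assumes H: "hopf_algebra C H" and [simp]: "coalgebra C D"
    and f: "f \<in> Hom C (car D) (car H)" "\<epsilon>\<^bsub>H\<^esub> \<cdot> f = \<epsilon>\<^bsub>D\<^esub>" and g: "g \<in> Hom C (car D) (car H)"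
  shows "\<epsilon>\<^bsub>H\<^esub> \<cdot> conv \<mu>\<^bsub>H\<^esub> D f g = \<epsilon>\<^bsub>H\<^esub> \<cdot> g"
proof -
  note h = hopf_algebraD[OF H]
  note [simp] = h(1) HomD[OF f(1)] HomD[OF g] algebraD(1-7)[OF h(3)]
  have 1: "\<epsilon>\<^bsub>H\<^esub> \<cdot> \<mu>\<^bsub>H\<^esub> = \<epsilon>\<^bsub>H\<^esub> \<otimes> \<epsilon>\<^bsub>H\<^esub>"
    using coalgebra_morphismD(5)[OF h(4)] by simp
  have 2: "\<epsilon>\<^bsub>D\<^esub> \<otimes> (\<epsilon>\<^bsub>H\<^esub> \<cdot> g) = \<epsilon>\<^bsub>H\<^esub> \<cdot> g \<cdot> (\<epsilon>\<^bsub>D\<^esub> \<otimes> \<one> (car D))"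
    using interchange[of "\<epsilon>\<^bsub>D\<^esub>" "\<one> \<K>" "\<one> (car D)" "\<epsilon>\<^bsub>H\<^esub> \<cdot> g"] by simp
  have "\<epsilon>\<^bsub>H\<^esub> \<cdot> conv \<mu>\<^bsub>H\<^esub> D f g = (\<epsilon>\<^bsub>D\<^esub> \<otimes> (\<epsilon>\<^bsub>H\<^esub> \<cdot> g)) \<cdot> \<delta>\<^bsub>D\<^esub>"
    by (simp add: conv_def comp_eq_comp[OF 1] interchanges f(2))
  then show ?thesis unfolding 2 by simp
qed

lemma conv_tensor_unit [simp]:
  assumes [simp]: "coalgebra C D"
  shows "conv m (tensor_coalgebra C D (unit_coalgebra C)) f g = conv m D f g"
  by (simp add: conv_def)

text \<open>The star condition in the form required by \<open>conv_tensor_product\<close>.\<close>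

lemma star_condition_comm:
  assumes [simp]: "coalgebra C H" and m: "m \<in> Hom C (car H \<boxtimes> car H) (car H)"
    and s: "\<sigma> \<in> Hom C (car H) (car H)" and star: "star_condition C H m"
  defines "P \<equiv> tensor_coalgebra C H H"
  shows "(m \<otimes> (\<sigma> \<cdot> (\<one> (car H) \<otimes> \<epsilon>\<^bsub>H\<^esub>))) \<cdot> \<c> (car P) (car P) \<cdot> \<delta>\<^bsub>P\<^esub> =
    (m \<otimes> (\<sigma> \<cdot> (\<one> (car H) \<otimes> \<epsilon>\<^bsub>H\<^esub>))) \<cdot> \<delta>\<^bsub>P\<^esub>"
proof -
  note [simp] = HomD[OF m] HomD[OF s]
  have dP [simp]: "\<delta>\<^bsub>P\<^esub> \<in> Arr C" "Dom C \<delta>\<^bsub>P\<^esub> = car H \<boxtimes> car H"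
    "Cod C \<delta>\<^bsub>P\<^esub> = car H \<boxtimes> car H \<boxtimes> car H \<boxtimes> car H" "car P = car H \<boxtimes> car H"
    by (simp_all add: P_def)
  have "m \<otimes> (\<sigma> \<cdot> (\<one> (car H) \<otimes> \<epsilon>\<^bsub>H\<^esub>)) = (\<one> (car H) \<otimes> \<sigma>) \<cdot> (m \<otimes> (\<one> (car H) \<otimes> \<epsilon>\<^bsub>H\<^esub>))"
    using interchange[of m "\<one> (car H)" "\<one> (car H) \<otimes> \<epsilon>\<^bsub>H\<^esub>" \<sigma>] by simp
  then show ?thesis
    using star[unfolded star_condition_iff[OF assms(1) m], folded P_def] by simp
qed

end

section \<open>Hopf trusses\<close>

text \<open>A Hopf truss. The underlying object is called \<open>a\<close>, the second product \<open>m2\<close>, the coalgebra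
  \<open>H \<otimes> H\<close> is \<open>P\<close>, its first projection is \<open>p\<close>, and \<open>G\<close> is the action \<open>\<Gamma>\<close>.\<close>

locale truss = strict_braided_monoidal_category C
  for C :: "('a, 'b, 'c) braided_category_scheme" (structure) +
  fixes H :: "('a, 'b) hopf_data" and H2 :: "('a, 'b) bialgebra_data" and \<sigma> :: 'b
  assumes truss: "hopf_truss C H H2 \<sigma>"
begin

abbreviation G where "G \<equiv> Gamma C H H2 \<sigma>"
abbreviation a where "a \<equiv> car H"
abbreviation P where "P \<equiv> tensor_coalgebra C H H"
abbreviation p where "p \<equiv> \<one> a \<otimes> \<epsilon>\<^bsub>H\<^esub>"
abbreviation m2 where "m2 \<equiv> \<mu>\<^bsub>H2\<^esub>"

lemma hopf: "hopf_algebra C H" using truss by (simp add: hopf_truss_def)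

lemmas h = hopf_algebraD[OF hopf]

lemma structure_typing [simp]:
  "hopf_algebra C H" "coalgebra C H" "algebra a \<mu>\<^bsub>H\<^esub> \<eta>\<^bsub>H\<^esub>"
  "car H2 = a" "\<epsilon>\<^bsub>H2\<^esub> = \<epsilon>\<^bsub>H\<^esub>" "\<delta>\<^bsub>H2\<^esub> = \<delta>\<^bsub>H\<^esub>"
  "\<mu>\<^bsub>H\<^esub> \<in> Arr C" "Dom C \<mu>\<^bsub>H\<^esub> = a \<boxtimes> a" "Cod C \<mu>\<^bsub>H\<^esub> = a"
  "\<eta>\<^bsub>H\<^esub> \<in> Arr C" "Dom C \<eta>\<^bsub>H\<^esub> = \<K>" "Cod C \<eta>\<^bsub>H\<^esub> = a"
  "\<S>\<^bsub>H\<^esub> \<in> Arr C" "Dom C \<S>\<^bsub>H\<^esub> = a" "Cod C \<S>\<^bsub>H\<^esub> = a"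
  "m2 \<in> Arr C" "Dom C m2 = a \<boxtimes> a" "Cod C m2 = a"
  "\<sigma> \<in> Arr C" "Dom C \<sigma> = a" "Cod C \<sigma> = a"
  using truss h HomD[OF h(6)] algebraD[OF h(3)]
  by (auto simp: hopf_truss_def nonunital_bialgebra_def coalgebra_morphism_def Hom_def)

lemma truss_morphisms:
  "coalgebra_morphism C H H \<sigma>" "coalgebra_morphism C P H m2"
  "m2 \<cdot> (m2 \<otimes> \<one> a) = m2 \<cdot> (\<one> a \<otimes> m2)"
  using truss
  by (auto simp: hopf_truss_def nonunital_bialgebra_def coalgebra_morphism_def)

lemma Gamma_Hom [simp]: "G \<in> Arr C" "Dom C G = a \<boxtimes> a" "Cod C G = a"
  by (simp_all add: Gamma_def)

lemma Gamma_comp: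
  assumes [simp]: "coalgebra C E" "w \<in> Arr C" "Dom C w = car E" "Cod C w = a"
  shows "G \<cdot> (\<one> a \<otimes> w) =
    conv \<mu>\<^bsub>H\<^esub> (tensor_coalgebra C H E) (\<S>\<^bsub>H\<^esub> \<cdot> \<sigma> \<cdot> (\<one> a \<otimes> \<epsilon>\<^bsub>E\<^esub>)) (m2 \<cdot> (\<one> a \<otimes> w))"
proof -
  have "G \<cdot> (\<one> a \<otimes> w) = \<mu>\<^bsub>H\<^esub> \<cdot> ((\<S>\<^bsub>H\<^esub> \<cdot> \<sigma>) \<otimes> (m2 \<cdot> (\<one> a \<otimes> w))) \<cdot> (\<delta>\<^bsub>H\<^esub> \<otimes> \<one> (car E))"
  proof -
    have 1: "(\<S>\<^bsub>H\<^esub> \<cdot> \<sigma>) \<otimes> (m2 \<cdot> (\<one> a \<otimes> w)) = ((\<S>\<^bsub>H\<^esub> \<cdot> \<sigma>) \<otimes> m2) \<cdot> (\<one> a \<otimes> \<one> a \<otimes> w)"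
      by (simp add: interchanges)
    have 2: "(\<delta>\<^bsub>H\<^esub> \<otimes> \<one> a) \<cdot> (\<one> a \<otimes> w) = (\<one> a \<otimes> \<one> a \<otimes> w) \<cdot> (\<delta>\<^bsub>H\<^esub> \<otimes> \<one> (car E))"
      by (simp add: interchanges)
    show ?thesis unfolding 1 by (simp add: Gamma_def 2)
  qed
  then show ?thesis
    using conv_proj1[of H E "\<S>\<^bsub>H\<^esub> \<cdot> \<sigma>" "m2 \<cdot> (\<one> a \<otimes> w)" "\<mu>\<^bsub>H\<^esub>"] by simp
qed

lemma Gamma_conv: "G = conv \<mu>\<^bsub>H\<^esub> P (\<S>\<^bsub>H\<^esub> \<cdot> \<sigma> \<cdot> p) m2"
  using Gamma_comp[of H "\<one> a"] by simp

lemma product_conv: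
  assumes "coalgebra C E" "u \<in> Hom C (car E) a" "v \<in> Hom C (car E) a"
  shows "m2 \<cdot> (\<one> a \<otimes> conv \<mu>\<^bsub>H\<^esub> E u v) =
    conv \<mu>\<^bsub>H\<^esub> (tensor_coalgebra C H E) (m2 \<cdot> (\<one> a \<otimes> u)) (G \<cdot> (\<one> a \<otimes> v))"
proof (rule measures_conv[OF _ h(1) assms(1) h(3) _ _ _ assms(2,3)])
  show "measures H H m2 m2 G"
    using truss by (simp add: hopf_truss_def measures_def)
qed (auto intro!: HomI)

lemma Gamma_mult:
  assumes E: "coalgebra C E" and u: "u \<in> Hom C (car E) a" and v: "v \<in> Hom C (car E) a"
  shows "G \<cdot> (\<one> a \<otimes> conv \<mu>\<^bsub>H\<^esub> E u v) =
    conv \<mu>\<^bsub>H\<^esub> (tensor_coalgebra C H E) (G \<cdot> (\<one> a \<otimes> u)) (G \<cdot> (\<one> a \<otimes> v))"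
proof -
  note [simp] = E HomD[OF u] HomD[OF v] HomD[OF conv_Hom[OF h(3) E u v]]
  show ?thesis
    by (simp add: Gamma_comp[of E u] Gamma_comp[of E "conv \<mu>\<^bsub>H\<^esub> E u v"] product_conv[OF E u v])
      (subst conv_assoc[OF h(3)], auto intro!: HomI)
qed

lemma conv_left_inverse:
  "coalgebra C D \<Longrightarrow> coalgebra_morphism C D H f \<Longrightarrow> y \<in> Hom C (car D) a \<Longrightarrow>
    conv \<mu>\<^bsub>H\<^esub> D f (conv \<mu>\<^bsub>H\<^esub> D (\<S>\<^bsub>H\<^esub> \<cdot> f) y) = y"
  using conv_assoc[OF h(3), of D f "\<S>\<^bsub>H\<^esub> \<cdot> f" y] conv_antipode(2)[OF hopf, of D f]
    conv_unit(2)[OF h(3), of D y] coalgebra_morphismD(1)[of D H f] Comp_Hom[OF _ h(6)] by simp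

text \<open>In Sweedler notation, with \<open>u(x) = x \<circ> 1\<close>, the truss axiom for \<open>x \<circ> (1 1)\<close> reads
  \<open>u = u * \<Gamma>(-, 1)\<close>. As \<open>u\<close> is a coalgebra morphism, it can be cancelled, and then
  \<open>\<Gamma>(-, 1) = (S \<cdot> \<sigma>) * u\<close> is the unit, so that \<open>u\<close> is the inverse \<open>\<sigma>\<close> of \<open>S \<cdot> \<sigma>\<close>.\<close>

lemma Gamma_unit_and_product_unit:
  "G \<cdot> (\<one> a \<otimes> \<eta>\<^bsub>H\<^esub>) = \<eta>\<^bsub>H\<^esub> \<cdot> \<epsilon>\<^bsub>H\<^esub>" "m2 \<cdot> (\<one> a \<otimes> \<eta>\<^bsub>H\<^esub>) = \<sigma>"
proof -
  let ?U = "m2 \<cdot> (\<one> a \<otimes> \<eta>\<^bsub>H\<^esub>)" and ?K = "unit_coalgebra C"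
  have "coalgebra_morphism C (tensor_coalgebra C H ?K) P (\<one> a \<otimes> \<eta>\<^bsub>H\<^esub>)"
    by (rule tensor_coalgebra_morphism) (simp_all add: h)
  then have "coalgebra_morphism C (tensor_coalgebra C H ?K) H ?U"
    by (rule coalgebra_morphism_comp[rotated 3]) (simp_all add: truss_morphisms)
  then have U: "coalgebra_morphism C H H ?U"
    by (simp add: coalgebra_morphism_def)
  have "conv \<mu>\<^bsub>H\<^esub> ?K \<eta>\<^bsub>H\<^esub> \<eta>\<^bsub>H\<^esub> = \<eta>\<^bsub>H\<^esub>"
    using conv_unit(1)[OF h(3), of ?K "\<eta>\<^bsub>H\<^esub>"] by (simp add: HomI)
  then have "?U = conv \<mu>\<^bsub>H\<^esub> H ?U (G \<cdot> (\<one> a \<otimes> \<eta>\<^bsub>H\<^esub>))"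
    using product_conv[of ?K "\<eta>\<^bsub>H\<^esub>" "\<eta>\<^bsub>H\<^esub>"] by (simp add: HomI)
  moreover have "?U = conv \<mu>\<^bsub>H\<^esub> H ?U (\<eta>\<^bsub>H\<^esub> \<cdot> \<epsilon>\<^bsub>H\<^esub>)"
    using conv_unit(1)[OF h(3), of H ?U] by (simp add: HomI)
  ultimately have eq: "conv \<mu>\<^bsub>H\<^esub> H ?U (G \<cdot> (\<one> a \<otimes> \<eta>\<^bsub>H\<^esub>)) = conv \<mu>\<^bsub>H\<^esub> H ?U (\<eta>\<^bsub>H\<^esub> \<cdot> \<epsilon>\<^bsub>H\<^esub>)"
    by metis
  show 1: "G \<cdot> (\<one> a \<otimes> \<eta>\<^bsub>H\<^esub>) = \<eta>\<^bsub>H\<^esub> \<cdot> \<epsilon>\<^bsub>H\<^esub>"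
    by (rule conv_cancel[OF h(3) h(1) _ _ _ _ conv_antipode(1)[OF hopf h(1) U] eq])
      (auto intro!: HomI)
  have 2: "conv \<mu>\<^bsub>H\<^esub> H (\<S>\<^bsub>H\<^esub> \<cdot> \<sigma>) ?U = \<eta>\<^bsub>H\<^esub> \<cdot> \<epsilon>\<^bsub>H\<^esub>"
    using Gamma_comp[of ?K "\<eta>\<^bsub>H\<^esub>"] 1 by simp
  have "\<sigma> = ?U"
    by (rule conv_inverse_unique[OF h(3) h(1) _ _ _ conv_antipode(2)[OF hopf h(1) truss_morphisms(1)] 2])
      (auto intro!: HomI)
  then show "?U = \<sigma>" by simp
qed

lemma sigma_proj: "coalgebra_morphism C P H (\<sigma> \<cdot> p)"
  by (rule coalgebra_morphism_comp[of P H H p \<sigma>]) (simp_all add: truss_morphisms)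

lemma product_eq: "conv \<mu>\<^bsub>H\<^esub> P (\<sigma> \<cdot> p) G = m2"
  using conv_left_inverse[OF _ sigma_proj, of m2]
  by (simp add: Gamma_conv[symmetric] HomI)

lemma sigma_product: "\<sigma> \<cdot> m2 = m2 \<cdot> (\<one> a \<otimes> \<sigma>)"
proof -
  have "\<sigma> \<cdot> m2 = m2 \<cdot> (\<one> a \<otimes> \<eta>\<^bsub>H\<^esub>) \<cdot> m2"
    using Gamma_unit_and_product_unit(2)[symmetric] by simp
  also have "(\<one> a \<otimes> \<eta>\<^bsub>H\<^esub>) \<cdot> m2 = (m2 \<otimes> \<one> a) \<cdot> (\<one> a \<otimes> \<one> a \<otimes> \<eta>\<^bsub>H\<^esub>)"
    using interchange[of m2 "\<one> a" "\<one> \<K>" "\<eta>\<^bsub>H\<^esub>"] interchange[of "\<one> a \<otimes> \<one> a" m2 "\<eta>\<^bsub>H\<^esub>" "\<one> a"] by simp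
  also have "m2 \<cdot> \<dots> = m2 \<cdot> (\<one> a \<otimes> (m2 \<cdot> (\<one> a \<otimes> \<eta>\<^bsub>H\<^esub>)))"
    by (simp add: whisker comp_eq_comp[OF truss_morphisms(3)])
  finally show ?thesis by (simp add: Gamma_unit_and_product_unit)
qed

text \<open>Both sides are convolution inverses of \<open>\<sigma> \<cdot> m2 = m2 \<cdot> (1 \<otimes> \<sigma>)\<close>; this replaces an argument
  with the antimultiplicativity of the antipode.\<close>

lemma Gamma_antipode:
  "conv \<mu>\<^bsub>H\<^esub> P (G \<cdot> (\<one> a \<otimes> (\<S>\<^bsub>H\<^esub> \<cdot> \<sigma>))) (\<S>\<^bsub>H\<^esub> \<cdot> \<sigma> \<cdot> p) = \<S>\<^bsub>H\<^esub> \<cdot> \<sigma> \<cdot> m2"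
proof -
  have g: "coalgebra_morphism C P H (\<sigma> \<cdot> m2)"
    by (rule coalgebra_morphism_comp[of P H H]) (simp_all add: truss_morphisms)
  have "conv \<mu>\<^bsub>H\<^esub> P (conv \<mu>\<^bsub>H\<^esub> P (G \<cdot> (\<one> a \<otimes> (\<S>\<^bsub>H\<^esub> \<cdot> \<sigma>))) (\<S>\<^bsub>H\<^esub> \<cdot> \<sigma> \<cdot> p)) (\<sigma> \<cdot> m2) =
    conv \<mu>\<^bsub>H\<^esub> P (G \<cdot> (\<one> a \<otimes> (\<S>\<^bsub>H\<^esub> \<cdot> \<sigma>))) (G \<cdot> (\<one> a \<otimes> \<sigma>))"
    by (subst conv_assoc[OF h(3)]) (auto intro!: HomI simp: Gamma_comp[of H \<sigma>] sigma_product)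
  also have "\<dots> = G \<cdot> (\<one> a \<otimes> conv \<mu>\<^bsub>H\<^esub> H (\<S>\<^bsub>H\<^esub> \<cdot> \<sigma>) \<sigma>)"
    by (rule Gamma_mult[symmetric]) (auto intro!: HomI)
  also have "\<dots> = G \<cdot> (\<one> a \<otimes> \<eta>\<^bsub>H\<^esub>) \<cdot> p"
    by (simp add: conv_antipode[OF hopf _ truss_morphisms(1)] whisker)
  also have "\<dots> = \<eta>\<^bsub>H\<^esub> \<cdot> \<epsilon>\<^bsub>P\<^esub>"
    using interchange[of "\<one> a" "\<epsilon>\<^bsub>H\<^esub>" "\<epsilon>\<^bsub>H\<^esub>" "\<one> \<K>"]
    by (simp add: comp_eq_comp[OF Gamma_unit_and_product_unit(1)])
  finally show ?thesis
    by (intro conv_inverse_unique[OF h(3) _ _ _ _ _ conv_antipode(2)[OF hopf _ g]] conv_Hom[OF h(3)])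
      (auto intro!: HomI)
qed

lemma Gamma_module: "G \<cdot> (\<one> a \<otimes> G) = G \<cdot> (m2 \<otimes> \<one> a)"
proof -
  let ?T = "tensor_coalgebra C H P" and ?c = "conv \<mu>\<^bsub>H\<^esub>"
  let ?x = "\<S>\<^bsub>H\<^esub> \<cdot> \<sigma> \<cdot> (\<one> a \<otimes> \<epsilon>\<^bsub>P\<^esub>)" and ?y = "G \<cdot> (\<one> a \<otimes> (\<S>\<^bsub>H\<^esub> \<cdot> \<sigma> \<cdot> p))"
  have T: "?T = tensor_coalgebra C P H"
    by (simp add: tensor_coalgebra_assoc)
  have q: "coalgebra_morphism C ?T P (\<one> a \<otimes> p)"
    by (rule tensor_coalgebra_morphism) simp_all
  have m: "coalgebra_morphism C ?T P (m2 \<otimes> \<one> a)"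
    unfolding T by (rule tensor_coalgebra_morphism) (simp_all add: truss_morphisms)
  \<comment> \<open>Both factors live on the first two strands, where \<open>Gamma_antipode\<close> applies.\<close>
  have "\<one> a \<otimes> \<epsilon>\<^bsub>P\<^esub> = p \<cdot> (\<one> a \<otimes> p)"
    using interchange[of "\<one> a" "\<epsilon>\<^bsub>H\<^esub>" "\<epsilon>\<^bsub>H\<^esub>" "\<one> \<K>"] by (simp add: whisker[symmetric])
  then have "?c ?T ?y ?x = ?c P (G \<cdot> (\<one> a \<otimes> (\<S>\<^bsub>H\<^esub> \<cdot> \<sigma>))) (\<S>\<^bsub>H\<^esub> \<cdot> \<sigma> \<cdot> p) \<cdot> (\<one> a \<otimes> p)"
    by (subst conv_comp[OF _ _ _ _ q]) (simp_all add: whisker)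
  also have "\<dots> = \<S>\<^bsub>H\<^esub> \<cdot> \<sigma> \<cdot> p \<cdot> (m2 \<otimes> \<one> a)"
    using interchange[of "\<one> a \<otimes> \<one> a" m2 "\<epsilon>\<^bsub>H\<^esub>" "\<one> \<K>"] interchange[of m2 "\<one> a" "\<one> a" "\<epsilon>\<^bsub>H\<^esub>"]
    by (simp add: Gamma_antipode)
  finally have 1: "?c ?T ?y ?x = \<S>\<^bsub>H\<^esub> \<cdot> \<sigma> \<cdot> p \<cdot> (m2 \<otimes> \<one> a)" .
  have "G \<cdot> (\<one> a \<otimes> G) = ?c ?T ?y (G \<cdot> (\<one> a \<otimes> m2))"
    by (subst (2) Gamma_conv, rule Gamma_mult) (auto intro!: HomI)
  also have "\<dots> = ?c ?T ?y (?c ?T ?x (m2 \<cdot> (\<one> a \<otimes> m2)))"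
    by (subst (2) Gamma_comp[of P]) simp_all
  also have "\<dots> = ?c ?T (?c ?T ?y ?x) (m2 \<cdot> (\<one> a \<otimes> m2))"
    by (rule conv_assoc[OF h(3), symmetric]) (auto intro!: HomI)
  also have "\<dots> = ?c P (\<S>\<^bsub>H\<^esub> \<cdot> \<sigma> \<cdot> p) m2 \<cdot> (m2 \<otimes> \<one> a)"
    unfolding 1 by (subst conv_comp[OF _ _ _ _ m]) (simp_all add: truss_morphisms(3))
  finally show ?thesis by (simp add: Gamma_conv[symmetric])
qed

text \<open>Since \<open>m2 = (\<sigma> \<cdot> p) * G\<close> is a coalgebra morphism, \<open>\<delta> \<cdot> G\<close> and \<open>(G \<otimes> G) \<cdot> \<delta>\<close> have the same
  convolution product with \<open>\<delta> \<cdot> \<sigma> \<cdot> p\<close> in the tensor square, and that factor is invertible.\<close>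

lemma Gamma_coalgebra_morphism:
  assumes star: "star_condition C H G"
  shows "coalgebra_morphism C P H G"
proof -
  let ?M = "tensor_product a \<mu>\<^bsub>H\<^esub>" and ?f = "\<sigma> \<cdot> p"
  note A = algebra_tensor[OF h(3)]
  have M: "\<delta>\<^bsub>H\<^esub> \<cdot> \<mu>\<^bsub>H\<^esub> = ?M \<cdot> (\<delta>\<^bsub>H\<^esub> \<otimes> \<delta>\<^bsub>H\<^esub>)"
    using coalgebra_morphismD(6)[OF h(4)] by (simp add: tensor_product_def)
  have d: "\<delta>\<^bsub>H\<^esub> \<cdot> conv \<mu>\<^bsub>H\<^esub> P x y = conv ?M P (\<delta>\<^bsub>H\<^esub> \<cdot> x) (\<delta>\<^bsub>H\<^esub> \<cdot> y)"
    if "x \<in> Hom C (car P) a" "y \<in> Hom C (car P) a" for x y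
    by (rule algebra_comp_conv[OF M _ _ _ _ that]) (auto intro!: HomI simp: tensor_product_def)
  have "conv ?M P (\<delta>\<^bsub>H\<^esub> \<cdot> ?f) (\<delta>\<^bsub>H\<^esub> \<cdot> G) = \<delta>\<^bsub>H\<^esub> \<cdot> m2"
    by (subst d[symmetric]) (auto intro!: HomI simp: product_eq)
  also have "\<dots> = conv ?M P (\<delta>\<^bsub>H\<^esub> \<cdot> ?f) ((G \<otimes> G) \<cdot> \<delta>\<^bsub>P\<^esub>)"
    using conv_tensor_product[OF hopf _ sigma_proj _ star_condition_comm[OF h(1) _ _ star]]
      coalgebra_morphismD(6)[OF truss_morphisms(2)]
    by (simp add: product_eq HomI)
  finally have eq: "conv ?M P (\<delta>\<^bsub>H\<^esub> \<cdot> ?f) (\<delta>\<^bsub>H\<^esub> \<cdot> G) = conv ?M P (\<delta>\<^bsub>H\<^esub> \<cdot> ?f) ((G \<otimes> G) \<cdot> \<delta>\<^bsub>P\<^esub>)" .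
  \<comment> \<open>The inverse is \<open>\<delta> \<cdot> S \<cdot> \<sigma> \<cdot> p\<close>, because \<open>\<delta>\<close> is multiplicative.\<close>
  have inv: "conv ?M P (\<delta>\<^bsub>H\<^esub> \<cdot> \<S>\<^bsub>H\<^esub> \<cdot> ?f) (\<delta>\<^bsub>H\<^esub> \<cdot> ?f) = (\<eta>\<^bsub>H\<^esub> \<otimes> \<eta>\<^bsub>H\<^esub>) \<cdot> \<epsilon>\<^bsub>P\<^esub>"
    using conv_antipode(1)[OF hopf _ sigma_proj] coalgebra_morphismD(6)[OF h(5)]
    by (subst d[symmetric]) (auto intro!: HomI simp: comp_eq_comp[OF coalgebra_morphismD(6)[OF h(5)]])
  have "\<delta>\<^bsub>H\<^esub> \<cdot> G = (G \<otimes> G) \<cdot> \<delta>\<^bsub>P\<^esub>"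
    by (rule conv_cancel[OF A _ _ _ _ _ inv eq]) (auto intro!: HomI)
  moreover have "\<epsilon>\<^bsub>H\<^esub> \<cdot> G = \<epsilon>\<^bsub>P\<^esub>"
    using counit_conv[OF hopf, of P ?f G] coalgebra_morphismD(5)[OF sigma_proj]
      coalgebra_morphismD(5)[OF truss_morphisms(2)]
    by (simp add: product_eq HomI)
  ultimately show ?thesis
    by (auto simp: coalgebra_morphism_def intro!: HomI)
qed

text \<open>The object part of \<open>\<Lambda>\<close>.\<close>

lemma Lambda_operator:
  assumes star: "star_condition C H G"
  shows "weak_twisted_rb_operator C H H2 (\<one> a) G \<sigma>" "star_condition C H (rb_action C H (\<one> a) G)"
proof -
  have act: "rb_action C H (\<one> a) G = G"
    by (simp add: rb_action_def)
  then show "star_condition C H (rb_action C H (\<one> a) G)" using star by simp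
  have prod: "rb_product C H (\<one> a) G \<sigma> = m2"
    using conv_proj1[of H H \<sigma> G "\<mu>\<^bsub>H\<^esub>"] product_eq by (simp add: rb_product_def act)
  have "measures H H G G G"
    by (rule measuresI[OF h(1) h(3) h(1)]) (auto simp: Gamma_mult intro!: HomI)
  moreover have "\<eta>\<^bsub>H\<^esub> \<cdot> \<epsilon>\<^bsub>H\<^esub> = \<epsilon>\<^bsub>H\<^esub> \<otimes> \<eta>\<^bsub>H\<^esub>"
    using interchange[of "\<epsilon>\<^bsub>H\<^esub>" "\<one> \<K>" "\<one> \<K>" "\<eta>\<^bsub>H\<^esub>"] by simp
  ultimately have mod: "module_algebra_coalgebra C H2 H G"
    using Gamma_coalgebra_morphism[OF star] Gamma_module Gamma_unit_and_product_unit
    by (auto simp: module_algebra_coalgebra_def measures_def coalgebra_morphism_def intro!: HomI)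
  have "(\<sigma> \<otimes> G) \<cdot> (\<delta>\<^bsub>H\<^esub> \<otimes> \<sigma>) = (\<sigma> \<otimes> G) \<cdot> (\<delta>\<^bsub>H\<^esub> \<otimes> \<one> a) \<cdot> (\<one> a \<otimes> \<sigma>)"
    using interchange[of "\<one> a" "\<delta>\<^bsub>H\<^esub>" \<sigma> "\<one> a"] by simp
  then have "\<mu>\<^bsub>H\<^esub> \<cdot> (\<sigma> \<otimes> G) \<cdot> (\<delta>\<^bsub>H\<^esub> \<otimes> \<sigma>) = rb_product C H (\<one> a) G \<sigma> \<cdot> (\<one> a \<otimes> \<sigma>)"
    by (simp add: rb_product_def act)
  then show "weak_twisted_rb_operator C H H2 (\<one> a) G \<sigma>"
    using truss mod truss_morphisms(1) coalgebra_morphism_ident[OF h(1)]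
    by (auto simp: weak_twisted_rb_operator_def hopf_truss_def act prod sigma_product coalgebra_morphism_def)
qed

end

context strict_braided_monoidal_category
begin

text \<open>Morphisms of Hopf trusses commute with \<open>\<sigma>\<close>, which is recovered from the second product and
  the unit, and hence with \<open>\<Gamma>\<close>.\<close>

lemma truss_morphism_twist_Gamma:
  assumes H: "hopf_truss C H H2 \<sigma>" and B: "hopf_truss C B B2 \<tau>"
    and f1: "hopf_algebra_morphism C H B f" and f2: "nonunital_bialgebra_morphism C H2 B2 f"
  shows "f \<cdot> \<sigma> = \<tau> \<cdot> f" "f \<cdot> Gamma C H H2 \<sigma> = Gamma C B B2 \<tau> \<cdot> (f \<otimes> f)"
proof -
  interpret H: truss C H H2 \<sigma> by unfold_locales (rule H)
  interpret B: truss C B B2 \<tau> by unfold_locales (rule B)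
  have cf: "coalgebra_morphism C H B f" and f: "f \<cdot> \<mu>\<^bsub>H\<^esub> = \<mu>\<^bsub>B\<^esub> \<cdot> (f \<otimes> f)" "f \<cdot> \<eta>\<^bsub>H\<^esub> = \<eta>\<^bsub>B\<^esub>"
    "f \<cdot> \<mu>\<^bsub>H2\<^esub> = \<mu>\<^bsub>B2\<^esub> \<cdot> (f \<otimes> f)"
    using f1 f2 by (auto simp: hopf_algebra_morphism_def nonunital_bialgebra_morphism_def)
  note [simp] = coalgebra_morphismD(2-4)[OF cf]
  have "f \<cdot> \<sigma> = f \<cdot> \<mu>\<^bsub>H2\<^esub> \<cdot> (\<one> (car H) \<otimes> \<eta>\<^bsub>H\<^esub>)"
    by (simp add: H.Gamma_unit_and_product_unit)
  also have "\<dots> = \<mu>\<^bsub>B2\<^esub> \<cdot> (f \<otimes> \<eta>\<^bsub>B\<^esub>)"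
    by (simp add: comp_eq_comp[OF f(3)] interchange f(2))
  also have "f \<otimes> \<eta>\<^bsub>B\<^esub> = (\<one> (car B) \<otimes> \<eta>\<^bsub>B\<^esub>) \<cdot> f"
    using interchange[of f "\<one> (car B)" "\<one> \<K>" "\<eta>\<^bsub>B\<^esub>"] by simp
  finally show s: "f \<cdot> \<sigma> = \<tau> \<cdot> f"
    by (simp add: comp_eq_comp[OF B.Gamma_unit_and_product_unit(2)])
  have 1: "f \<cdot> \<S>\<^bsub>H\<^esub> \<cdot> \<sigma> = \<S>\<^bsub>B\<^esub> \<cdot> \<tau> \<cdot> f"
    using comp_eq_comp[OF hopf_algebra_morphism_antipode[OF H.hopf B.hopf f1], of \<sigma>] s by simp
  show "f \<cdot> Gamma C H H2 \<sigma> = Gamma C B B2 \<tau> \<cdot> (f \<otimes> f)"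
  proof -
    have 2: "(f \<cdot> \<S>\<^bsub>H\<^esub> \<cdot> \<sigma>) \<otimes> (f \<cdot> \<mu>\<^bsub>H2\<^esub>) = ((\<S>\<^bsub>B\<^esub> \<cdot> \<tau>) \<otimes> \<mu>\<^bsub>B2\<^esub>) \<cdot> (f \<otimes> f \<otimes> f)"
      by (simp add: 1 f(3) interchanges)
    have 3: "(f \<otimes> f \<otimes> f) \<cdot> (\<delta>\<^bsub>H\<^esub> \<otimes> \<one> (car H)) = (\<delta>\<^bsub>B\<^esub> \<otimes> \<one> (car B)) \<cdot> (f \<otimes> f)"
      by (simp add: interchanges coalgebra_morphismD(6)[OF cf])
    have "f \<cdot> Gamma C H H2 \<sigma> =
        \<mu>\<^bsub>B\<^esub> \<cdot> ((f \<cdot> \<S>\<^bsub>H\<^esub> \<cdot> \<sigma>) \<otimes> (f \<cdot> \<mu>\<^bsub>H2\<^esub>)) \<cdot> (\<delta>\<^bsub>H\<^esub> \<otimes> \<one> (car H))"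
      by (simp add: Gamma_def comp_eq_comp[OF f(1)] interchange_comp)
    then show ?thesis
      unfolding 2 by (simp add: Gamma_def 3)
  qed
qed

end

section \<open>Weak twisted relative Rota--Baxter operators\<close>

text \<open>An operator that satisfies the star condition. Here \<open>act\<close> is the induced action of \<open>H\<close> on
  itself and \<open>mt\<close> the induced second product; \<open>a\<close>, \<open>P\<close> and \<open>p\<close> are as for trusses.\<close>

locale rb_operator = strict_braided_monoidal_category C
  for C :: "('a, 'b, 'c) braided_category_scheme" (structure) +
  fixes H :: "('a, 'b) hopf_data" and B :: "('a, 'b) bialgebra_data" and T \<phi> \<Psi> :: 'b
  assumes operator: "weak_twisted_rb_operator C H B T \<phi> \<Psi>"
    and star: "star_condition C H (rb_action C H T \<phi>)"
begin

abbreviation a where "a \<equiv> car H"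
abbreviation P where "P \<equiv> tensor_coalgebra C H H"
abbreviation p where "p \<equiv> \<one> a \<otimes> \<epsilon>\<^bsub>H\<^esub>"
abbreviation act where "act \<equiv> rb_action C H T \<phi>"
abbreviation mt where "mt \<equiv> rb_product C H T \<phi> \<Psi>"

lemma hopf: "hopf_algebra C H" using operator by (simp add: weak_twisted_rb_operator_def)

lemmas h = hopf_algebraD[OF hopf]

lemma rb_morphisms:
  "coalgebra_morphism C H B T" "coalgebra_morphism C H H \<Psi>"
  "coalgebra_morphism C (tensor_coalgebra C B H) H \<phi>"
  and rb_product_T: "T \<cdot> mt = \<mu>\<^bsub>B\<^esub> \<cdot> (T \<otimes> T)"
  and phi_module: "\<phi> \<cdot> (\<one> (car B) \<otimes> \<phi>) = \<phi> \<cdot> (\<mu>\<^bsub>B\<^esub> \<otimes> \<one> a)"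
  and phi_measures: "measures B H \<phi> \<phi> \<phi>"
  using operator
  by (auto simp: weak_twisted_rb_operator_def module_algebra_coalgebra_def measures_def)

lemma structure_typing [simp]:
  "hopf_algebra C H" "coalgebra C H" "algebra a \<mu>\<^bsub>H\<^esub> \<eta>\<^bsub>H\<^esub>" "coalgebra C B"
  "\<mu>\<^bsub>H\<^esub> \<in> Arr C" "Dom C \<mu>\<^bsub>H\<^esub> = a \<boxtimes> a" "Cod C \<mu>\<^bsub>H\<^esub> = a"
  "\<eta>\<^bsub>H\<^esub> \<in> Arr C" "Dom C \<eta>\<^bsub>H\<^esub> = \<K>" "Cod C \<eta>\<^bsub>H\<^esub> = a"
  "\<S>\<^bsub>H\<^esub> \<in> Arr C" "Dom C \<S>\<^bsub>H\<^esub> = a" "Cod C \<S>\<^bsub>H\<^esub> = a"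
  "\<mu>\<^bsub>B\<^esub> \<in> Arr C" "Dom C \<mu>\<^bsub>B\<^esub> = car B \<boxtimes> car B" "Cod C \<mu>\<^bsub>B\<^esub> = car B"
  "T \<in> Arr C" "Dom C T = a" "Cod C T = car B"
  "\<Psi> \<in> Arr C" "Dom C \<Psi> = a" "Cod C \<Psi> = a"
  "\<phi> \<in> Arr C" "Dom C \<phi> = car B \<boxtimes> a" "Cod C \<phi> = a"
  using operator h HomD[OF h(6)] algebraD[OF h(3)]
  by (auto simp: weak_twisted_rb_operator_def nonunital_bialgebra_def coalgebra_morphism_def
      module_algebra_coalgebra_def Hom_def)

lemma act_Hom [simp]: "act \<in> Arr C" "Dom C act = a \<boxtimes> a" "Cod C act = a"
  by (simp_all add: rb_action_def)

lemma mt_Hom [simp]: "mt \<in> Arr C" "Dom C mt = a \<boxtimes> a" "Cod C mt = a"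
  by (simp_all add: rb_product_def)

lemma act_coalgebra_morphism: "coalgebra_morphism C P H act"
  unfolding rb_action_def
  by (rule coalgebra_morphism_comp[of P "tensor_coalgebra C B H" H])
    (auto intro: tensor_coalgebra_morphism rb_morphisms)

lemma act_mult:
  assumes E: "coalgebra C E" and u: "u \<in> Hom C (car E) a" and v: "v \<in> Hom C (car E) a"
  shows "act \<cdot> (\<one> a \<otimes> conv \<mu>\<^bsub>H\<^esub> E u v) =
    conv \<mu>\<^bsub>H\<^esub> (tensor_coalgebra C H E) (act \<cdot> (\<one> a \<otimes> u)) (act \<cdot> (\<one> a \<otimes> v))"
proof -
  note [simp] = E HomD[OF u] HomD[OF v] HomD[OF conv_Hom[OF h(3) E u v]]
  have act: "act \<cdot> (\<one> a \<otimes> w) = (\<phi> \<cdot> (\<one> (car B) \<otimes> w)) \<cdot> (T \<otimes> \<one> (car E))"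
    if [simp]: "w \<in> Arr C" "Dom C w = car E" "Cod C w = a" for w
    by (simp add: rb_action_def interchanges)
  have t: "coalgebra_morphism C (tensor_coalgebra C H E) (tensor_coalgebra C B E) (T \<otimes> \<one> (car E))"
    by (rule tensor_coalgebra_morphism) (simp_all add: rb_morphisms)
  have "act \<cdot> (\<one> a \<otimes> conv \<mu>\<^bsub>H\<^esub> E u v) = conv \<mu>\<^bsub>H\<^esub> (tensor_coalgebra C B E)
      (\<phi> \<cdot> (\<one> (car B) \<otimes> u)) (\<phi> \<cdot> (\<one> (car B) \<otimes> v)) \<cdot> (T \<otimes> \<one> (car E))"
    by (subst measures_conv[OF phi_measures _ E h(3) _ _ _ u v, symmetric])
      (auto intro!: HomI simp: act simp del: comp_assoc)
  also have "\<dots> = conv \<mu>\<^bsub>H\<^esub> (tensor_coalgebra C H E) (act \<cdot> (\<one> a \<otimes> u)) (act \<cdot> (\<one> a \<otimes> v))"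
    by (subst conv_comp[OF _ _ _ _ t]) (simp_all add: act)
  finally show ?thesis .
qed

lemma mt_comp:
  assumes [simp]: "coalgebra C E" "w \<in> Arr C" "Dom C w = car E" "Cod C w = a"
  shows "mt \<cdot> (\<one> a \<otimes> w) =
    conv \<mu>\<^bsub>H\<^esub> (tensor_coalgebra C H E) (\<Psi> \<cdot> (\<one> a \<otimes> \<epsilon>\<^bsub>E\<^esub>)) (act \<cdot> (\<one> a \<otimes> w))"
proof -
  have 1: "\<Psi> \<otimes> (act \<cdot> (\<one> a \<otimes> w)) = (\<Psi> \<otimes> act) \<cdot> (\<one> a \<otimes> \<one> a \<otimes> w)"
    by (simp add: interchanges)
  have 2: "(\<delta>\<^bsub>H\<^esub> \<otimes> \<one> a) \<cdot> (\<one> a \<otimes> w) = (\<one> a \<otimes> \<one> a \<otimes> w) \<cdot> (\<delta>\<^bsub>H\<^esub> \<otimes> \<one> (car E))"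
    by (simp add: interchanges)
  have "mt \<cdot> (\<one> a \<otimes> w) = \<mu>\<^bsub>H\<^esub> \<cdot> (\<Psi> \<otimes> (act \<cdot> (\<one> a \<otimes> w))) \<cdot> (\<delta>\<^bsub>H\<^esub> \<otimes> \<one> (car E))"
    unfolding 1 by (simp add: rb_product_def 2)
  then show ?thesis
    using conv_proj1[of H E \<Psi> "act \<cdot> (\<one> a \<otimes> w)" "\<mu>\<^bsub>H\<^esub>"] by simp
qed

lemma mt_conv: "mt = conv \<mu>\<^bsub>H\<^esub> P (\<Psi> \<cdot> p) act"
  using mt_comp[of H "\<one> a"] by simp

lemma Psi_proj: "coalgebra_morphism C P H (\<Psi> \<cdot> p)"
  by (rule coalgebra_morphism_comp[of P H H p \<Psi>]) (simp_all add: rb_morphisms)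

lemma mt_coalgebra_morphism: "coalgebra_morphism C P H mt"
proof -
  let ?M = "tensor_product a \<mu>\<^bsub>H\<^esub>"
  have M: "\<delta>\<^bsub>H\<^esub> \<cdot> \<mu>\<^bsub>H\<^esub> = ?M \<cdot> (\<delta>\<^bsub>H\<^esub> \<otimes> \<delta>\<^bsub>H\<^esub>)"
    using coalgebra_morphismD(6)[OF h(4)] by (simp add: tensor_product_def)
  have "\<delta>\<^bsub>H\<^esub> \<cdot> mt = conv ?M P (\<delta>\<^bsub>H\<^esub> \<cdot> \<Psi> \<cdot> p) (\<delta>\<^bsub>H\<^esub> \<cdot> act)"
    unfolding mt_conv
    by (rule algebra_comp_conv[OF M]) (auto intro!: HomI simp: tensor_product_def)
  also have "\<dots> = (mt \<otimes> mt) \<cdot> \<delta>\<^bsub>P\<^esub>"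
    using conv_tensor_product[OF hopf _ Psi_proj _ star_condition_comm[OF h(1) _ _ star]]
      coalgebra_morphismD(6)[OF act_coalgebra_morphism]
    by (simp add: mt_conv[symmetric] HomI)
  finally have "\<delta>\<^bsub>H\<^esub> \<cdot> mt = (mt \<otimes> mt) \<cdot> \<delta>\<^bsub>P\<^esub>" .
  moreover have "\<epsilon>\<^bsub>H\<^esub> \<cdot> mt = \<epsilon>\<^bsub>P\<^esub>"
    using counit_conv[OF hopf, of P "\<Psi> \<cdot> p" act] coalgebra_morphismD(5)[OF Psi_proj]
      coalgebra_morphismD(5)[OF act_coalgebra_morphism]
    by (simp add: mt_conv[symmetric] HomI)
  ultimately show ?thesis
    by (auto simp: coalgebra_morphism_def intro!: HomI)
qed

lemma mt_measures:
  assumes E: "coalgebra C E" and u: "u \<in> Hom C (car E) a" and v: "v \<in> Hom C (car E) a"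
  shows "mt \<cdot> (\<one> a \<otimes> conv \<mu>\<^bsub>H\<^esub> E u v) =
    conv \<mu>\<^bsub>H\<^esub> (tensor_coalgebra C H E) (mt \<cdot> (\<one> a \<otimes> u)) (act \<cdot> (\<one> a \<otimes> v))"
proof -
  note [simp] = E HomD[OF u] HomD[OF v] HomD[OF conv_Hom[OF h(3) E u v]]
  show ?thesis
    by (simp add: mt_comp[of E u] mt_comp[of E "conv \<mu>\<^bsub>H\<^esub> E u v"] act_mult[OF E u v])
      (subst conv_assoc[OF h(3)], auto intro!: HomI)
qed

lemma Psi_mt: "\<Psi> \<cdot> mt = mt \<cdot> (\<one> a \<otimes> \<Psi>)"
proof -
  have "(\<Psi> \<otimes> act) \<cdot> (\<delta>\<^bsub>H\<^esub> \<otimes> \<Psi>) = (\<Psi> \<otimes> act) \<cdot> (\<delta>\<^bsub>H\<^esub> \<otimes> \<one> a) \<cdot> (\<one> a \<otimes> \<Psi>)"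
    using interchange[of "\<one> a" "\<delta>\<^bsub>H\<^esub>" \<Psi> "\<one> a"] by simp
  then have "\<mu>\<^bsub>H\<^esub> \<cdot> (\<Psi> \<otimes> act) \<cdot> (\<delta>\<^bsub>H\<^esub> \<otimes> \<Psi>) = mt \<cdot> (\<one> a \<otimes> \<Psi>)"
    by (simp add: rb_product_def)
  then show ?thesis using operator by (simp add: weak_twisted_rb_operator_def)
qed

lemma act_mt: "act \<cdot> (mt \<otimes> \<one> a) = act \<cdot> (\<one> a \<otimes> act)"
proof -
  have "act \<cdot> (mt \<otimes> \<one> a) = \<phi> \<cdot> ((T \<cdot> mt) \<otimes> \<one> a)"
    by (simp add: rb_action_def interchanges)
  also have "\<dots> = \<phi> \<cdot> (\<mu>\<^bsub>B\<^esub> \<otimes> \<one> a) \<cdot> (T \<otimes> T \<otimes> \<one> a)"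
    by (simp add: rb_product_T interchanges)
  also have "\<dots> = \<phi> \<cdot> (\<one> (car B) \<otimes> \<phi>) \<cdot> (T \<otimes> T \<otimes> \<one> a)"
    using comp_eq_comp[OF phi_module, of "T \<otimes> T \<otimes> \<one> a"] by simp
  also have "\<dots> = act \<cdot> (\<one> a \<otimes> act)"
    by (simp add: rb_action_def interchanges)
  finally show ?thesis .
qed

lemma mt_assoc: "mt \<cdot> (mt \<otimes> \<one> a) = mt \<cdot> (\<one> a \<otimes> mt)"
proof -
  let ?T = "tensor_coalgebra C H P" and ?c = "conv \<mu>\<^bsub>H\<^esub>"
  let ?x = "\<Psi> \<cdot> (\<one> a \<otimes> \<epsilon>\<^bsub>P\<^esub>)" and ?y = "act \<cdot> (\<one> a \<otimes> (\<Psi> \<cdot> p))" and ?z = "act \<cdot> (\<one> a \<otimes> act)"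
  have T: "?T = tensor_coalgebra C P H"
    by (simp add: tensor_coalgebra_assoc)
  have m: "coalgebra_morphism C ?T P (mt \<otimes> \<one> a)"
    unfolding T by (rule tensor_coalgebra_morphism) (simp_all add: mt_coalgebra_morphism)
  have "p \<cdot> (mt \<otimes> \<one> a) = mt \<cdot> (\<one> a \<otimes> p)"
    using interchange[of "\<one> a \<otimes> \<one> a" mt "\<epsilon>\<^bsub>H\<^esub>" "\<one> \<K>"] interchange[of mt "\<one> a" "\<one> a" "\<epsilon>\<^bsub>H\<^esub>"] by simp
  then have 1: "\<Psi> \<cdot> p \<cdot> (mt \<otimes> \<one> a) = mt \<cdot> (\<one> a \<otimes> (\<Psi> \<cdot> p))"
    by (simp add: comp_eq_comp[OF Psi_mt] whisker)
  have "mt \<cdot> (mt \<otimes> \<one> a) = ?c ?T (\<Psi> \<cdot> p \<cdot> (mt \<otimes> \<one> a)) (act \<cdot> (mt \<otimes> \<one> a))"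
    by (subst (1) mt_conv, subst conv_comp[OF _ _ _ _ m]) simp_all
  also have "\<dots> = ?c ?T (?c ?T ?x ?y) ?z"
    unfolding 1 act_mt using mt_comp[of P "\<Psi> \<cdot> p"] by simp
  also have "\<dots> = ?c ?T ?x (?c ?T ?y ?z)"
    by (rule conv_assoc[OF h(3)]) (auto intro!: HomI)
  also have "?c ?T ?y ?z = act \<cdot> (\<one> a \<otimes> mt)"
    by (subst mt_conv, rule act_mult[symmetric]) (auto intro!: HomI)
  also have "?c ?T ?x \<dots> = mt \<cdot> (\<one> a \<otimes> mt)"
    using mt_comp[of P mt] by simp
  finally show ?thesis .
qed

text \<open>The non-unital bialgebra with the second product \<open>mt\<close>.\<close>

abbreviation Ht where
  "Ht \<equiv> \<lparr>car = car H, counit = \<epsilon>\<^bsub>H\<^esub>, coproduct = \<delta>\<^bsub>H\<^esub>, product = mt\<rparr>"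

lemma Gamma_eq_act: "Gamma C H Ht \<Psi> = act"
proof -
  have "Gamma C H Ht \<Psi> = conv \<mu>\<^bsub>H\<^esub> P (\<S>\<^bsub>H\<^esub> \<cdot> \<Psi> \<cdot> p) (conv \<mu>\<^bsub>H\<^esub> P (\<Psi> \<cdot> p) act)"
    using conv_proj1[of H H "\<S>\<^bsub>H\<^esub> \<cdot> \<Psi>" mt "\<mu>\<^bsub>H\<^esub>"] by (simp add: Gamma_def mt_conv[symmetric])
  also have "\<dots> = conv \<mu>\<^bsub>H\<^esub> P (conv \<mu>\<^bsub>H\<^esub> P (\<S>\<^bsub>H\<^esub> \<cdot> \<Psi> \<cdot> p) (\<Psi> \<cdot> p)) act"
    by (rule conv_assoc[OF h(3), symmetric]) (auto intro!: HomI)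
  also have "\<dots> = act"
    unfolding conv_antipode(1)[OF hopf coalgebra_tensor[OF h(1) h(1)] Psi_proj]
    by (rule conv_unit(2)[OF h(3)]) (auto intro!: HomI)
  finally show ?thesis .
qed

text \<open>The object part of \<open>\<Omega>\<close>.\<close>

lemma Omega_truss: "hopf_truss C H Ht \<Psi>"
proof -
  have "coalgebra C Ht"
    using h(1) unfolding coalgebra_def by simp
  moreover have "coalgebra_morphism C (tensor_coalgebra C Ht Ht) Ht mt"
    using mt_coalgebra_morphism by (simp add: coalgebra_morphism_def tensor_coalgebra_def)
  ultimately have 1: "nonunital_bialgebra C Ht"
    by (auto simp: nonunital_bialgebra_def mt_assoc intro!: HomI)
  have "measures H H mt mt act"
    by (rule measuresI[OF h(1) h(3) h(1)]) (auto simp: mt_measures intro!: HomI)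
  then show ?thesis
    using 1 rb_morphisms(2) by (simp add: hopf_truss_def Gamma_eq_act measures_def)
qed

end

section \<open>The categories\<close>

lemma full_subcategory_sel [simp]:
  "Obj (full_subcategory C S) = Obj C \<inter> S"
  "Arr (full_subcategory C S) = {f \<in> Arr C. Dom C f \<in> S \<and> Cod C f \<in> S}"
  "Dom (full_subcategory C S) = Dom C" "Cod (full_subcategory C S) = Cod C"
  "Ident (full_subcategory C S) = Ident C" "Comp (full_subcategory C S) = Comp C"
  by (simp_all add: full_subcategory_def)

lemma Hom_full_subcategory:
  "f \<in> Hom (full_subcategory C S) X Y \<longleftrightarrow> f \<in> Hom C X Y \<and> X \<in> S \<and> Y \<in> S"
  by (auto simp: Hom_def)

lemma category_full_subcategory:
  assumes "category C"
  shows "category (full_subcategory C S)"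
proof -
  interpret category C by fact
  show ?thesis
    by unfold_locales
      (auto simp: Hom_full_subcategory Dom_Obj Cod_Obj Ident_Hom Comp_Ident Ident_Comp
        intro: Comp_Hom Comp_assoc)
qed

context strict_braided_monoidal_category
begin

lemma hopf_algebra_morphism_ident:
  "hopf_algebra C H \<Longrightarrow> hopf_algebra_morphism C H H (\<one> (car H))"
  using hopf_algebraD[of H] algebraD[of "car H" "\<mu>\<^bsub>H\<^esub>" "\<eta>\<^bsub>H\<^esub>"]
  by (auto simp: hopf_algebra_morphism_def)

lemma nonunital_bialgebra_morphism_ident:
  "nonunital_bialgebra C H \<Longrightarrow> nonunital_bialgebra_morphism C H H (\<one> (car H))"
  by (auto simp: nonunital_bialgebra_morphism_def nonunital_bialgebra_def Hom_def)

lemma nonunital_bialgebra_morphism_comp: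
  assumes H: "nonunital_bialgebra C H" and B: "nonunital_bialgebra C B" and D: "nonunital_bialgebra C D"
    and f: "nonunital_bialgebra_morphism C H B f" and g: "nonunital_bialgebra_morphism C B D g"
  shows "nonunital_bialgebra_morphism C H D (g \<cdot> f)"
proof -
  have co: "coalgebra C H" "coalgebra C B" "coalgebra C D"
    "coalgebra_morphism C H B f" "coalgebra_morphism C B D g"
    using assms by (auto simp: nonunital_bialgebra_def nonunital_bialgebra_morphism_def)
  have [simp]: "\<mu>\<^bsub>H\<^esub> \<in> Arr C" "Dom C \<mu>\<^bsub>H\<^esub> = car H \<boxtimes> car H" "Cod C \<mu>\<^bsub>H\<^esub> = car H"
    "\<mu>\<^bsub>B\<^esub> \<in> Arr C" "Dom C \<mu>\<^bsub>B\<^esub> = car B \<boxtimes> car B" "Cod C \<mu>\<^bsub>B\<^esub> = car B"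
    "\<mu>\<^bsub>D\<^esub> \<in> Arr C" "Dom C \<mu>\<^bsub>D\<^esub> = car D \<boxtimes> car D" "Cod C \<mu>\<^bsub>D\<^esub> = car D"
    using H B D by (auto simp: nonunital_bialgebra_def Hom_def)
  have fg: "f \<cdot> \<mu>\<^bsub>H\<^esub> = \<mu>\<^bsub>B\<^esub> \<cdot> (f \<otimes> f)" "g \<cdot> \<mu>\<^bsub>B\<^esub> = \<mu>\<^bsub>D\<^esub> \<cdot> (g \<otimes> g)"
    using f g by (auto simp: nonunital_bialgebra_morphism_def)
  note [simp] = co(1-3) coalgebra_morphismD(2-4)[OF co(4)] coalgebra_morphismD(2-4)[OF co(5)]
  have "(g \<cdot> f) \<cdot> \<mu>\<^bsub>H\<^esub> = \<mu>\<^bsub>D\<^esub> \<cdot> ((g \<cdot> f) \<otimes> (g \<cdot> f))"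
    by (simp add: fg(1) comp_eq_comp[OF fg(2)] interchange)
  then show ?thesis
    using coalgebra_morphism_comp[OF co] by (simp add: nonunital_bialgebra_morphism_def)
qed

lemma hopf_algebra_morphism_iff:
  "hopf_algebra_morphism C H B f \<longleftrightarrow> nonunital_bialgebra_morphism C H B f \<and> f \<cdot> \<eta>\<^bsub>H\<^esub> = \<eta>\<^bsub>B\<^esub>"
  by (auto simp: hopf_algebra_morphism_def nonunital_bialgebra_morphism_def)

lemma hopf_algebra_morphism_comp:
  assumes H: "hopf_algebra C H" and B: "hopf_algebra C B" and D: "hopf_algebra C D"
    and f: "hopf_algebra_morphism C H B f" and g: "hopf_algebra_morphism C B D g"
  shows "hopf_algebra_morphism C H D (g \<cdot> f)"
proof -
  have "f \<in> Hom C (car H) (car B)" "g \<in> Hom C (car B) (car D)" "\<eta>\<^bsub>H\<^esub> \<in> Hom C \<K> (car H)"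
    using f g H by (auto simp: hopf_algebra_morphism_def coalgebra_morphism_def hopf_algebra_def)
  then have "(g \<cdot> f) \<cdot> \<eta>\<^bsub>H\<^esub> = \<eta>\<^bsub>D\<^esub>"
    using f g Comp_assoc by (simp add: hopf_algebra_morphism_def)
  then show ?thesis
    using nonunital_bialgebra_morphism_comp[OF hopf_algebraD(2)[OF H] hopf_algebraD(2)[OF B] hopf_algebraD(2)[OF D], of f g] f g
    by (simp add: hopf_algebra_morphism_iff)
qed

lemma hopf_trussD:
  assumes "hopf_truss C H H2 \<sigma>"
  shows "hopf_algebra C H" "nonunital_bialgebra C H2" "car H2 = car H"
  using assms by (auto simp: hopf_truss_def)

lemma weak_twisted_rb_operatorD:
  assumes "weak_twisted_rb_operator C H B T \<phi> \<Psi>"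
  shows "hopf_algebra C H" "nonunital_bialgebra C B" "car H \<in> Obj C" "car B \<in> Obj C"
    "T \<in> Hom C (car H) (car B)" "\<Psi> \<in> Hom C (car H) (car H)"
    "\<phi> \<in> Hom C (car B \<boxtimes> car H) (car H)"
  using assms
  by (auto simp: weak_twisted_rb_operator_def module_algebra_coalgebra_def coalgebra_morphism_def
      hopf_algebra_def nonunital_bialgebra_def)

lemma morphism_Hom:
  "hopf_algebra_morphism C H B f \<Longrightarrow> f \<in> Hom C (car H) (car B)"
  "nonunital_bialgebra_morphism C X Y g \<Longrightarrow> g \<in> Hom C (car X) (car Y)"
  by (auto simp: hopf_algebra_morphism_def nonunital_bialgebra_morphism_def coalgebra_morphism_def)

lemma HTr_sel:
  "Obj (HTr C) = {(H, H2, \<sigma>). hopf_truss C H H2 \<sigma>}"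
  "Dom (HTr C) = (\<lambda>(X, f, Y). X)" "Cod (HTr C) = (\<lambda>(X, f, Y). Y)"
  "Ident (HTr C) (H, H2, \<sigma>) = ((H, H2, \<sigma>), \<one> (car H), (H, H2, \<sigma>))"
  "Comp (HTr C) (Y', g, Z) (X, f, Y) = (X, g \<cdot> f, Z)"
  by (simp_all add: HTr_def)

lemma HTr_Hom:
  "x \<in> Hom (HTr C) (H, H2, \<sigma>) (B, B2, \<tau>) \<longleftrightarrow>
    (\<exists>f. x = ((H, H2, \<sigma>), f, (B, B2, \<tau>)) \<and> hopf_truss C H H2 \<sigma> \<and> hopf_truss C B B2 \<tau> \<and>
      hopf_algebra_morphism C H B f \<and> nonunital_bialgebra_morphism C H2 B2 f)"
  by (auto simp: Hom_def HTr_def)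

lemma category_HTr: "category (HTr C)"
proof
  show "Dom (HTr C) f \<in> Obj (HTr C)" "Cod (HTr C) f \<in> Obj (HTr C)" if "f \<in> Arr (HTr C)" for f
    using that by (auto simp: HTr_def)
  show "Ident (HTr C) X \<in> Hom (HTr C) X X" if "X \<in> Obj (HTr C)" for X
  proof -
    obtain H H2 \<sigma> where X: "X = (H, H2, \<sigma>)" by (cases X)
    then have t: "hopf_truss C H H2 \<sigma>" using that by (simp add: HTr_sel)
    show ?thesis
      using hopf_algebra_morphism_ident[OF hopf_trussD(1)[OF t]]
        nonunital_bialgebra_morphism_ident[OF hopf_trussD(2)[OF t]] hopf_trussD(3)[OF t] t
      by (simp add: X HTr_sel HTr_Hom)
  qed
  show "Comp (HTr C) g f \<in> Hom (HTr C) X Z"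
    if fg: "f \<in> Hom (HTr C) X Y" "g \<in> Hom (HTr C) Y Z" for f g X Y Z
  proof -
    obtain H H2 \<sigma> where X: "X = (H, H2, \<sigma>)" by (cases X)
    obtain B B2 \<tau> where Y: "Y = (B, B2, \<tau>)" by (cases Y)
    obtain D D2 \<rho> where Z: "Z = (D, D2, \<rho>)" by (cases Z)
    obtain f' where f: "f = (X, f', Y)" and t: "hopf_truss C H H2 \<sigma>" "hopf_truss C B B2 \<tau>"
      and f': "hopf_algebra_morphism C H B f'" "nonunital_bialgebra_morphism C H2 B2 f'"
      using fg(1) by (auto simp: X Y HTr_Hom)
    obtain g' where g: "g = (Y, g', Z)" and t': "hopf_truss C D D2 \<rho>"
      and g': "hopf_algebra_morphism C B D g'" "nonunital_bialgebra_morphism C B2 D2 g'"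
      using fg(2) by (auto simp: Y Z HTr_Hom)
    note d = hopf_trussD(1,2)[OF t(1)] hopf_trussD(1,2)[OF t(2)] hopf_trussD(1,2)[OF t']
    show ?thesis
      using hopf_algebra_morphism_comp[OF d(1,3,5) f'(1) g'(1)] t t'
        nonunital_bialgebra_morphism_comp[OF d(2,4,6) f'(2) g'(2)]
      by (simp add: f g X Z HTr_sel(5) HTr_Hom)
  qed
  show "Comp (HTr C) f (Ident (HTr C) X) = f" "Comp (HTr C) (Ident (HTr C) Y) f = f"
    if "f \<in> Hom (HTr C) X Y" for f X Y
    using that
    by (cases X; cases Y; auto simp: HTr_sel(4,5) HTr_Hom
        intro: Comp_Ident[OF morphism_Hom(1)] Ident_Comp[OF morphism_Hom(1)])+
  show "Comp (HTr C) (Comp (HTr C) h g) f = Comp (HTr C) h (Comp (HTr C) g f)"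
    if "f \<in> Hom (HTr C) W X" "g \<in> Hom (HTr C) X Y" "h \<in> Hom (HTr C) Y Z" for f g h W X Y Z
    using that
    by (cases W; cases X; cases Y; cases Z)
      (auto simp: HTr_sel(5) HTr_Hom intro!: Comp_assoc[OF morphism_Hom(1) morphism_Hom(1) morphism_Hom(1)])
qed

lemma wtrRB_sel:
  "Obj (wtrRB C) = {(H, B, T, \<phi>, \<Psi>). weak_twisted_rb_operator C H B T \<phi> \<Psi>}"
  "Dom (wtrRB C) = (\<lambda>(X, p, Y). X)" "Cod (wtrRB C) = (\<lambda>(X, p, Y). Y)"
  "Ident (wtrRB C) (H, B, T, \<phi>, \<Psi>) =
    ((H, B, T, \<phi>, \<Psi>), (\<one> (car H), \<one> (car B)), (H, B, T, \<phi>, \<Psi>))"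
  "Comp (wtrRB C) (Y', (f', g'), Z) (X, (f, g), Y) = (X, (f' \<cdot> f, g' \<cdot> g), Z)"
  by (simp_all add: wtrRB_def)

text \<open>The conditions on \<open>(f, g)\<close> to be a morphism of operators, apart from the source and target
  being operators.\<close>

definition rb_morphism :: "('a, 'b) rb_operator \<Rightarrow> 'b \<Rightarrow> 'b \<Rightarrow> ('a, 'b) rb_operator \<Rightarrow> bool"
  where "rb_morphism = (\<lambda>(H, B, T, \<phi>, \<Psi>) f g (H', B', T', \<phi>', \<Psi>').
    hopf_algebra_morphism C H H' f \<and> nonunital_bialgebra_morphism C B B' g \<and>
    T' \<cdot> f = g \<cdot> T \<and> f \<cdot> \<Psi> = \<Psi>' \<cdot> f \<and> f \<cdot> \<phi> = \<phi>' \<cdot> (g \<otimes> f))"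

lemma wtrRB_Hom:
  "x \<in> Hom (wtrRB C) X Y \<longleftrightarrow>
    (\<exists>f g. x = (X, (f, g), Y) \<and> X \<in> Obj (wtrRB C) \<and> Y \<in> Obj (wtrRB C) \<and> rb_morphism X f g Y)"
  by (cases X; cases Y) (auto simp: Hom_def wtrRB_def rb_morphism_def)

lemma rb_morphism_comp:
  assumes X: "X \<in> Obj (wtrRB C)" and Y: "Y \<in> Obj (wtrRB C)" and Z: "Z \<in> Obj (wtrRB C)"
    and fg: "rb_morphism X f g Y" and fg': "rb_morphism Y f' g' Z"
  shows "rb_morphism X (f' \<cdot> f) (g' \<cdot> g) Z"
proof -
  obtain H B T \<phi> \<Psi> where X': "X = (H, B, T, \<phi>, \<Psi>)" by (cases X)
  obtain H' B' T' \<phi>' \<Psi>' where Y': "Y = (H', B', T', \<phi>', \<Psi>')" by (cases Y)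
  obtain H'' B'' T'' \<phi>'' \<Psi>'' where Z': "Z = (H'', B'', T'', \<phi>'', \<Psi>'')" by (cases Z)
  have x: "weak_twisted_rb_operator C H B T \<phi> \<Psi>" and y: "weak_twisted_rb_operator C H' B' T' \<phi>' \<Psi>'"
    and z: "weak_twisted_rb_operator C H'' B'' T'' \<phi>'' \<Psi>''"
    using X Y Z by (simp_all add: X' Y' Z' wtrRB_sel)
  note x = weak_twisted_rb_operatorD[OF x] and y = weak_twisted_rb_operatorD[OF y]
    and z = weak_twisted_rb_operatorD[OF z]
  have m: "hopf_algebra_morphism C H H' f" "nonunital_bialgebra_morphism C B B' g"
    "hopf_algebra_morphism C H' H'' f'" "nonunital_bialgebra_morphism C B' B'' g'"
    and e: "T' \<cdot> f = g \<cdot> T" "f \<cdot> \<Psi> = \<Psi>' \<cdot> f" "f \<cdot> \<phi> = \<phi>' \<cdot> (g \<otimes> f)"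
    and e': "T'' \<cdot> f' = g' \<cdot> T'" "f' \<cdot> \<Psi>' = \<Psi>'' \<cdot> f'" "f' \<cdot> \<phi>' = \<phi>'' \<cdot> (g' \<otimes> f')"
    using fg fg' by (simp_all add: X' Y' Z' rb_morphism_def)
  note [simp] = x(3,4) y(3,4) z(3,4) HomD[OF x(5)] HomD[OF y(5)] HomD[OF z(5)]
    HomD[OF x(6)] HomD[OF y(6)] HomD[OF z(6)] HomD[OF x(7)] HomD[OF y(7)] HomD[OF z(7)]
    HomD[OF morphism_Hom(1)[OF m(1)]] HomD[OF morphism_Hom(2)[OF m(2)]]
    HomD[OF morphism_Hom(1)[OF m(3)]] HomD[OF morphism_Hom(2)[OF m(4)]]
  have "T'' \<cdot> f' \<cdot> f = (g' \<cdot> g) \<cdot> T"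
    by (simp add: comp_eq_comp[OF e'(1)] e(1))
  moreover have "(f' \<cdot> f) \<cdot> \<Psi> = \<Psi>'' \<cdot> f' \<cdot> f"
    by (simp add: comp_eq_comp[OF e'(2)] e(2))
  moreover have "(f' \<cdot> f) \<cdot> \<phi> = \<phi>'' \<cdot> ((g' \<cdot> g) \<otimes> (f' \<cdot> f))"
    by (simp add: comp_eq_comp[OF e'(3)] e(3) interchange)
  ultimately show ?thesis
    using hopf_algebra_morphism_comp[OF x(1) y(1) z(1) m(1) m(3)]
      nonunital_bialgebra_morphism_comp[OF x(2) y(2) z(2) m(2) m(4)]
    by (simp add: X' Z' rb_morphism_def)
qed

lemma rb_morphism_Hom:
  "rb_morphism (H, B, T, \<phi>, \<Psi>) f g (H', B', T', \<phi>', \<Psi>') \<Longrightarrow>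
    f \<in> Hom C (car H) (car H') \<and> g \<in> Hom C (car B) (car B')"
  by (auto simp: rb_morphism_def dest: morphism_Hom)

lemma category_wtrRB: "category (wtrRB C)"
proof
  show "Dom (wtrRB C) f \<in> Obj (wtrRB C)" "Cod (wtrRB C) f \<in> Obj (wtrRB C)"
    if "f \<in> Arr (wtrRB C)" for f
    using that by (auto simp: wtrRB_def)
  show "Ident (wtrRB C) X \<in> Hom (wtrRB C) X X" if "X \<in> Obj (wtrRB C)" for X
  proof -
    obtain H B T \<phi> \<Psi> where X: "X = (H, B, T, \<phi>, \<Psi>)" by (cases X)
    then have w: "weak_twisted_rb_operator C H B T \<phi> \<Psi>" using that by (simp add: wtrRB_sel)
    note w' = weak_twisted_rb_operatorD[OF w]
    note [simp] = w'(3,4) HomD[OF w'(5)] HomD[OF w'(6)] HomD[OF w'(7)]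
    show ?thesis
      using hopf_algebra_morphism_ident[OF w'(1)] nonunital_bialgebra_morphism_ident[OF w'(2)] that
      by (simp add: X wtrRB_sel(4) wtrRB_Hom rb_morphism_def)
  qed
  show "Comp (wtrRB C) g f \<in> Hom (wtrRB C) X Z"
    if "f \<in> Hom (wtrRB C) X Y" "g \<in> Hom (wtrRB C) Y Z" for f g X Y Z
    using that by (auto simp: wtrRB_sel(5) wtrRB_Hom intro: rb_morphism_comp)
  show "Comp (wtrRB C) f (Ident (wtrRB C) X) = f" "Comp (wtrRB C) (Ident (wtrRB C) Y) f = f"
    if "f \<in> Hom (wtrRB C) X Y" for f X Y
    using that
    by (cases X; cases Y; auto simp: wtrRB_sel(4,5) wtrRB_Hom
        intro: Comp_Ident Ident_Comp dest!: rb_morphism_Hom)+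
  show "Comp (wtrRB C) (Comp (wtrRB C) h g) f = Comp (wtrRB C) h (Comp (wtrRB C) g f)"
    if "f \<in> Hom (wtrRB C) W X" "g \<in> Hom (wtrRB C) X Y" "h \<in> Hom (wtrRB C) Y Z" for f g h W X Y Z
    using that
    by (cases W; cases X; cases Y; cases Z)
      (auto simp: wtrRB_sel(5) wtrRB_Hom intro!: Comp_assoc dest!: rb_morphism_Hom)
qed

section \<open>The functors and the adjunction\<close>

text \<open>The conditions on \<open>f\<close> to be a morphism of Hopf trusses, apart from the source and target being
  Hopf trusses.\<close>

definition truss_morphism :: "('a, 'b) truss \<Rightarrow> 'b \<Rightarrow> ('a, 'b) truss \<Rightarrow> bool"
  where "truss_morphism = (\<lambda>(H, H2, \<sigma>) f (B, B2, \<tau>).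
    hopf_algebra_morphism C H B f \<and> nonunital_bialgebra_morphism C H2 B2 f)"

lemma HTr_star_Obj:
  "(H, H2, \<sigma>) \<in> Obj (HTr_star C) \<longleftrightarrow> hopf_truss C H H2 \<sigma> \<and> star_condition C H (Gamma C H H2 \<sigma>)"
  by (simp add: HTr_star_def HTr_sel)

lemma wtrRB_star_Obj:
  "(H, B, T, \<phi>, \<Psi>) \<in> Obj (wtrRB_star C) \<longleftrightarrow>
    weak_twisted_rb_operator C H B T \<phi> \<Psi> \<and> star_condition C H (rb_action C H T \<phi>)"
  by (simp add: wtrRB_star_def wtrRB_sel)

lemma HTr_star_Hom:
  "x \<in> Hom (HTr_star C) X Y \<longleftrightarrow>
    (\<exists>f. x = (X, f, Y) \<and> X \<in> Obj (HTr_star C) \<and> Y \<in> Obj (HTr_star C) \<and> truss_morphism X f Y)"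
  by (cases X; cases Y)
    (auto simp: HTr_star_def Hom_full_subcategory HTr_Hom HTr_sel truss_morphism_def)

lemma wtrRB_star_Hom:
  "x \<in> Hom (wtrRB_star C) X Y \<longleftrightarrow>
    (\<exists>f g. x = (X, (f, g), Y) \<and> X \<in> Obj (wtrRB_star C) \<and> Y \<in> Obj (wtrRB_star C) \<and>
      rb_morphism X f g Y)"
  by (auto simp: wtrRB_star_def Hom_full_subcategory wtrRB_Hom)

lemma star_sel:
  "Ident (HTr_star C) (H, H2, \<sigma>) = ((H, H2, \<sigma>), \<one> (car H), (H, H2, \<sigma>))"
  "Comp (HTr_star C) (Y', g, Z) (X, f, Y) = (X, g \<cdot> f, Z)"
  "Ident (wtrRB_star C) (H, B, T, \<phi>, \<Psi>) =
    ((H, B, T, \<phi>, \<Psi>), (\<one> (car H), \<one> (car B)), (H, B, T, \<phi>, \<Psi>))"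
  "Comp (wtrRB_star C) (V', (f', g'), W) (U, (f'', g''), V) = (U, (f' \<cdot> f'', g' \<cdot> g''), W)"
  by (simp_all add: HTr_star_def wtrRB_star_def HTr_sel(4,5) wtrRB_sel(4,5))

lemma Lambda_obj:
  assumes "X \<in> Obj (HTr_star C)"
  shows "Lambda_obj C X \<in> Obj (wtrRB_star C)"
proof -
  obtain H H2 \<sigma> where X: "X = (H, H2, \<sigma>)" by (cases X)
  then have t: "hopf_truss C H H2 \<sigma>" "star_condition C H (Gamma C H H2 \<sigma>)"
    using assms by (simp_all add: HTr_star_Obj)
  then interpret truss C H H2 \<sigma> by unfold_locales
  show ?thesis
    using Lambda_operator[OF t(2)] by (simp add: X Lambda_obj_def wtrRB_star_Obj)
qed

lemma Lambda_morphism: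
  assumes X: "X \<in> Obj (HTr_star C)" and Y: "Y \<in> Obj (HTr_star C)" and f: "truss_morphism X f Y"
  shows "rb_morphism (Lambda_obj C X) f f (Lambda_obj C Y)"
proof -
  obtain H H2 \<sigma> where X': "X = (H, H2, \<sigma>)" by (cases X)
  obtain B B2 \<tau> where Y': "Y = (B, B2, \<tau>)" by (cases Y)
  have t: "hopf_truss C H H2 \<sigma>" "hopf_truss C B B2 \<tau>"
    and f': "hopf_algebra_morphism C H B f" "nonunital_bialgebra_morphism C H2 B2 f"
    using assms by (simp_all add: X' Y' HTr_star_Obj truss_morphism_def)
  show ?thesis
    using truss_morphism_twist_Gamma[OF t f'] f' HomD[OF morphism_Hom(1)[OF f'(1)]]
    by (simp add: X' Y' Lambda_obj_def rb_morphism_def)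
qed

lemma Omega_obj:
  assumes "Y \<in> Obj (wtrRB_star C)"
  shows "Omega_obj C Y \<in> Obj (HTr_star C)"
proof -
  obtain H B T \<phi> \<Psi> where Y: "Y = (H, B, T, \<phi>, \<Psi>)" by (cases Y)
  then interpret rb_operator C H B T \<phi> \<Psi>
    using assms by unfold_locales (simp_all add: wtrRB_star_Obj)
  show ?thesis
    using Omega_truss star by (simp add: Y Omega_obj_def HTr_star_Obj Gamma_eq_act)
qed

lemma Omega_morphism:
  assumes X: "X \<in> Obj (wtrRB_star C)" and Y: "Y \<in> Obj (wtrRB_star C)" and fg: "rb_morphism X f g Y"
  shows "truss_morphism (Omega_obj C X) f (Omega_obj C Y)"
proof -
  obtain H B T \<phi> \<Psi> where X': "X = (H, B, T, \<phi>, \<Psi>)" by (cases X)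
  obtain H' B' T' \<phi>' \<Psi>' where Y': "Y = (H', B', T', \<phi>', \<Psi>')" by (cases Y)
  interpret X: rb_operator C H B T \<phi> \<Psi>
    using X by unfold_locales (simp_all add: X' wtrRB_star_Obj)
  interpret Y: rb_operator C H' B' T' \<phi>' \<Psi>'
    using Y by unfold_locales (simp_all add: Y' wtrRB_star_Obj)
  have m: "hopf_algebra_morphism C H H' f" "nonunital_bialgebra_morphism C B B' g"
    and e: "T' \<cdot> f = g \<cdot> T" "f \<cdot> \<Psi> = \<Psi>' \<cdot> f" "f \<cdot> \<phi> = \<phi>' \<cdot> (g \<otimes> f)"
    using fg by (simp_all add: X' Y' rb_morphism_def)
  have cf: "coalgebra_morphism C H H' f" and f: "f \<cdot> \<mu>\<^bsub>H\<^esub> = \<mu>\<^bsub>H'\<^esub> \<cdot> (f \<otimes> f)"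
    using m(1) by (simp_all add: hopf_algebra_morphism_def)
  note [simp] = coalgebra_morphismD(2-4)[OF cf] HomD[OF morphism_Hom(2)[OF m(2)]]
  have 1: "f \<cdot> X.act = Y.act \<cdot> (f \<otimes> f)"
    by (simp add: rb_action_def comp_eq_comp[OF e(3)] e(1) interchange)
  have 2: "(f \<cdot> \<Psi>) \<otimes> (f \<cdot> X.act) = (\<Psi>' \<otimes> Y.act) \<cdot> (f \<otimes> f \<otimes> f)"
    by (simp add: 1 e(2) interchanges)
  have 3: "(f \<otimes> f \<otimes> f) \<cdot> (\<delta>\<^bsub>H\<^esub> \<otimes> \<one> (car H)) = (\<delta>\<^bsub>H'\<^esub> \<otimes> \<one> (car H')) \<cdot> (f \<otimes> f)"
    by (simp add: interchanges coalgebra_morphismD(6)[OF cf])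
  have "f \<cdot> X.mt = \<mu>\<^bsub>H'\<^esub> \<cdot> ((f \<cdot> \<Psi>) \<otimes> (f \<cdot> X.act)) \<cdot> (\<delta>\<^bsub>H\<^esub> \<otimes> \<one> (car H))"
    by (simp add: rb_product_def comp_eq_comp[OF f] interchange_comp)
  then have "f \<cdot> X.mt = Y.mt \<cdot> (f \<otimes> f)"
    unfolding 2 by (simp add: rb_product_def 3)
  then show ?thesis
    using m(1) cf
    by (simp add: X' Y' truss_morphism_def Omega_obj_def nonunital_bialgebra_morphism_def coalgebra_morphism_def)
qed

lemma category_star: "category (HTr_star C)" "category (wtrRB_star C)"
  unfolding HTr_star_def wtrRB_star_def
  by (rule category_full_subcategory category_HTr category_wtrRB)+

lemma functor_Lambda: "is_functor (HTr_star C) (wtrRB_star C) (Lambda C)"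
proof (intro is_functor.intro category_star is_functor_axioms.intro)
  show "OMap (Lambda C) X \<in> Obj (wtrRB_star C)" if "X \<in> Obj (HTr_star C)" for X
    using Lambda_obj[OF that] by (simp add: Lambda_def)
  show "AMap (Lambda C) x \<in> Hom (wtrRB_star C) (OMap (Lambda C) X) (OMap (Lambda C) Y)"
    if "x \<in> Hom (HTr_star C) X Y" for x X Y
    using that
    by (auto simp: HTr_star_Hom wtrRB_star_Hom Lambda_def intro: Lambda_obj Lambda_morphism)
  show "AMap (Lambda C) (Ident (HTr_star C) X) = Ident (wtrRB_star C) (OMap (Lambda C) X)"
    if "X \<in> Obj (HTr_star C)" for X
    using that by (cases X) (auto simp: HTr_star_Obj star_sel Lambda_def Lambda_obj_def hopf_truss_def)
  show "AMap (Lambda C) (Comp (HTr_star C) y x) =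
      Comp (wtrRB_star C) (AMap (Lambda C) y) (AMap (Lambda C) x)"
    if "x \<in> Hom (HTr_star C) X Y" "y \<in> Hom (HTr_star C) Y Z" for x y X Y Z
    using that by (auto simp: HTr_star_Hom star_sel Lambda_def)
qed

lemma functor_Omega: "is_functor (wtrRB_star C) (HTr_star C) (Omega C)"
proof (intro is_functor.intro category_star is_functor_axioms.intro)
  show "OMap (Omega C) X \<in> Obj (HTr_star C)" if "X \<in> Obj (wtrRB_star C)" for X
    using Omega_obj[OF that] by (simp add: Omega_def)
  show "AMap (Omega C) x \<in> Hom (HTr_star C) (OMap (Omega C) X) (OMap (Omega C) Y)"
    if "x \<in> Hom (wtrRB_star C) X Y" for x X Y
    using that
    by (auto simp: HTr_star_Hom wtrRB_star_Hom Omega_def intro: Omega_obj Omega_morphism)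
  show "AMap (Omega C) (Ident (wtrRB_star C) X) = Ident (HTr_star C) (OMap (Omega C) X)"
    if "X \<in> Obj (wtrRB_star C)" for X
    by (cases X) (auto simp: star_sel Omega_def Omega_obj_def)
  show "AMap (Omega C) (Comp (wtrRB_star C) y x) =
      Comp (HTr_star C) (AMap (Omega C) y) (AMap (Omega C) x)"
    if "x \<in> Hom (wtrRB_star C) X Y" "y \<in> Hom (wtrRB_star C) Y Z" for x y X Y Z
    using that by (auto simp: wtrRB_star_Hom star_sel Omega_def)
qed

text \<open>Morphisms out of \<open>\<Lambda> X\<close> correspond to morphisms into \<open>\<Omega> Y\<close>. From left to right, apply \<open>\<Omega>\<close>;
  the second product of \<open>\<Omega> (\<Lambda> X)\<close> is that of \<open>X\<close>.\<close>

lemma adjunct_iff: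
  assumes X: "X \<in> Obj (HTr_star C)" and Y: "(K, B, T, \<phi>, \<Psi>) \<in> Obj (wtrRB_star C)"
  shows "rb_morphism (Lambda_obj C X) f g (K, B, T, \<phi>, \<Psi>) \<longleftrightarrow>
    truss_morphism X f (Omega_obj C (K, B, T, \<phi>, \<Psi>)) \<and> g = T \<cdot> f"
proof -
  obtain H H2 \<sigma> where X': "X = (H, H2, \<sigma>)" by (cases X)
  have tH: "hopf_truss C H H2 \<sigma>" using X by (simp add: X' HTr_star_Obj)
  interpret H: truss C H H2 \<sigma> by unfold_locales (rule tH)
  interpret K: rb_operator C K B T \<phi> \<Psi>
    using Y by unfold_locales (simp_all add: wtrRB_star_Obj)
  have LX: "Lambda_obj C X = (H, H2, \<one> (car H), Gamma C H H2 \<sigma>, \<sigma>)"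
    by (simp add: X' Lambda_obj_def)
  have prod: "rb_product C H (\<one> (car H)) (Gamma C H H2 \<sigma>) \<sigma> = \<mu>\<^bsub>H2\<^esub>"
    using conv_proj1[of H H \<sigma> "Gamma C H H2 \<sigma>" "\<mu>\<^bsub>H\<^esub>"] H.product_eq
    by (simp add: rb_product_def rb_action_def)
  show ?thesis
  proof
    assume fg: "rb_morphism (Lambda_obj C X) f g (K, B, T, \<phi>, \<Psi>)"
    then have f: "hopf_algebra_morphism C H K f" and g: "nonunital_bialgebra_morphism C H2 B g"
      and e: "T \<cdot> f = g \<cdot> \<one> (car H)"
      by (simp_all add: LX rb_morphism_def)
    have "g = T \<cdot> f"
      using HomD[OF morphism_Hom(2)[OF g]] e by simp
    moreover have "truss_morphism (Omega_obj C (Lambda_obj C X)) f (Omega_obj C (K, B, T, \<phi>, \<Psi>))"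
      by (rule Omega_morphism[OF Lambda_obj[OF X] Y fg])
    then have "truss_morphism X f (Omega_obj C (K, B, T, \<phi>, \<Psi>))"
      using prod by (simp add: X' Lambda_obj_def Omega_obj_def truss_morphism_def
          nonunital_bialgebra_morphism_def coalgebra_morphism_def)
    ultimately show "truss_morphism X f (Omega_obj C (K, B, T, \<phi>, \<Psi>)) \<and> g = T \<cdot> f"
      by simp
  next
    assume asm: "truss_morphism X f (Omega_obj C (K, B, T, \<phi>, \<Psi>)) \<and> g = T \<cdot> f"
    then have f: "hopf_algebra_morphism C H K f" "nonunital_bialgebra_morphism C H2 K.Ht f"
      and g: "g = T \<cdot> f"
      by (simp_all add: X' Omega_obj_def truss_morphism_def)
    have cf: "coalgebra_morphism C H K f"
      using f(1) by (simp add: hopf_algebra_morphism_def)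
    note [simp] = coalgebra_morphismD(2-4)[OF cf]
    have m2: "f \<cdot> \<mu>\<^bsub>H2\<^esub> = K.mt \<cdot> (f \<otimes> f)"
      using f(2) by (simp add: nonunital_bialgebra_morphism_def)
    have s: "f \<cdot> \<sigma> = \<Psi> \<cdot> f" "f \<cdot> Gamma C H H2 \<sigma> = K.act \<cdot> (f \<otimes> f)"
      using truss_morphism_twist_Gamma[OF tH K.Omega_truss f] by (simp_all add: K.Gamma_eq_act)
    have "(T \<cdot> f) \<cdot> \<mu>\<^bsub>H2\<^esub> = \<mu>\<^bsub>B\<^esub> \<cdot> ((T \<cdot> f) \<otimes> (T \<cdot> f))"
      by (simp add: m2 comp_eq_comp[OF K.rb_product_T] interchange)
    moreover have "coalgebra_morphism C H2 B (T \<cdot> f)"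
      using coalgebra_morphism_comp[OF H.h(1) K.h(1) _ cf K.rb_morphisms(1)]
      by (simp add: coalgebra_morphism_def)
    ultimately have "nonunital_bialgebra_morphism C H2 B g"
      by (simp add: g nonunital_bialgebra_morphism_def)
    moreover have "K.act \<cdot> (f \<otimes> f) = \<phi> \<cdot> (g \<otimes> f)"
      by (simp add: g rb_action_def interchange)
    ultimately show "rb_morphism (Lambda_obj C X) f g (K, B, T, \<phi>, \<Psi>)"
      using f(1) s by (simp add: LX rb_morphism_def g)
  qed
qed

lemma adjunction_Lambda_Omega: "left_adjoint (HTr_star C) (wtrRB_star C) (Lambda C) (Omega C)"
proof -
  define \<Phi> :: "('a, 'b) truss \<Rightarrow> ('a, 'b) rb_operator \<Rightarrow>
      ('a, 'b) rb_operator \<times> ('b \<times> 'b) \<times> ('a, 'b) rb_operator \<Rightarrow> ('a, 'b) truss \<times> 'b \<times> ('a, 'b) truss"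
    where "\<Phi> = (\<lambda>X Y (_, (f, g), _). (X, f, Omega_obj C Y))"
  have "bij_betw (\<Phi> X Y) (Hom (wtrRB_star C) (OMap (Lambda C) X) Y)
      (Hom (HTr_star C) X (OMap (Omega C) Y))"
    if X: "X \<in> Obj (HTr_star C)" and Y: "Y \<in> Obj (wtrRB_star C)" for X Y
  proof -
    obtain K B T \<phi> \<Psi> where Y': "Y = (K, B, T, \<phi>, \<Psi>)" by (cases Y)
    note iff = adjunct_iff[OF X Y[unfolded Y'], folded Y']
    let ?S = "{f. truss_morphism X f (Omega_obj C Y)}"
    have "Hom (wtrRB_star C) (Lambda_obj C X) Y = (\<lambda>f. (Lambda_obj C X, (f, T \<cdot> f), Y)) ` ?S"
      by (rule set_eqI) (simp add: wtrRB_star_Hom iff Y Lambda_obj[OF X] image_iff, blast)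
    moreover have "Hom (HTr_star C) X (Omega_obj C Y) = (\<lambda>f. (X, f, Omega_obj C Y)) ` ?S"
      by (rule set_eqI) (simp add: HTr_star_Hom X Omega_obj[OF Y] image_iff, blast)
    ultimately show ?thesis
      unfolding bij_betw_def inj_on_def by (auto simp: \<Phi>_def Lambda_def Omega_def image_iff)
  qed
  moreover have "\<Phi> X' Y' (Comp (wtrRB_star C) k (Comp (wtrRB_star C) x (AMap (Lambda C) h))) =
      Comp (HTr_star C) (AMap (Omega C) k) (Comp (HTr_star C) (\<Phi> X Y x) h)"
    if "h \<in> Hom (HTr_star C) X' X" "k \<in> Hom (wtrRB_star C) Y Y'"
      "x \<in> Hom (wtrRB_star C) (OMap (Lambda C) X) Y" for X X' Y Y' h k x
    using that
    by (auto simp: \<Phi>_def HTr_star_Hom wtrRB_star_Hom star_sel Lambda_def Omega_def)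
  ultimately show ?thesis
    unfolding left_adjoint_def using functor_Lambda functor_Omega by blast
qed

end

theorem theorem4p11:
  fixes C :: "('o, 'm, 'c) braided_category_scheme"
  assumes "strict_braided_monoidal_category C"
  shows "left_adjoint (HTr_star C) (wtrRB_star C) (Lambda C) (Omega C)"
  using strict_braided_monoidal_category.adjunction_Lambda_Omega[OF assms] .

end
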